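(* Let $\mu\neq0$, $\sigma>0$ be constants, and let $X_t=\mu t+\sigma B_t$, $t\ge 0$, with $B$ a standard Brownian motion (so $X_0=0$). Let $q>0$, let $\mathbf{e}_q$ be an exponential random variable with parameter $q$ independent of $X$, and put $\delta=\mu/\sigma^2$, $\gamma=\sqrt{\delta^2+2q/\sigma^2}$. Then: If $a\ge b>0$, $$\mathbb{P}_0(\sigma_a<\hat\sigma_b\wedge\mathbf{e}_q)=\frac{\sigma^2\gamma}{2q}\left(\frac{e^{-\delta b}(\gamma\coth[\gamma b]+\delta)}{\sinh[\gamma b]}-\frac{\gamma}{\sinh^2[\gamma b]}\right)e^{-(a-b)(\delta+\gamma\coth[\gamma b])};$$ if $b>a>0$, $$\mathbb{P}_0(\sigma_a<\hat\sigma_b\wedge\mathbf{e}_q)=\frac{1-\frac{\sigma^2\gamma}{2q}\left(\frac{e^{\delta a}(\gamma\coth[\gamma a]-\delta)}{\sinh[\gamma a]}-\frac{\gamma}{\sinh^2[\gamma a]}\right)e^{-(b-a)(-\delta+\gamma\coth[\gamma a])}}{\gamma\cosh[\gamma a]-\delta\sinh[\gamma a]}\;\gamma e^{-\delta a}.$$ If $b\ge a>0$, $$\mathbb{P}_0(\hat\sigma_b<\sigma_a\wedge\mathbf{e}_q)=\frac{\sigma^2\gamma}{2q}\left(\frac{e^{\delta a}(\gamma\coth[\gamma a]-\delta)}{\sinh[\gamma a]}-\frac{\gamma}{\sinh^2[\gamma a]}\right)e^{-(b-a)(-\delta+\gamma\coth[\gamma a])};$$ if $a>b>0$, $$\mathbb{P}_0(\hat\sigma_b<\sigma_a\wedge\mathbf{e}_q)=\frac{1-\frac{\sigma^2\gamma}{2q}\left(\frac{e^{-\delta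 b}(\gamma\coth[\gamma b]+\delta)}{\sinh[\gamma b]}-\frac{\gamma}{\sinh^2[\gamma b]}\right)e^{-(a-b)(\delta+\gamma\coth[\gamma b])}}{\gamma\cosh[\gamma b]+\delta\sinh[\gamma b]}\;\gamma e^{\delta b}.$$
   Context: Drawdown process: $Y_t=\sup_{0\le s\le t}X_s-X_t$; drawup process: $\hat Y_t=X_t-\inf_{0\le s\le t}X_s$. For $c>0$, $\sigma_c=\inf\{t\ge0:Y_t\ge c\}$ and $\hat\sigma_c=\inf\{t\ge0:\hat Y_t\ge c\}$ (the symbol $\sigma$ without subscript is the diffusion coefficient). $\mathbb{P}_0$ is probability given $X_0=0$. *)

theory Defs
  imports "HOL-Probability.Probability"
begin

definition coth :: "real \<Rightarrow> real" where
  "coth x = cosh x / sinh x"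

text \<open>
  The time index is \<^typ>\<open>real\<close>; only nonnegative times are constrained. Every path is
  continuous, so that functionals of whole paths such as the hitting times below are
  measurable without completing the probability space; the start in 0 is almost sure.
\<close>

locale standard_brownian_motion = prob_space M
  for M :: "'a measure" +
  fixes B :: "real \<Rightarrow> 'a \<Rightarrow> real"
  assumes random_variable: "\<And>t. 0 \<le> t \<Longrightarrow> B t \<in> borel_measurable M"
    and start: "AE w in M. B 0 w = 0"
    and continuous_paths: "\<And>w. w \<in> space M \<Longrightarrow> continuous_on {0..} (\<lambda>t. B t w)"
    and normal_increments: "\<And>s t. 0 \<le> s \<Longrightarrow> s < t \<Longrightarrow>
      distributed M lborel (\<lambda>w. B t w - B s w) (normal_density 0 (sqrt (t - s)))"
    and independent_increments: "\<And>(n::nat) (t :: nat \<Rightarrow> real).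
      0 \<le> t 0 \<Longrightarrow> (\<And>i. i < n \<Longrightarrow> t i < t (Suc i)) \<Longrightarrow>
      indep_vars (\<lambda>_. borel) (\<lambda>i w. B (t (Suc i)) w - B (t i) w) {..<n}"

text \<open>
  Drawdown and drawup of a single path. For paths that are continuous on \<open>{0..}\<close> the supremum
  and the infimum range over nonempty bounded sets, so the real-valued \<open>SUP\<close> and \<open>INF\<close> are
  the genuine ones.
\<close>

definition drawdown :: "(real \<Rightarrow> real) \<Rightarrow> real \<Rightarrow> real" where
  "drawdown x t = (SUP s\<in>{0..t}. x s) - x t"

definition drawup :: "(real \<Rightarrow> real) \<Rightarrow> real \<Rightarrow> real" where
  "drawup x t = x t - (INF s\<in>{0..t}. x s)"

text \<open>Extended-real valued, with value \<open>\<infinity>\<close> (the infimum of the empty set) if the level is never reached.\<close>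

definition drawdown_time :: "real \<Rightarrow> (real \<Rightarrow> real) \<Rightarrow> ereal" where
  "drawdown_time c x = Inf {ereal t | t. 0 \<le> t \<and> c \<le> drawdown x t}"

definition drawup_time :: "real \<Rightarrow> (real \<Rightarrow> real) \<Rightarrow> ereal" where
  "drawup_time c x = Inf {ereal t | t. 0 \<le> t \<and> c \<le> drawup x t}"

end

theory Submission
  imports Defs
begin

text \<open>
  For mesh \<open>\<epsilon>\<close>, let \<open>\<tau>\<^sub>k\<close> be the successive times at which \<open>X\<close> has moved by \<open>\<epsilon>\<close>. Optional stopping
  of the two martingales \<open>exp (c * X\<^sub>t - q * t)\<close>, \<open>c = - \<delta> \<plusminus> \<gamma>\<close>, shows that \<open>X\<close> at these times,
  killed at \<open>e\<close>, is a random walk on \<open>\<epsilon>\<int>\<close> whose up and down steps have the defective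
  probabilities \<open>exp (\<plusminus> \<delta> * \<epsilon>) / (2 * cosh (\<gamma> * \<epsilon>))\<close>. Drawdown and drawup of the walk and of \<open>X\<close>
  differ by less than \<open>2 * \<epsilon>\<close>, so the probability in question lies between two passage
  probabilities of the walk. These have closed forms: the passage probability is the only bounded
  harmonic function with the right boundary values, because the walk is killed at a positive rate.
  Once the drawdown reaches \<open>b\<close> before the drawup does, the walk sits at its minimum, and each further
  step down costs the same factor, which produces the exponential in \<open>a - b\<close>. If the drawup
  reaches \<open>b > a\<close> first, the walk sits at its maximum and starts afresh towards drawdown \<open>a\<close>. Letting
  \<open>\<epsilon> \<rightarrow> 0\<close> gives the formulas for the drawdown, and reflection those for the drawup.
\<close>

subsection \<open>The lattice walk\<close>

text \<open>The embedding of the walk is exact, so no invariance principle is needed, and its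
  passage probabilities can be guessed and verified: at height x in mesh units the harmonic
  functions are \<open>E ^ x\<close> times combinations of \<open>exp (h * x)\<close> and
  \<open>exp (- h * x)\<close>, and the behaviour at new extrema fixes the coefficients. Two
  martingales occur because a step has two unknowns, the discounted expectations of going up and of
  going down. The strong Markov property is avoided: the one-step identity holds for every stopping
  time at which the path sits at a fixed level. A step that goes the other way is the stopping time
  \<infinity>, with discount 0, so that an induction on the number of steps multiplies discounted
  expectations. Independence turns killing into that discount: P(S < e) = E exp(- q S). The
  \<open>coth\<close> in the exponent comes from \<open>s K / s (Suc K)\<close> being raised to a
  power of order 1/\<epsilon>. The factor \<open>\<sigma>\<^sup>2 * \<gamma> / (2 * q)\<close> comes
  from summing over the final maximum: the sum has a denominator that behaves like \<epsilon>
  squared times \<open>\<gamma>\<^sup>2 - \<delta>\<^sup>2 = 2 * q /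
  \<sigma>\<^sup>2\<close>.\<close>

text \<open>
  The state \<open>(i, j)\<close> records drawdown and drawup of the walk in units of the mesh. Truncated
  subtraction implements the reflection at the running extrema, and the deficit
  \<open>1 - (p + r)\<close> is the probability of being killed during a step.
\<close>

fun walk_prob :: "real \<Rightarrow> real \<Rightarrow> nat \<Rightarrow> nat \<Rightarrow> nat \<Rightarrow> nat \<Rightarrow> nat \<Rightarrow> real" where
  "walk_prob p r N K 0 i j = (if N \<le> i then 1 else 0)"
| "walk_prob p r N K (Suc n) i j =
    (if N \<le> i then 1 else if K \<le> j then 0
     else p * walk_prob p r N K n (i - 1) (j + 1) + r * walk_prob p r N K n (i + 1) (j - 1))"

text \<open>\<open>walk_prob\<close> and \<open>\<phi>\<close> obey the same one-step recursion, so
  each further step allowed shrinks their difference by the factor \<open>p + r\<close>.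
  \<open>I\<close> is a finite set of states that interior steps do not leave: it bounds
  \<open>\<phi>\<close>, which starts the induction, and limits where harmonicity has to be
  checked.\<close>

lemma walk_prob_limit:
  fixes \<phi> :: "nat \<Rightarrow> nat \<Rightarrow> real"
  assumes p: "0 \<le> p" "0 \<le> r" "p + r < 1"
    and fin: "finite {(i, j). I i j}"
    and up: "\<And>i j. I i j \<Longrightarrow> N \<le> i \<Longrightarrow> \<phi> i j = 1"
    and lo: "\<And>i j. I i j \<Longrightarrow> i < N \<Longrightarrow> K \<le> j \<Longrightarrow> \<phi> i j = 0"
    and step: "\<And>i j. I i j \<Longrightarrow> i < N \<Longrightarrow> j < K \<Longrightarrow> I (i - 1) (j + 1) \<and> I (i + 1) (j - 1)
       \<and> \<phi> i j = p * \<phi> (i - 1) (j + 1) + r * \<phi> (i + 1) (j - 1)"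
    and init: "I i0 j0"
  shows "(\<lambda>n. walk_prob p r N K n i0 j0) \<longlonglongrightarrow> \<phi> i0 j0"
proof -
  obtain C where C: "\<And>i j. I i j \<Longrightarrow> \<bar>\<phi> i j\<bar> \<le> C" and C0: "0 \<le> C"
  proof
    let ?S = "(\<lambda>(i, j). \<bar>\<phi> i j\<bar>) ` {(i, j). I i j}"
    show "\<bar>\<phi> i j\<bar> \<le> Max (insert 0 ?S)" if "I i j" for i j
      by (rule Max_ge) (use fin that in auto)
    show "0 \<le> Max (insert 0 ?S)"
      by (rule Max_ge) (use fin in auto)
  qed
  have bound: "I i j \<Longrightarrow> \<bar>walk_prob p r N K n i j - \<phi> i j\<bar> \<le> C * (p + r) ^ n" for n i j
  proof (induction n arbitrary: i j)
    case 0
    show ?case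
    proof (cases "N \<le> i")
      case True
      then show ?thesis using up[OF 0 True] C0 by simp
    next
      case False
      then show ?thesis using C[OF 0] by simp
    qed
  next
    case (Suc n)
    have nn: "0 \<le> C * (p + r) ^ Suc n" using C0 p by simp
    consider "N \<le> i" | "i < N" "K \<le> j" | "i < N" "j < K" by linarith
    then show ?case
    proof cases
      case 1
      then show ?thesis using up[OF Suc.prems 1] nn by simp
    next
      case 2
      then show ?thesis using lo[OF Suc.prems 2] nn by simp
    next
      case 3
      let ?u = "walk_prob p r N K n (i - 1) (j + 1) - \<phi> (i - 1) (j + 1)"
      let ?d = "walk_prob p r N K n (i + 1) (j - 1) - \<phi> (i + 1) (j - 1)"
      have inv: "I (i - 1) (j + 1)" "I (i + 1) (j - 1)"
        and eq: "\<phi> i j = p * \<phi> (i - 1) (j + 1) + r * \<phi> (i + 1) (j - 1)"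
        using step[OF Suc.prems 3] by blast+
      have "walk_prob p r N K (Suc n) i j - \<phi> i j = p * ?u + r * ?d"
        unfolding eq using 3 by (simp add: right_diff_distrib)
      also have "\<bar>\<dots>\<bar> \<le> p * \<bar>?u\<bar> + r * \<bar>?d\<bar>"
        by (rule order_trans[OF abs_triangle_ineq]) (simp add: abs_mult p)
      also have "\<dots> \<le> p * (C * (p + r) ^ n) + r * (C * (p + r) ^ n)"
        using Suc.IH[OF inv(1)] Suc.IH[OF inv(2)] p(1,2) by (intro add_mono mult_left_mono)
      also have "\<dots> = C * (p + r) ^ Suc n" by (simp add: algebra_simps)
      finally show ?thesis .
    qed
  qed
  have "(\<lambda>n. C * (p + r) ^ n) \<longlonglongrightarrow> 0"
    by (rule tendsto_mult_right_zero, rule LIMSEQ_realpow_zero) (use p in auto)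
  then have "(\<lambda>n. walk_prob p r N K n i0 j0 - \<phi> i0 j0) \<longlonglongrightarrow> 0"
    by (rule Lim_null_comparison[rotated]) (use bound[OF init] in simp)
  then show ?thesis by (simp add: LIM_zero_iff)
qed

text \<open>For mesh \<open>\<epsilon>\<close> the parameters will be \<open>h = \<gamma> * \<epsilon>\<close> and \<open>E = exp (- \<delta> * \<epsilon>)\<close>.\<close>

locale tilted_walk =
  fixes h E :: real
  assumes h_pos: "0 < h" and E_pos: "0 < E" and E_less: "E + 1 / E < 2 * cosh h"
begin

section \<open>Harmonic functions of the killed walk\<close>

definition s :: "nat \<Rightarrow> real" where "s k = sinh (real k * h)"

lemma s_0 [simp]: "s 0 = 0" by (simp add: s_def)

definition up :: real where "up = 1 / (2 * cosh h * E)"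
definition down :: real where "down = E / (2 * cosh h)"

lemma s_pos: "0 < k \<Longrightarrow> 0 < s k"
  using h_pos by (simp add: s_def)

lemma s_add: "s k + s (Suc (Suc k)) = 2 * cosh h * s (Suc k)"
proof -
  have "real (Suc (Suc k)) * h = real (Suc k) * h + h" "real k * h = real (Suc k) * h - h"
    by (simp_all add: algebra_simps)
  then show ?thesis unfolding s_def by (simp only: sinh_add sinh_diff) simp
qed

lemma up_down: "0 < up" "0 < down" "up + down < 1"
proof -
  show "0 < up" "0 < down" using E_pos by (simp_all add: up_def down_def)
  have "up + down = (E + 1 / E) / (2 * cosh h)"
    using E_pos by (simp add: up_def down_def field_simps)
  also have "\<dots> < 1" using E_less cosh_real_pos[of h] by (simp add: field_simps)
  finally show "up + down < 1" .
qed

lemma up_E: "up * (E * x) = x / (2 * cosh h)" "down * (x / E) = x / (2 * cosh h)"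
  "up * x = (x / E) / (2 * cosh h)" "down * x = E * x / (2 * cosh h)"
  using E_pos by (simp_all add: up_def down_def)

lemma step_eq: "x + y = 2 * cosh h * z \<Longrightarrow> x / (2 * cosh h) + y / (2 * cosh h) = z"
  using cosh_real_pos[of h] by (simp flip: add_divide_distrib)

text \<open>Tilting by \<open>E ^ x\<close> turns both step weights into
  \<open>1 / (2 * cosh h)\<close>, and \<open>s_add\<close> does the rest. This version is the
  harmonic function \<open>E ^ x * s (c - x)\<close> of the height x; the next two are
  \<open>E ^ x * s (c + x)\<close> with nonpositive and nonnegative exponent, separate because
  exponents are natural numbers.\<close>

lemma harmonic_E:
  "up * (E ^ Suc (Suc n) * s k) + down * (E ^ n * s (Suc (Suc k))) = E ^ Suc n * s (Suc k)"
proof -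
  have "up * (E ^ Suc (Suc n) * s k) + down * (E ^ n * s (Suc (Suc k)))
      = (E ^ Suc n * s k) / (2 * cosh h) + (E ^ Suc n * s (Suc (Suc k))) / (2 * cosh h)"
    using up_E(1)[of "E ^ Suc n * s k"] up_E(4)[of "E ^ n * s (Suc (Suc k))"] by (simp add: mult.assoc)
  also have "\<dots> = E ^ Suc n * s (Suc k)"
    by (rule step_eq, unfold distrib_left[symmetric] s_add) (rule mult.left_commute)
  finally show ?thesis .
qed

lemma harmonic_inverse_E:
  "up * ((1 / E) ^ n * s (Suc (Suc k))) + down * ((1 / E) ^ Suc (Suc n) * s k) = (1 / E) ^ Suc n * s (Suc k)"
proof -
  have "up * ((1 / E) ^ n * s (Suc (Suc k))) + down * ((1 / E) ^ Suc (Suc n) * s k)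
      = ((1 / E) ^ Suc n * s (Suc (Suc k))) / (2 * cosh h) + ((1 / E) ^ Suc n * s k) / (2 * cosh h)"
    using up_E(3)[of "(1 / E) ^ n * s (Suc (Suc k))"] up_E(2)[of "(1 / E) ^ Suc n * s k"] by simp
  also have "\<dots> = (1 / E) ^ Suc n * s (Suc k)"
    by (rule step_eq, subst add.commute, unfold distrib_left[symmetric] s_add) (rule mult.left_commute)
  finally show ?thesis .
qed

lemma harmonic_E':
  "up * (E ^ Suc (Suc n) * s (Suc (Suc k))) + down * (E ^ n * s k) = E ^ Suc n * s (Suc k)"
proof -
  have "up * (E ^ Suc (Suc n) * s (Suc (Suc k))) + down * (E ^ n * s k)
      = (E ^ Suc n * s (Suc (Suc k))) / (2 * cosh h) + (E ^ Suc n * s k) / (2 * cosh h)"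
    using up_E(1)[of "E ^ Suc n * s (Suc (Suc k))"] up_E(4)[of "E ^ n * s k"] by (simp add: mult.assoc)
  also have "\<dots> = E ^ Suc n * s (Suc k)"
    by (rule step_eq, subst add.commute, unfold distrib_left[symmetric] s_add) (rule mult.left_commute)
  finally show ?thesis .
qed

section \<open>Two-sided passage: the sum over the final maximum\<close>

definition tilted_sum :: "nat \<Rightarrow> real" where "tilted_sum n = (\<Sum>k\<le>n. E ^ k * s k)"

lemma tilted_sum_0 [simp]: "tilted_sum 0 = 0" by (simp add: tilted_sum_def)
lemma tilted_sum_Suc: "tilted_sum (Suc n) = tilted_sum n + E ^ Suc n * s (Suc n)" by (simp add: tilted_sum_def)

text \<open>Induction with the three-term recurrence of \<open>s\<close>. The factor on the left is
  positive by \<open>E_less\<close> and is the source of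
  \<open>\<gamma>\<^sup>2 - \<delta>\<^sup>2\<close> in the limit.\<close>

lemma tilted_sum_closed: "(2 * cosh h - E - 1 / E) * tilted_sum n = E ^ n * (s (Suc n) - E * s n) - s 1"
proof (induction n)
  case (Suc n)
  have e: "s (Suc (Suc n)) = 2 * cosh h * s (Suc n) - s n" using s_add[of n] by simp
  have "(2 * cosh h - E - 1 / E) * (E * y) = (2 * cosh h - E) * E * y - y" for y
    using E_pos by (simp add: left_diff_distrib)
  from this[of "E ^ n * s (Suc n)"]
  show ?case unfolding tilted_sum_Suc distrib_left Suc.IH e power_Suc mult.assoc
    by (simp add: algebra_simps)
qed simp

text \<open>\<open>tilted_sum\<close> is harmonic up to a defect that does not depend on
  \<open>n\<close>, even at \<open>n = 0\<close>, where \<open>n - 1\<close> truncates as for a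
  reflected walk. \<open>first_exit\<close> contains a difference of two such sums, in which the
  defect cancels.\<close>

lemma tilted_sum_step: "up * tilted_sum (Suc n) + down * tilted_sum (n - 1) = tilted_sum n + s 1 / (2 * cosh h)"
proof (cases n)
  case 0
  then show ?thesis using up_E(1)[of "s 1"] by (simp add: tilted_sum_Suc)
next
  case (Suc m)
  show ?thesis unfolding Suc
  proof (simp only: diff_Suc_1, induction m)
    case 0
    show ?case using harmonic_E'[of 0 0] up_E(1)[of "s 1"]
      by (simp add: tilted_sum_Suc distrib_left)
  next
    case (Suc m)
    then show ?case using harmonic_E'[of "Suc m" "Suc m"]
      by (simp only: tilted_sum_Suc diff_Suc_1 distrib_left)
  qed
qed

text \<open>Discounted probability that the walk falls by 1 before it rises by \<open>K\<close>.\<close>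

definition ratio :: "nat \<Rightarrow> real" where "ratio K = E * s K / s (Suc K)"

text \<open>
  Discounted probability that the range of the walk first reaches \<open>K\<close> at the bottom: the first
  term is the contribution of paths that do not raise their maximum any more, the sum runs over
  the possible values of the final maximum.
\<close>

definition first_exit :: "nat \<Rightarrow> nat \<Rightarrow> nat \<Rightarrow> real" where
  "first_exit K i j = E ^ (K - i) * s (Suc i) / s (Suc K) + s 1 / (s K * s (Suc K)) * (tilted_sum (K - i - 1) - tilted_sum j)"

text \<open>While the range \<open>i + j\<close> is below \<open>K\<close>, it must first reach
  \<open>K\<close> at the bottom; then the minimum has to drop \<open>N - K\<close> more times, at
  cost \<open>ratio K\<close> each. Once the range is at least \<open>K\<close>, the maximum is
  frozen, since raising it would complete the drawup; \<open>E ^ j * s (K - j) / s K\<close> is then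
  the discounted probability of falling by \<open>j\<close> to the minimum before rising by
  \<open>K - j\<close>.\<close>

definition drawdown_first :: "nat \<Rightarrow> nat \<Rightarrow> nat \<Rightarrow> nat \<Rightarrow> real" where
  "drawdown_first N K i j =
    (if i + j < K then ratio K ^ (N - K) * first_exit K i j
     else ratio K ^ (N - (i + j)) * (E ^ j * s (K - j) / s K))"

lemma first_exit_top: "0 < K \<Longrightarrow> first_exit K 0 K = 0"
proof -
  assume "0 < K"
  then obtain m where K: "K = Suc m" by (cases K) auto
  show ?thesis using s_pos[of K] s_pos[of "Suc K"]
    by (simp add: first_exit_def K tilted_sum_Suc field_simps)
qed

lemma first_exit_bottom: "0 < K \<Longrightarrow> first_exit K K 0 = 1"
  using s_pos[of "Suc K"] by (simp add: first_exit_def)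

lemma first_exit_step:
  assumes "i + j < K"
  shows "first_exit K i j = up * first_exit K (i - 1) (j + 1) + down * first_exit K (i + 1) (j - 1)"
proof -
  define \<kappa> where "\<kappa> = s 1 / (s K * s (Suc K))"
  obtain m where K: "K = Suc (i + m)" using assms by (metis less_iff_Suc_add add_lessD1)
  have pos: "0 < s K" "0 < s (Suc K)" using s_pos assms by auto
  have \<kappa>: "\<kappa> * s K = s 1 / s (Suc K)" using pos by (simp add: \<kappa>_def)
  \<comment> \<open>For \<open>i = 0\<close> a step up raises the maximum and \<open>i - 1\<close>
    truncates to 0. The value there agrees with the general formula continued to drawdown -1, where
    \<open>s 0 = 0\<close> kills the first term: this is the reflecting boundary condition at the
    maximum.\<close>
  have shift: "first_exit K (i - 1) (j + 1) = E ^ Suc (Suc m) * s i / s (Suc K) + \<kappa> * (tilted_sum (Suc m) - tilted_sum (Suc j))"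
  proof (cases i)
    case 0
    have "first_exit K 0 (j + 1) = E ^ K * s 1 / s (Suc K) + \<kappa> * (tilted_sum m - tilted_sum (Suc j))"
      by (simp add: first_exit_def \<kappa>_def K 0)
    also have "E ^ K * s 1 / s (Suc K) = \<kappa> * (E ^ K * s K)"
      by (simp only: mult.left_commute[of \<kappa>] \<kappa>) simp
    also have "\<dots> + \<kappa> * (tilted_sum m - tilted_sum (Suc j)) = \<kappa> * (tilted_sum (Suc m) - tilted_sum (Suc j))"
      by (simp add: tilted_sum_Suc[of m] K 0 algebra_simps)
    finally show ?thesis by (simp add: 0)
  next
    case (Suc l)
    then show ?thesis by (simp add: first_exit_def \<kappa>_def K)
  qed
  have d: "first_exit K (i + 1) (j - 1) = E ^ m * s (Suc (Suc i)) / s (Suc K) + \<kappa> * (tilted_sum (m - 1) - tilted_sum (j - 1))"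
    by (simp add: first_exit_def \<kappa>_def K)
  have "up * first_exit K (i - 1) (j + 1) + down * first_exit K (i + 1) (j - 1)
      = (up * (E ^ Suc (Suc m) * s i) + down * (E ^ m * s (Suc (Suc i)))) / s (Suc K)
        + \<kappa> * ((up * tilted_sum (Suc m) + down * tilted_sum (m - 1)) - (up * tilted_sum (Suc j) + down * tilted_sum (j - 1)))"
    unfolding shift d by (simp only: add_divide_distrib right_diff_distrib distrib_left times_divide_eq_right mult.left_commute)
  also have "\<dots> = E ^ Suc m * s (Suc i) / s (Suc K) + \<kappa> * (tilted_sum m - tilted_sum j)"
    unfolding harmonic_E tilted_sum_step by simp
  also have "\<dots> = first_exit K i j" by (simp add: first_exit_def \<kappa>_def K)
  finally show ?thesis by simp
qed

text \<open>Matches the two branches of \<open>drawdown_first\<close> where they meet. The two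
  corners suffice, because the range grows only when the walk sets a new extremum, that is with
  \<open>i = 0\<close> or \<open>j = 0\<close> afterwards.\<close>

lemma drawdown_first_diag:
  assumes "i + j = K" "0 < K" "i = 0 \<or> j = 0"
  shows "drawdown_first N K i j = ratio K ^ (N - K) * first_exit K i j"
  using assms first_exit_top[of K] first_exit_bottom[of K] s_pos[of K]
  by (auto simp: drawdown_first_def)

lemma drawdown_first_step:
  assumes "K \<le> N" "i + j \<le> N" "i < N" "j < K"
  shows "drawdown_first N K i j
    = up * drawdown_first N K (i - 1) (j + 1) + down * drawdown_first N K (i + 1) (j - 1)"
proof (cases "i + j < K")
  case True
  have 1: "drawdown_first N K (i - 1) (j + 1) = ratio K ^ (N - K) * first_exit K (i - 1) (j + 1)"
  proof (cases "i = 0 \<and> j + 1 = K")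
    case True
    then show ?thesis using drawdown_first_diag[of 0 K K N] by simp
  next
    case False
    then have "i - 1 + (j + 1) < K" using True assms by linarith
    then show ?thesis by (simp only: drawdown_first_def if_True)
  qed
  have 2: "drawdown_first N K (i + 1) (j - 1) = ratio K ^ (N - K) * first_exit K (i + 1) (j - 1)"
  proof (cases "j = 0 \<and> i + 1 = K")
    case True
    then show ?thesis using drawdown_first_diag[of K 0 K N] by simp
  next
    case False
    then have "i + 1 + (j - 1) < K" using True assms by linarith
    then show ?thesis by (simp only: drawdown_first_def if_True)
  qed
  show ?thesis unfolding 1 2
    using True first_exit_step[OF True] by (simp add: drawdown_first_def algebra_simps)
next
  case False
  define \<rho> where "\<rho> = ratio K ^ (N - (i + j))"
  obtain l where K: "K = Suc (l + j)" using assms by (metis less_iff_Suc_add add.commute)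
  have pos: "0 < s K" using s_pos K by auto
  have i: "0 < i" using False assms by auto
  have 1: "drawdown_first N K (i - 1) (j + 1) = \<rho> * (E ^ Suc j * s l / s K)"
    using False i by (simp add: drawdown_first_def \<rho>_def K)
  have lhs: "drawdown_first N K i j = \<rho> * (E ^ j * s (Suc l) / s K)"
    using False by (simp add: drawdown_first_def \<rho>_def K)
  show ?thesis
  proof (cases j)
    case 0
    have "N - i = Suc (N - Suc i)" using assms by simp
    then have \<rho>: "\<rho> = ratio K * ratio K ^ (N - Suc i)" by (simp add: \<rho>_def 0)
    have "drawdown_first N K (i + 1) (j - 1) = ratio K ^ (N - Suc i)"
      using False 0 pos by (simp add: drawdown_first_def)
    then have 2: "E * s K * drawdown_first N K (i + 1) (j - 1) = \<rho> * s (Suc K)"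
      using s_pos[of "Suc K"] by (simp add: \<rho> ratio_def)
    have hu: "up * (E * s l) + down * (s (Suc (Suc l)) / E) = s (Suc l)"
      using step_eq[OF s_add[of l]] E_pos by (simp add: up_E)
    \<comment> \<open>A fall from the minimum extends the range and so removes one factor
      \<open>ratio K\<close>. What remains is the second branch continued to drawup -1;
      \<open>ratio\<close> is exactly the factor for which this continuation is correct.\<close>
    have "drawdown_first N K (i + 1) (j - 1) = \<rho> * (s (Suc (Suc l)) / E) / s K"
      using 2 pos E_pos K 0 by (simp add: field_simps)
    then have "up * drawdown_first N K (i - 1) (j + 1) + down * drawdown_first N K (i + 1) (j - 1)
      = \<rho> * (up * (E * s l) + down * (s (Suc (Suc l)) / E)) / s K"
      unfolding 1 using 0 by (simp add: algebra_simps add_divide_distrib)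
    then show ?thesis unfolding hu lhs using 0 by simp
  next
    case (Suc n)
    have 2: "drawdown_first N K (i + 1) (j - 1) = \<rho> * (E ^ n * s (Suc (Suc l)) / s K)"
      using False Suc by (simp add: drawdown_first_def \<rho>_def K)
    have "up * drawdown_first N K (i - 1) (j + 1) + down * drawdown_first N K (i + 1) (j - 1)
      = \<rho> * (up * (E ^ Suc (Suc n) * s l) + down * (E ^ n * s (Suc (Suc l)))) / s K"
      unfolding 1 2 by (simp add: Suc algebra_simps add_divide_distrib)
    then show ?thesis unfolding harmonic_E lhs using Suc by simp
  qed
qed

lemma drawdown_first_stop:
  assumes "0 < K" "K \<le> N" "i + j \<le> N"
  shows "N \<le> i \<Longrightarrow> drawdown_first N K i j = 1"
    and "j = K \<Longrightarrow> drawdown_first N K i j = 0"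
proof -
  assume "N \<le> i"
  then have "i = N" "j = 0" using assms by auto
  then show "drawdown_first N K i j = 1"
    using assms s_pos[of K] by (simp add: drawdown_first_def)
next
  assume "j = K"
  then show "drawdown_first N K i j = 0" by (simp add: drawdown_first_def)
qed

text \<open>The bound \<open>i + j \<le> N\<close> survives each step because the range grows only
  from \<open>i = 0\<close>, to at most \<open>K \<le> N\<close>, or from \<open>j = 0\<close>, to
  at most \<open>N\<close>.\<close>

lemma walk_prob_drawdown_first:
  assumes "0 < K" "K \<le> N"
  shows "(\<lambda>n. walk_prob up down N K n 0 0) \<longlonglongrightarrow> drawdown_first N K 0 0"
proof (rule walk_prob_limit[where I = "\<lambda>i j. i + j \<le> N \<and> j \<le> K" and \<phi> = "drawdown_first N K"])
  show "finite {(i, j). i + j \<le> N \<and> j \<le> K}"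
    by (rule finite_subset[of _ "{..N} \<times> {..K}"]) auto
  show "drawdown_first N K i j = 1" if "i + j \<le> N \<and> j \<le> K" "N \<le> i" for i j
    using drawdown_first_stop[OF assms] that by simp
  show "drawdown_first N K i j = 0" if "i + j \<le> N \<and> j \<le> K" "i < N" "K \<le> j" for i j
    using drawdown_first_stop[OF assms] that by simp
  show "(i - 1 + (j + 1) \<le> N \<and> j + 1 \<le> K) \<and> (i + 1 + (j - 1) \<le> N \<and> j - 1 \<le> K)
      \<and> drawdown_first N K i j
        = up * drawdown_first N K (i - 1) (j + 1) + down * drawdown_first N K (i + 1) (j - 1)"
    if "i + j \<le> N \<and> j \<le> K" "i < N" "j < K" for i j
    using that assms drawdown_first_step[OF assms(2), of i j] by auto
qed (use up_down in auto)

section \<open>Passage of the drawdown alone, and the complementary order\<close>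

definition drawdown_start :: "nat \<Rightarrow> real" where
  "drawdown_start N = E ^ N * s 1 / (s (Suc N) - s N / E)"

text \<open>From drawdown \<open>i\<close> the walk either falls by \<open>N - i\<close> first, or
  first rises by \<open>Suc i\<close> to a new maximum and restarts there.
  \<open>drawdown_start\<close> is the solution of the resulting fixed point equation at
  \<open>i = 0\<close>.\<close>

definition drawdown_hit :: "nat \<Rightarrow> nat \<Rightarrow> real" where
  "drawdown_hit N i = E ^ (N - i) * s (Suc i) / s (Suc N)
     + (1 / E) ^ Suc i * s (N - i) / s (Suc N) * drawdown_start N"

lemma drawdown_start_eq:
  assumes "s (Suc N) - s N / E \<noteq> 0"
  shows "drawdown_hit N 0 = drawdown_start N"
proof -
  have "drawdown_start N * (s (Suc N) - s N / E) = E ^ N * s 1"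
    using assms by (simp add: drawdown_start_def)
  then have "E ^ N * s 1 + s N / E * drawdown_start N = drawdown_start N * s (Suc N)"
    by (simp add: algebra_simps)
  then show ?thesis using s_pos[of "Suc N"]
    by (simp add: drawdown_hit_def field_simps)
qed

lemma drawdown_hit_step:
  assumes "i < N" "s (Suc N) - s N / E \<noteq> 0"
  shows "drawdown_hit N i = up * drawdown_hit N (i - 1) + down * drawdown_hit N (i + 1)"
proof -
  obtain m where N: "N = Suc (i + m)" using assms by (metis less_iff_Suc_add)
  have pos: "0 < s (Suc N)" using s_pos by auto
  \<comment> \<open>Reflection at the maximum again: the truncated case \<open>i = 0\<close> agrees
    with the formula continued to drawdown -1, whose value is
    \<open>drawdown_start N\<close>.\<close>
  have 1: "drawdown_hit N (i - 1) = E ^ Suc (Suc m) * s i / s (Suc N)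
      + (1 / E) ^ i * s (Suc (Suc m)) / s (Suc N) * drawdown_start N"
  proof (cases i)
    case 0
    then show ?thesis using drawdown_start_eq[OF assms(2)] pos by (simp add: N)
  next
    case (Suc l)
    then show ?thesis by (simp add: drawdown_hit_def N)
  qed
  have 2: "drawdown_hit N (i + 1) = E ^ m * s (Suc (Suc i)) / s (Suc N)
      + (1 / E) ^ Suc (Suc i) * s m / s (Suc N) * drawdown_start N"
    by (simp add: drawdown_hit_def N)
  have 3: "drawdown_hit N i = E ^ Suc m * s (Suc i) / s (Suc N)
      + (1 / E) ^ Suc i * s (Suc m) / s (Suc N) * drawdown_start N"
    by (simp add: drawdown_hit_def N)
  show ?thesis unfolding 1 2 3
    unfolding harmonic_E[symmetric] harmonic_inverse_E[of i m, symmetric]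
    by (simp only: add_divide_distrib distrib_left distrib_right times_divide_eq_right times_divide_eq_left)
qed

text \<open>\<open>E_less\<close> means that the logarithm of \<open>E\<close> lies strictly between
  \<open>- h\<close> and \<open>h\<close>, so \<open>1 / E < exp h\<close>, while
  \<open>s (Suc N)\<close> exceeds \<open>exp h * s N\<close> by
  \<open>sinh h * exp (- (real N * h))\<close>.\<close>

lemma drawdown_start_denom: "0 < s (Suc N) - s N / E"
proof -
  have "1 / E < exp h"
  proof (rule ccontr)
    assume "\<not> 1 / E < exp h"
    then have le: "exp h \<le> 1 / E" by simp
    have "E * exp h \<le> 1" using le E_pos by (simp add: field_simps)
    moreover have "E * 1 \<le> E * exp h" using E_pos h_pos by (intro mult_left_mono) auto
    ultimately have "E \<le> exp h" using h_pos one_le_exp_iff[of h] by linarith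
    \<comment> \<open>The product expands to \<open>E + 1 / E - 2 * cosh h\<close>, so its sign
      contradicts \<open>E_less\<close>.\<close>
    have "0 \<le> (1 / E - exp h) * (1 - E * exp (- h))"
      using le \<open>E \<le> exp h\<close> by (intro mult_nonneg_nonneg) (auto simp: exp_minus field_simps)
    also have "\<dots> = E + 1 / E - 2 * cosh h + (E * (exp h * exp (- h)) - E) - (exp (-h) - exp (-h))"
      using E_pos by (simp add: cosh_field_def exp_minus field_simps)
    finally show False using E_less by (simp flip: exp_add)
  qed
  moreover have "s N * exp h < s (Suc N)"
  proof -
    have "s (Suc N) - s N * exp h = sinh h * exp (- (real N * h))"
      by (simp add: s_def sinh_field_def distrib_right exp_add exp_diff exp_minus field_simps)
    then show ?thesis using h_pos by (smt (verit) exp_gt_zero mult_pos_pos sinh_real_pos_iff)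
  qed
  moreover have "s N * (1 / E) \<le> s N * exp h"
    using \<open>1 / E < exp h\<close> h_pos by (intro mult_left_mono) (auto simp: s_def)
  ultimately show ?thesis by simp
qed

end

text \<open>From the passage probability of the drawdown alone, subtract the paths whose drawup
  reaches \<open>K\<close> first and which then restart at the maximum. Replacing \<open>E\<close>
  by \<open>1 / E\<close> exchanges up and down, so the drawup-first probability is
  \<open>drawdown_first\<close> of the reflected walk, with \<open>i\<close> and \<open>j\<close>
  exchanged.\<close>

lemma walk_prob_drawdown_second:
  assumes 1: "tilted_walk h E" and 2: "tilted_walk h (1 / E)" and NK: "0 < N" "N < K"
  shows "(\<lambda>n. walk_prob (tilted_walk.up h E) (tilted_walk.down h E) N K n 0 0) \<longlonglongrightarrow>
    tilted_walk.drawdown_start h E N * (1 - tilted_walk.drawdown_first h (1 / E) K N 0 0)"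
proof -
  interpret P: tilted_walk h E by fact
  interpret R: tilted_walk h "1 / E" by fact
  have swap: "R.up = P.down" "R.down = P.up"
    by (simp_all add: R.up_def R.down_def P.up_def P.down_def)
  let ?\<phi> = "\<lambda>i j. P.drawdown_hit N i - R.drawdown_first K N j i * P.drawdown_start N"
  have ne: "P.s (Suc N) - P.s N / E \<noteq> 0" using P.drawdown_start_denom[of N] by simp
  have "(\<lambda>n. walk_prob P.up P.down N K n 0 0) \<longlonglongrightarrow> ?\<phi> 0 0"
  proof (rule walk_prob_limit[where I = "\<lambda>i j. i + j \<le> K \<and> i \<le> N" and \<phi> = ?\<phi>])
    show "finite {(i, j). i + j \<le> K \<and> i \<le> N}"
      by (rule finite_subset[of _ "{..N} \<times> {..K}"]) auto
    show "?\<phi> i j = 1" if "i + j \<le> K \<and> i \<le> N" "N \<le> i" for i j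
      using R.drawdown_first_stop[of N K j i] NK that P.s_pos[of "Suc N"]
      by (simp add: P.drawdown_hit_def)
    show "?\<phi> i j = 0" if "i + j \<le> K \<and> i \<le> N" "i < N" "K \<le> j" for i j
    proof -
      \<comment> \<open>The invariant \<open>i + j \<le> K\<close> is what puts the walk at its
        maximum when the drawup is complete.\<close>
      have "i = 0" "j = K" using that by auto
      then show ?thesis
        using R.drawdown_first_stop[of N K j i] NK P.drawdown_start_eq[OF ne] by simp
    qed
    show "(i - 1 + (j + 1) \<le> K \<and> i - 1 \<le> N) \<and> (i + 1 + (j - 1) \<le> K \<and> i + 1 \<le> N)
        \<and> ?\<phi> i j = P.up * ?\<phi> (i - 1) (j + 1) + P.down * ?\<phi> (i + 1) (j - 1)"
      if "i + j \<le> K \<and> i \<le> N" "i < N" "j < K" for i j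
      using that NK R.drawdown_first_step[of N K j i] P.drawdown_hit_step[OF that(2) ne]
      by (auto simp: swap algebra_simps)
  qed (use P.up_down in auto)
  then show ?thesis by (simp add: P.drawdown_start_eq[OF ne] algebra_simps)
qed

subsection \<open>The fine mesh limit\<close>

lemma tendsto_sinh_ratio: "((\<lambda>x. sinh (k * x) / x) \<longlongrightarrow> k) (at_right (0::real))"
proof -
  have "((\<lambda>x. sinh (k * x)) has_real_derivative k) (at_right 0)"
    by (auto intro!: derivative_eq_intros)
  then show ?thesis by (simp add: has_field_derivative_iff)
qed

lemma cosh_minus_one: "cosh x - 1 = 2 * sinh (x / 2) ^ 2" for x :: real
  using cosh_double[of "x / 2"] cosh_square_eq[of "x / 2"] by simp

lemma tendsto_cosh_ratio: "((\<lambda>x. (cosh (k * x) - 1) / x\<^sup>2) \<longlongrightarrow> k\<^sup>2 / 2) (at_right (0::real))"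
proof -
  have "((\<lambda>x. 2 * (sinh (k / 2 * x) / x)\<^sup>2) \<longlongrightarrow> 2 * (k / 2)\<^sup>2) (at_right 0)"
    by (intro tendsto_intros tendsto_sinh_ratio)
  then show ?thesis by (simp add: cosh_minus_one power_divide)
qed

lemma tendsto_cosh_ratio': "((\<lambda>x. (cosh (k * x) - 1) / x) \<longlongrightarrow> 0) (at_right (0::real))"
proof -
  have "((\<lambda>x. (cosh (k * x) - 1) / x\<^sup>2 * x) \<longlongrightarrow> k\<^sup>2 / 2 * 0) (at_right 0)"
    by (intro tendsto_mult tendsto_cosh_ratio tendsto_ident_at)
  then have "((\<lambda>x. (cosh (k * x) - 1) / x\<^sup>2 * x) \<longlongrightarrow> 0) (at_right 0)" by simp
  moreover have "\<forall>\<^sub>F x in at_right 0. (cosh (k * x) - 1) / x\<^sup>2 * x = (cosh (k * x) - 1) / x"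
    using eventually_at_right_less by eventually_elim (simp add: power2_eq_square)
  ultimately show ?thesis by (rule Lim_transform_eventually)
qed

lemma tendsto_exp_ratio: "((\<lambda>x. (1 - exp (- (k * x))) / x) \<longlongrightarrow> k) (at_right (0::real))"
proof -
  have "((\<lambda>x. 1 - exp (- (k * x))) has_real_derivative k) (at_right 0)"
    by (auto intro!: derivative_eq_intros)
  then show ?thesis by (simp add: has_field_derivative_iff)
qed

text \<open>Serves a power with base \<open>1 + \<epsilon> n * v n\<close> and an exponent of order
  1/\<epsilon>, of which only the logarithm has a tractable limit.\<close>

lemma tendsto_ln_ratio:
  fixes \<epsilon> v :: "nat \<Rightarrow> real"
  assumes "\<epsilon> \<longlonglongrightarrow> 0" "\<And>n. 0 < \<epsilon> n" "v \<longlonglongrightarrow> l" "0 < l"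
  shows "(\<lambda>n. ln (1 + \<epsilon> n * v n) / \<epsilon> n) \<longlonglongrightarrow> l"
proof -
  have "((\<lambda>x. ln (1 + x)) has_real_derivative 1) (at_right 0)"
    by (auto intro!: derivative_eq_intros)
  then have lim: "((\<lambda>x::real. ln (1 + x) / x) \<longlongrightarrow> 1) (at_right 0)"
    by (simp add: has_field_derivative_iff)
  have v: "\<forall>\<^sub>F n in sequentially. 0 < v n"
    using order_tendstoD(1)[OF assms(3,4)] .
  have "(\<lambda>n. \<epsilon> n * v n) \<longlonglongrightarrow> 0"
    using tendsto_mult[OF assms(1,3)] by simp
  then have "filterlim (\<lambda>n. \<epsilon> n * v n) (at_right 0) sequentially"
    by (rule tendsto_imp_filterlim_at_right, intro eventually_mono[OF v]) (simp add: assms(2))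
  then have "(\<lambda>n. ln (1 + \<epsilon> n * v n) / (\<epsilon> n * v n) * v n) \<longlonglongrightarrow> 1 * l"
    by (intro tendsto_mult filterlim_compose[OF lim] assms(3))
  moreover have "\<forall>\<^sub>F n in sequentially. ln (1 + \<epsilon> n * v n) / (\<epsilon> n * v n) * v n = ln (1 + \<epsilon> n * v n) / \<epsilon> n"
    using v by eventually_elim simp
  ultimately show ?thesis
    by (simp add: filterlim_cong)
qed

lemma tilted_walk_exp:
  fixes \<gamma> \<delta> \<epsilon> :: real
  assumes dg: "\<bar>\<delta>\<bar> < \<gamma>" and \<epsilon>: "0 < \<epsilon>"
  shows "tilted_walk (\<gamma> * \<epsilon>) (exp (- (\<delta> * \<epsilon>)))"
proof
  have "\<bar>\<delta> * \<epsilon>\<bar> < \<gamma> * \<epsilon>" using dg \<epsilon> by (simp add: abs_mult)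
  then have "cosh (\<delta> * \<epsilon>) < cosh (\<gamma> * \<epsilon>)"
    using cosh_real_strict_mono[of "\<bar>\<delta> * \<epsilon>\<bar>" "\<gamma> * \<epsilon>"] by simp
  moreover have "2 * cosh (\<delta> * \<epsilon>) = exp (- (\<delta> * \<epsilon>)) + 1 / exp (- (\<delta> * \<epsilon>))"
    by (simp add: cosh_field_def exp_minus inverse_eq_divide)
  ultimately show "exp (- (\<delta> * \<epsilon>)) + 1 / exp (- (\<delta> * \<epsilon>)) < 2 * cosh (\<gamma> * \<epsilon>)"
    by linarith
  show "0 < \<gamma> * \<epsilon>" using dg \<epsilon> by simp
qed simp

section \<open>Limits along a mesh tending to 0\<close>

locale mesh =
  fixes \<gamma> \<delta> :: real and \<epsilon> :: "nat \<Rightarrow> real"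
  assumes dg: "\<bar>\<delta>\<bar> < \<gamma>" and eps: "\<epsilon> \<longlonglongrightarrow> 0" and eps_pos: "\<And>n. 0 < \<epsilon> n"
begin

lemma eps_at_right: "filterlim \<epsilon> (at_right 0) sequentially"
  using eps eps_pos by (intro tendsto_imp_filterlim_at_right) auto

lemma gamma_pos: "0 < \<gamma>" using dg by simp

lemma tilted: "tilted_walk (\<gamma> * \<epsilon> n) (exp (- (\<delta> * \<epsilon> n)))"
  using dg eps_pos by (rule tilted_walk_exp)

sublocale T: tilted_walk "\<gamma> * \<epsilon> n" "exp (- (\<delta> * \<epsilon> n))" for n
  by (rule tilted)

lemma s_Suc: "T.s n (Suc k) = T.s n k * cosh (\<gamma> * \<epsilon> n) + cosh (\<gamma> * (real k * \<epsilon> n)) * T.s n 1"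
proof -
  have "real (Suc k) * (\<gamma> * \<epsilon> n) = \<gamma> * (real k * \<epsilon> n) + \<gamma> * \<epsilon> n" by (simp add: algebra_simps)
  then show ?thesis unfolding T.s_def by (simp add: sinh_add ac_simps)
qed

lemma s1: "T.s n 1 = sinh (\<gamma> * \<epsilon> n)" "0 < T.s n 1"
  using T.s_pos[of 1 n] by (simp_all add: T.s_def)

lemma s1_ratio: "(\<lambda>n. T.s n 1 / \<epsilon> n) \<longlonglongrightarrow> \<gamma>"
  unfolding s1 by (rule filterlim_compose[OF tendsto_sinh_ratio eps_at_right])

text \<open>Only the exponential contributes at first order; \<open>cosh\<close> differs from 1 at
  second order. The parameter \<open>c\<close> is later \<delta> for the tilted sum and - \<delta>
  for \<open>drawdown_start\<close>.\<close>

lemma lim_tilt: "(\<lambda>n. (cosh (\<gamma> * \<epsilon> n) - exp (- (c * \<epsilon> n))) / T.s n 1) \<longlonglongrightarrow> c / \<gamma>"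
proof -
  have "(\<lambda>n. ((cosh (\<gamma> * \<epsilon> n) - 1) / \<epsilon> n + (1 - exp (- (c * \<epsilon> n))) / \<epsilon> n) / (T.s n 1 / \<epsilon> n)) \<longlonglongrightarrow> (0 + c) / \<gamma>"
    by (intro tendsto_intros s1_ratio filterlim_compose[OF tendsto_cosh_ratio' eps_at_right]
        filterlim_compose[OF tendsto_exp_ratio eps_at_right]) (use gamma_pos in auto)
  moreover have "((cosh (\<gamma> * \<epsilon> n) - 1) / \<epsilon> n + (1 - exp (- (c * \<epsilon> n))) / \<epsilon> n) / (T.s n 1 / \<epsilon> n)
      = (cosh (\<gamma> * \<epsilon> n) - exp (- (c * \<epsilon> n))) / T.s n 1" for n
    using eps_pos[of n] by (simp flip: add_divide_distrib)
  ultimately show ?thesis by (simp only: add_0)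
qed

text \<open>With \<open>E = exp (- (\<delta> * \<epsilon> n))\<close> one has
  \<open>E + 1 / E = 2 * cosh (\<delta> * \<epsilon> n)\<close>, so the denominator is a difference
  of two \<open>cosh\<close> values and of second order in \<epsilon>, like the numerator.\<close>

lemma lim_normaliser:
  "(\<lambda>n. (T.s n 1)\<^sup>2 / (2 * cosh (\<gamma> * \<epsilon> n) - exp (- (\<delta> * \<epsilon> n)) - 1 / exp (- (\<delta> * \<epsilon> n))))
    \<longlonglongrightarrow> \<gamma>\<^sup>2 / (\<gamma>\<^sup>2 - \<delta>\<^sup>2)"
proof -
  have ne: "\<gamma>\<^sup>2 / 2 - \<delta>\<^sup>2 / 2 \<noteq> 0" using dg abs_le_square_iff[of \<gamma> \<delta>] by auto
  have "(\<lambda>n. (T.s n 1 / \<epsilon> n)\<^sup>2 / (2 * ((cosh (\<gamma> * \<epsilon> n) - 1) / (\<epsilon> n)\<^sup>2 - (cosh (\<delta> * \<epsilon> n) - 1) / (\<epsilon> n)\<^sup>2)))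
    \<longlonglongrightarrow> \<gamma>\<^sup>2 / (2 * (\<gamma>\<^sup>2 / 2 - \<delta>\<^sup>2 / 2))"
    by (intro tendsto_intros s1_ratio filterlim_compose[OF tendsto_cosh_ratio eps_at_right])
       (use ne in auto)
  moreover have "(T.s n 1 / \<epsilon> n)\<^sup>2 / (2 * ((cosh (\<gamma> * \<epsilon> n) - 1) / (\<epsilon> n)\<^sup>2 - (cosh (\<delta> * \<epsilon> n) - 1) / (\<epsilon> n)\<^sup>2))
    = (T.s n 1)\<^sup>2 / (2 * cosh (\<gamma> * \<epsilon> n) - exp (- (\<delta> * \<epsilon> n)) - 1 / exp (- (\<delta> * \<epsilon> n)))" for n
  proof -
    have "2 * cosh (\<delta> * \<epsilon> n) = exp (- (\<delta> * \<epsilon> n)) + 1 / exp (- (\<delta> * \<epsilon> n))"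
      by (simp add: cosh_field_def exp_minus field_simps)
    then have eq: "2 * cosh (\<gamma> * \<epsilon> n) - 2 * cosh (\<delta> * \<epsilon> n)
        = 2 * cosh (\<gamma> * \<epsilon> n) - exp (- (\<delta> * \<epsilon> n)) - 1 / exp (- (\<delta> * \<epsilon> n))"
      by (simp only: diff_diff_eq)
    have "2 * ((cosh (\<gamma> * \<epsilon> n) - 1) - (cosh (\<delta> * \<epsilon> n) - 1))
        = 2 * cosh (\<gamma> * \<epsilon> n) - exp (- (\<delta> * \<epsilon> n)) - 1 / exp (- (\<delta> * \<epsilon> n))"
      unfolding eq[symmetric] by simp
    moreover have "(x / \<epsilon> n)\<^sup>2 / (2 * (y / (\<epsilon> n)\<^sup>2 - z / (\<epsilon> n)\<^sup>2)) = x\<^sup>2 / (2 * (y - z))" for x y z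
    proof -
      have "2 * (y / (\<epsilon> n)\<^sup>2 - z / (\<epsilon> n)\<^sup>2) = 2 * (y - z) / (\<epsilon> n)\<^sup>2"
        by (simp add: diff_divide_distrib)
      then show ?thesis using eps_pos[of n] by (simp add: power_divide)
    qed
    ultimately show ?thesis by (simp only:)
  qed
  ultimately show ?thesis by (simp add: right_diff_distrib)
qed

context
  fixes K :: "nat \<Rightarrow> nat" and b :: real
  assumes K: "(\<lambda>n. real (K n) * \<epsilon> n) \<longlonglongrightarrow> b"
begin

lemma lim_s: "(\<lambda>n. T.s n (K n)) \<longlonglongrightarrow> sinh (\<gamma> * b)"
proof -
  have "(\<lambda>n. sinh (\<gamma> * (real (K n) * \<epsilon> n))) \<longlonglongrightarrow> sinh (\<gamma> * b)"
    by (intro tendsto_intros K)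
  then show ?thesis by (simp add: T.s_def ac_simps)
qed

lemma lim_Suc: "(\<lambda>n. real (Suc (K n)) * \<epsilon> n) \<longlonglongrightarrow> b"
  using tendsto_add[OF K eps] by (simp add: algebra_simps)

lemma lim_E: "(\<lambda>n. exp (- (\<delta> * \<epsilon> n)) ^ K n) \<longlonglongrightarrow> exp (- \<delta> * b)"
proof -
  have "(\<lambda>n. exp (- \<delta> * (real (K n) * \<epsilon> n))) \<longlonglongrightarrow> exp (- \<delta> * b)"
    by (intro tendsto_intros K)
  then show ?thesis by (simp add: ac_simps flip: exp_of_nat_mult)
qed

lemma lim_diff_ratio:
  "(\<lambda>n. (T.s n (Suc (K n)) - exp (- (c * \<epsilon> n)) * T.s n (K n)) / T.s n 1)
    \<longlonglongrightarrow> sinh (\<gamma> * b) * (c / \<gamma>) + cosh (\<gamma> * b)"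
proof -
  have "(\<lambda>n. T.s n (K n) * ((cosh (\<gamma> * \<epsilon> n) - exp (- (c * \<epsilon> n))) / T.s n 1) + cosh (\<gamma> * (real (K n) * \<epsilon> n)))
    \<longlonglongrightarrow> sinh (\<gamma> * b) * (c / \<gamma>) + cosh (\<gamma> * b)"
    by (intro tendsto_intros lim_s lim_tilt K)
  moreover have "T.s n (K n) * ((cosh (\<gamma> * \<epsilon> n) - exp (- (c * \<epsilon> n))) / T.s n 1) + cosh (\<gamma> * (real (K n) * \<epsilon> n))
     = (T.s n (Suc (K n)) - exp (- (c * \<epsilon> n)) * T.s n (K n)) / T.s n 1" for n
    using s1(2)[of n] unfolding s_Suc by (simp add: field_simps)
  ultimately show ?thesis by simp
qed

lemma lim_drawdown_start:
  "(\<lambda>n. T.drawdown_start n (K n)) \<longlonglongrightarrow>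
    exp (- \<delta> * b) / (sinh (\<gamma> * b) * (- \<delta> / \<gamma>) + cosh (\<gamma> * b))"
proof -
  have ne: "sinh (\<gamma> * b) * (- \<delta> / \<gamma>) + cosh (\<gamma> * b) \<noteq> 0"
  proof -
    have "\<bar>- \<delta> / \<gamma>\<bar> \<le> 1" using dg gamma_pos by simp
    have "\<bar>sinh (\<gamma> * b) * (- \<delta> / \<gamma>)\<bar> \<le> \<bar>sinh (\<gamma> * b)\<bar>"
      unfolding abs_mult using \<open>\<bar>- \<delta> / \<gamma>\<bar> \<le> 1\<close> by (rule mult_left_le) simp
    also have "\<dots> < cosh (\<gamma> * b)"
      by (rule power2_less_imp_less) (simp_all add: cosh_square_eq)
    finally show ?thesis by linarith
  qed
  have "(\<lambda>n. exp (- (\<delta> * \<epsilon> n)) ^ K n / ((T.s n (Suc (K n)) - exp (- (- \<delta> * \<epsilon> n)) * T.s n (K n)) / T.s n 1))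
    \<longlonglongrightarrow> exp (- \<delta> * b) / (sinh (\<gamma> * b) * (- \<delta> / \<gamma>) + cosh (\<gamma> * b))"
    by (rule tendsto_divide[OF lim_E lim_diff_ratio ne])
  moreover have "exp (- (\<delta> * \<epsilon> n)) ^ K n / ((T.s n (Suc (K n)) - exp (- (- \<delta> * \<epsilon> n)) * T.s n (K n)) / T.s n 1)
      = T.drawdown_start n (K n)" for n
  proof -
    have "exp (- (- \<delta> * \<epsilon> n)) = 1 / exp (- (\<delta> * \<epsilon> n))"
      by (simp add: exp_minus inverse_eq_divide)
    then show ?thesis unfolding T.drawdown_start_def by simp
  qed
  ultimately show ?thesis by simp
qed

end

text \<open>The power of \<open>ratio\<close> is treated through its logarithm. The prefactor
  \<open>first_exit K 0 0\<close>, after summation in closed form, is built from quantities whose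
  limits are known.\<close>

lemma lim_drawdown_first:
  assumes K: "(\<lambda>n. real (K n) * \<epsilon> n) \<longlonglongrightarrow> b" and N: "(\<lambda>n. real (N n) * \<epsilon> n) \<longlonglongrightarrow> a"
    and KN: "\<And>n. 0 < K n" "\<And>n. K n \<le> N n" and b: "0 < b"
  shows "(\<lambda>n. T.drawdown_first n (N n) (K n) 0 0) \<longlonglongrightarrow>
    exp (- (a - b) * (\<delta> + \<gamma> * coth (\<gamma> * b))) *
      (\<gamma>\<^sup>2 / (\<gamma>\<^sup>2 - \<delta>\<^sup>2) * ((exp (- \<delta> * b) * (sinh (\<gamma> * b) * (\<delta> / \<gamma>) + cosh (\<gamma> * b)) - 1)
        / (sinh (\<gamma> * b) * sinh (\<gamma> * b))))"
proof -
  have sb: "0 < sinh (\<gamma> * b)" using b gamma_pos by simp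
  note sK = T.s_pos[OF KN(1)]
  \<comment> \<open>\<open>?v\<close> is \<open>(s (Suc K) / s K - 1) / \<epsilon>\<close>, split by
    the addition theorem so that its limit can be read off.\<close>
  have "(\<lambda>n. T.s n 1 / \<epsilon> n * (cosh (\<gamma> * (real (K n) * \<epsilon> n)) / T.s n (K n)) + (cosh (\<gamma> * \<epsilon> n) - 1) / \<epsilon> n)
      \<longlonglongrightarrow> \<gamma> * (cosh (\<gamma> * b) / sinh (\<gamma> * b)) + 0" (is "?v \<longlonglongrightarrow> _")
    by (intro tendsto_add tendsto_mult tendsto_divide tendsto_cosh tendsto_const s1_ratio
        filterlim_compose[OF tendsto_cosh_ratio' eps_at_right] lim_s[OF K] K)
       (use sb in auto)
  then have v: "?v \<longlonglongrightarrow> \<gamma> * coth (\<gamma> * b)" by (simp add: coth_def)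
  have "0 < \<gamma> * coth (\<gamma> * b)" using gamma_pos sb by (simp add: coth_def)
  from tendsto_ln_ratio[OF eps eps_pos v this]
  have ln: "(\<lambda>n. ln (1 + \<epsilon> n * ?v n) / \<epsilon> n) \<longlonglongrightarrow> \<gamma> * coth (\<gamma> * b)" .
  have ratio: "T.ratio n (K n) ^ (N n - K n)
      = exp (- (real (N n) * \<epsilon> n - real (K n) * \<epsilon> n) * (\<delta> + ln (1 + \<epsilon> n * ?v n) / \<epsilon> n))" for n
  proof -
    have "1 + e * (x / e * (y / z) + (c - 1) / e) = (z * c + y * x) / z" if "0 < e" "0 < z" for e x y z c :: real
    proof -
      have "e * (x / e * (y / z) + (c - 1) / e) = x * y / z + (c - 1)"
        using that by (simp add: distrib_left)
      moreover have "(z * c + y * x) / z = c + x * y / z"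
        using that by (simp add: add_divide_distrib)
      ultimately show ?thesis by linarith
    qed
    from this[OF eps_pos[of n] sK[of n n]]
    have one: "1 + \<epsilon> n * ?v n = T.s n (Suc (K n)) / T.s n (K n)"
      unfolding s_Suc .
    have "T.ratio n (K n) = exp (- (\<delta> * \<epsilon> n)) * exp (- ln (1 + \<epsilon> n * ?v n))"
    proof -
      have "exp (- ln (T.s n (Suc (K n)) / T.s n (K n))) = T.s n (K n) / T.s n (Suc (K n))"
        using sK[of n n] T.s_pos[of "Suc (K n)" n] by (simp add: exp_minus)
      then show ?thesis unfolding one T.ratio_def by simp
    qed
    also have "\<dots> = exp (- \<epsilon> n * (\<delta> + ln (1 + \<epsilon> n * ?v n) / \<epsilon> n))"
      using eps_pos[of n] unfolding exp_add[symmetric] by (simp add: distrib_left)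
    finally have r: "T.ratio n (K n) = exp (- \<epsilon> n * (\<delta> + ln (1 + \<epsilon> n * ?v n) / \<epsilon> n))" .
    have "real (N n - K n) * (- \<epsilon> n * Z) = - (real (N n) * \<epsilon> n - real (K n) * \<epsilon> n) * Z" for Z
      by (simp add: of_nat_diff[OF KN(2)] left_diff_distrib right_diff_distrib)
    then show ?thesis unfolding r exp_of_nat_mult[symmetric] by (simp only:)
  qed
  have R: "(\<lambda>n. T.ratio n (K n) ^ (N n - K n)) \<longlonglongrightarrow> exp (- (a - b) * (\<delta> + \<gamma> * coth (\<gamma> * b)))"
    unfolding ratio by (intro tendsto_intros N K ln)
  have first: "T.drawdown_first n (N n) (K n) 0 0 = T.ratio n (K n) ^ (N n - K n) *
     ((T.s n 1)\<^sup>2 / (2 * cosh (\<gamma> * \<epsilon> n) - exp (- (\<delta> * \<epsilon> n)) - 1 / exp (- (\<delta> * \<epsilon> n)))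
      * ((exp (- (\<delta> * \<epsilon> n)) ^ K n * ((T.s n (Suc (K n)) - exp (- (\<delta> * \<epsilon> n)) * T.s n (K n)) / T.s n 1) - 1)
        / (T.s n (K n) * T.s n (Suc (K n)))))" for n
  proof -
    define d where "d = 2 * cosh (\<gamma> * \<epsilon> n) - exp (- (\<delta> * \<epsilon> n)) - 1 / exp (- (\<delta> * \<epsilon> n))"
    have d: "0 < d" using T.E_less[of n] unfolding d_def by simp
    obtain m where m: "K n = Suc m" using KN(1)[of n] by (cases "K n") auto
    note pos = sK[of n n] T.s_pos[of "Suc (K n)" n] s1(2)[of n]
    have sum_eq: "T.tilted_sum n (K n) = (exp (- (\<delta> * \<epsilon> n)) ^ K n * (T.s n (Suc (K n)) - exp (- (\<delta> * \<epsilon> n)) * T.s n (K n)) - T.s n 1) / d"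
      using T.tilted_sum_closed[of n "K n"] d unfolding d_def[symmetric] by (simp add: eq_divide_eq mult.commute)
    \<comment> \<open>At the start the leading term of \<open>first_exit\<close> is precisely the
      summand missing from \<open>tilted_sum (K - 1)\<close>, so the two merge into the full
      sum.\<close>
    have "T.first_exit n (K n) 0 0 = T.s n 1 / (T.s n (K n) * T.s n (Suc (K n))) * T.tilted_sum n (K n)"
    proof -
      have "T.s n 1 / (T.s n (K n) * T.s n (Suc (K n))) * (x * T.s n (K n)) = x * T.s n 1 / T.s n (Suc (K n))" for x
        using pos by simp
      then show ?thesis by (simp add: T.first_exit_def m T.tilted_sum_Suc distrib_left)
    qed
    also have "\<dots> = (T.s n 1)\<^sup>2 / d
      * ((exp (- (\<delta> * \<epsilon> n)) ^ K n * ((T.s n (Suc (K n)) - exp (- (\<delta> * \<epsilon> n)) * T.s n (K n)) / T.s n 1) - 1)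
        / (T.s n (K n) * T.s n (Suc (K n))))"
    proof -
      have "s / P * ((x * y - s) / d) = s\<^sup>2 / d * ((x * (y / s) - 1) / P)" if "s \<noteq> 0" for s P x y :: real
      proof -
        have "x * (y / s) - 1 = (x * y - s) / s" using that by (simp add: diff_divide_distrib)
        then show ?thesis using that by (simp add: power2_eq_square)
      qed
      from this[OF less_imp_neq[OF pos(3), symmetric]] show ?thesis unfolding sum_eq .
    qed
    finally show ?thesis using KN(1)[of n] unfolding d_def by (simp add: T.drawdown_first_def)
  qed
  show ?thesis unfolding first
    by (rule tendsto_mult[OF R tendsto_mult[OF lim_normaliser tendsto_divide[OF tendsto_diff[OF
        tendsto_mult[OF lim_E[OF K] lim_diff_ratio[OF K]] tendsto_const]
        tendsto_mult[OF lim_s[OF K] lim_s[OF lim_Suc[OF K]]]]]]) (use gamma_pos b in simp)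
qed

end

subsection \<open>Crossings of a continuous path\<close>

lemma Inf_ereal_least:
  assumes "w \<in> V" "\<forall>v\<in>V. w \<le> v"
  shows "Inf {ereal u | u. u \<in> V} = ereal w"
  using assms by (intro antisym Inf_lower Inf_greatest) auto

lemma least_if_compact_below:
  fixes V :: "real set"
  assumes "V \<noteq> {}" "\<And>v. v \<in> V \<Longrightarrow> compact (V \<inter> {..v})"
  shows "\<exists>w\<in>V. \<forall>v\<in>V. w \<le> v"
proof -
  obtain v0 where v0: "v0 \<in> V" using assms(1) by auto
  then obtain w where w: "w \<in> V \<inter> {..v0}" "\<forall>v\<in>V \<inter> {..v0}. w \<le> v"
    using compact_attains_inf[OF assms(2)[OF v0]] by auto
  have "w \<le> v" if "v \<in> V" for v
    using w that by (cases "v \<le> v0") auto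
  with w show ?thesis by auto
qed

text \<open>The starting time \<open>S\<close> is extended real because it is the outcome of an
  earlier step, which may fail; from \<infinity> every later hit is again \<infinity>.\<close>

definition hit_time :: "(real \<Rightarrow> real) \<Rightarrow> ereal \<Rightarrow> real \<Rightarrow> ereal" where
  "hit_time x S y = Inf {ereal u | u. u \<in> {u. 0 \<le> u \<and> S \<le> ereal u \<and> x u = y}}"

text \<open>The value \<infinity> records that the step went the other way. Up and down steps thus
  become separate extended-valued times, of which at most one is finite, and no case distinction on
  paths enters the probabilities.\<close>

definition hit_first :: "(real \<Rightarrow> real) \<Rightarrow> ereal \<Rightarrow> real \<Rightarrow> real \<Rightarrow> ereal" where
  "hit_first x S y y' = (if hit_time x S y < hit_time x S y' then hit_time x S y else \<infinity>)"

lemma hit_time_ge: "S \<le> hit_time x S y" "0 \<le> hit_time x S y"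
  by (auto simp: hit_time_def intro!: Inf_greatest)

lemma hit_first_ge: "S \<le> hit_first x S y y'" "0 \<le> hit_first x S y y'"
  using hit_time_ge[where S = S and x = x and y = y] by (auto simp: hit_first_def)

lemma hit_time_upper: "0 \<le> u \<Longrightarrow> S \<le> ereal u \<Longrightarrow> x u = y \<Longrightarrow> hit_time x S y \<le> ereal u"
  by (auto simp: hit_time_def intro!: Inf_lower)

lemma hit_time_attained:
  assumes x: "continuous_on {0..} x" and fin: "hit_time x S y < \<infinity>"
  obtains u where "hit_time x S y = ereal u" "0 \<le> u" "S \<le> ereal u" "x u = y"
proof -
  let ?V = "{u. 0 \<le> u \<and> S \<le> ereal u \<and> x u = y}"
  have ne: "?V \<noteq> {}"
  proof
    assume "?V = {}"
    then have "hit_time x S y = \<infinity>" unfolding hit_time_def \<open>?V = {}\<close> by (simp add: top_ereal_def)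
    then show False using fin by simp
  qed
  have cpt: "compact (?V \<inter> {..v})" for v
  proof -
    have "closed ({u \<in> {0..}. x u = y} \<inter> {u. S \<le> ereal u})"
      by (intro closed_Int continuous_closed_preimage_constant x closed_Collect_le continuous_intros)
    then have "compact ({0..v} \<inter> ({u \<in> {0..}. x u = y} \<inter> {u. S \<le> ereal u}))"
      by (rule compact_Int_closed[OF compact_Icc])
    also have "{0..v} \<inter> ({u \<in> {0..}. x u = y} \<inter> {u. S \<le> ereal u}) = ?V \<inter> {..v}" by auto
    finally show ?thesis .
  qed
  obtain w where w: "w \<in> ?V" "\<forall>v\<in>?V. w \<le> v"
    by (rule bexE[OF least_if_compact_below[OF ne cpt]])
  then have "hit_time x S y = ereal w"
    unfolding hit_time_def by (rule Inf_ereal_least)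
  with w show thesis by (intro that) auto
qed

lemma hit_time_le_iff:
  assumes "continuous_on {0..} x"
  shows "hit_time x S y \<le> ereal t \<longleftrightarrow> (\<exists>u\<ge>0. S \<le> ereal u \<and> u \<le> t \<and> x u = y)"
proof
  assume le: "hit_time x S y \<le> ereal t"
  then have "hit_time x S y < \<infinity>" by (cases "hit_time x S y") auto
  then obtain u where "hit_time x S y = ereal u" "0 \<le> u" "S \<le> ereal u" "x u = y"
    by (rule hit_time_attained[OF assms])
  then show "\<exists>u\<ge>0. S \<le> ereal u \<and> u \<le> t \<and> x u = y" using le by auto
next
  assume "\<exists>u\<ge>0. S \<le> ereal u \<and> u \<le> t \<and> x u = y"
  then obtain u where u: "0 \<le> u" "S \<le> ereal u" "u \<le> t" "x u = y" by blast
  then have "hit_time x S y \<le> ereal u" by (intro hit_time_upper)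
  also have "\<dots> \<le> ereal t" using u by simp
  finally show "hit_time x S y \<le> ereal t" .
qed

lemma hit_time_neq:
  assumes "continuous_on {0..} x" "y \<noteq> y'" "hit_time x S y < \<infinity>"
  shows "hit_time x S y \<noteq> hit_time x S y'"
proof
  assume eq: "hit_time x S y = hit_time x S y'"
  obtain u where u: "hit_time x S y = ereal u" "x u = y"
    using hit_time_attained[OF assms(1,3)] by blast
  have "hit_time x S y' < \<infinity>" using eq assms by simp
  then obtain u' where u': "hit_time x S y' = ereal u'" "x u' = y'"
    using hit_time_attained[OF assms(1)] by blast
  show False using u u' eq assms by auto
qed

lemma hit_first_attained:
  assumes "continuous_on {0..} x" "hit_first x S y y' < \<infinity>"
  obtains u where "hit_first x S y y' = ereal u" "hit_time x S y = ereal u" "0 \<le> u" "S \<le> ereal u" "x u = y"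
    "ereal u < hit_time x S y'"
proof -
  have lt: "hit_time x S y < hit_time x S y'" "hit_first x S y y' = hit_time x S y"
    using assms(2) by (auto simp: hit_first_def split: if_splits)
  then have "hit_time x S y < \<infinity>" using assms(2) by simp
  then obtain u where "hit_time x S y = ereal u" "0 \<le> u" "S \<le> ereal u" "x u = y"
    by (rule hit_time_attained[OF assms(1)])
  then show thesis using lt by (intro that) auto
qed

text \<open>Intermediate value theorem: outside the strip, one of its boundary levels would have
  been hit no later than \<open>u\<close>.\<close>

lemma between_hits:
  assumes x: "continuous_on {0..} x" and s: "0 \<le> s" "x s = z" and y: "y < z" "z < y'"
    and u: "s \<le> u" "ereal u < hit_time x (ereal s) y" "ereal u < hit_time x (ereal s) y'"
  shows "y < x u" "x u < y'"
proof -
  have c: "continuous_on {s..u} x"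
    using x by (rule continuous_on_subset) (use s in auto)
  show "y < x u"
  proof (rule ccontr)
    assume "\<not> y < x u"
    then obtain v where v: "s \<le> v" "v \<le> u" "x v = y"
      using IVT2'[of x u y s] s y u c by auto
    then have "hit_time x (ereal s) y \<le> ereal v"
      using s by (intro hit_time_upper) auto
    also have "\<dots> \<le> ereal u" using v by simp
    finally show False using u by simp
  qed
  show "x u < y'"
  proof (rule ccontr)
    assume "\<not> x u < y'"
    then obtain v where v: "s \<le> v" "v \<le> u" "x v = y'"
      using IVT'[of x s y' u] s y u c by auto
    then have "hit_time x (ereal s) y' \<le> ereal v"
      using s by (intro hit_time_upper) auto
    also have "\<dots> \<le> ereal u" using v by simp
    finally show False using u by simp
  qed
qed

text \<open>The pathwise counterpart of \<open>walk_prob\<close>: \<open>S\<close> is the current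
  time, \<open>z\<close> the current height. The disjunction selects the actual step, since the
  other branch starts at \<infinity> and fails. The clock \<open>e\<close> is compared only at the
  end, which suffices because the times increase.\<close>

fun walk_event :: "(real \<Rightarrow> real) \<Rightarrow> real \<Rightarrow> nat \<Rightarrow> nat \<Rightarrow> ereal \<Rightarrow> nat \<Rightarrow> ereal \<Rightarrow> real \<Rightarrow> nat \<Rightarrow> nat \<Rightarrow> bool"
where
  "walk_event x \<epsilon> N K e 0 S z i j \<longleftrightarrow> N \<le> i \<and> S < e"
| "walk_event x \<epsilon> N K e (Suc n) S z i j \<longleftrightarrow>
    (if N \<le> i then S < e else j < K \<and>
      (walk_event x \<epsilon> N K e n (hit_first x S (z + \<epsilon>) (z - \<epsilon>)) (z + \<epsilon>) (i - 1) (j + 1) \<or>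
       walk_event x \<epsilon> N K e n (hit_first x S (z - \<epsilon>) (z + \<epsilon>)) (z - \<epsilon>) (i + 1) (j - 1)))"

lemma walk_event_less: "walk_event x \<epsilon> N K e n S z i j \<Longrightarrow> S < e"
proof (induction n arbitrary: S z i j)
  case (Suc n)
  have le: "S < e" if "walk_event x \<epsilon> N K e n (hit_first x S y y') z i j" for y y' z i j
    using hit_first_ge(1)[where S = S and x = x] Suc.IH[OF that] by (rule le_less_trans)
  show ?case
    using Suc.prems le by (auto split: if_splits)
qed simp

text \<open>Invariant: the path attains the lattice maximum, and its minimum lies less than one mesh
  below the lattice minimum. Hence drops are at least those of the walk, while rises may exceed them
  by less than a mesh, which is the reason for \<open>K + 1\<close>.\<close>

lemma walk_event_sound:
  assumes x: "continuous_on {0..} x" and \<epsilon>: "0 < \<epsilon>"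
  shows "walk_event x \<epsilon> N K e n (ereal s) z i j \<Longrightarrow> 0 \<le> s \<Longrightarrow> x s = z \<Longrightarrow>
    \<exists>u. 0 \<le> u \<and> u \<le> s \<and> x u = z + real i * \<epsilon> \<Longrightarrow>
    (\<And>u. 0 \<le> u \<Longrightarrow> u \<le> s \<Longrightarrow> z - (real j + 1) * \<epsilon> < x u) \<Longrightarrow>
    (\<And>u v. 0 \<le> u \<Longrightarrow> u \<le> v \<Longrightarrow> v \<le> s \<Longrightarrow> x v - x u < (real K + 1) * \<epsilon>) \<Longrightarrow>
    \<exists>u t. 0 \<le> u \<and> u \<le> t \<and> ereal t < e \<and> real N * \<epsilon> \<le> x u - x t
      \<and> (\<forall>u v. 0 \<le> u \<longrightarrow> u \<le> v \<longrightarrow> v \<le> t \<longrightarrow> x v - x u < (real K + 1) * \<epsilon>)"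
proof (induction n arbitrary: s z i j)
  case 0
  then obtain u where u: "0 \<le> u" "u \<le> s" "x u = z + real i * \<epsilon>" by blast
  have "real N * \<epsilon> \<le> real i * \<epsilon>" using 0(1) \<epsilon> by (intro mult_right_mono) auto
  then show ?case using u 0 by (intro exI[of _ u] exI[of _ s]) auto
next
  case (Suc n)
  obtain u0 where u0: "0 \<le> u0" "u0 \<le> s" "x u0 = z + real i * \<epsilon>" using Suc.prems by blast
  show ?case
  proof (cases "N \<le> i")
    case True
    have "real N * \<epsilon> \<le> real i * \<epsilon>" using True \<epsilon> by (intro mult_right_mono) auto
    then show ?thesis using u0 True Suc.prems by (intro exI[of _ u0] exI[of _ s]) auto
  next
    case False
    have j: "j < K" using False Suc.prems(1) by simp
    \<comment> \<open>During one step the path stays within a mesh of \<open>z\<close>, and it never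
      went below \<open>z - (j + 1) * \<epsilon>\<close>, so rises stay below
      \<open>(j + 2) * \<epsilon>\<close>; \<open>j < K\<close> then yields the bound.\<close>
    have jK: "(real j + 2) * \<epsilon> \<le> (real K + 1) * \<epsilon>"
      using j \<epsilon> by (intro mult_right_mono) auto
    have low: "z - (real j + 1) * \<epsilon> \<le> z - \<epsilon>" using \<epsilon> by simp
    consider (u) "walk_event x \<epsilon> N K e n (hit_first x (ereal s) (z + \<epsilon>) (z - \<epsilon>)) (z + \<epsilon>) (i - 1) (j + 1)"
      | (d) "walk_event x \<epsilon> N K e n (hit_first x (ereal s) (z - \<epsilon>) (z + \<epsilon>)) (z - \<epsilon>) (i + 1) (j - 1)"
      using False Suc.prems(1) by auto
    then show ?thesis
    proof cases
      case u
      have "hit_first x (ereal s) (z + \<epsilon>) (z - \<epsilon>) < \<infinity>"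
        using walk_event_less[OF u] by (cases e) auto
      then obtain s' where s': "hit_first x (ereal s) (z + \<epsilon>) (z - \<epsilon>) = ereal s'"
        "hit_time x (ereal s) (z + \<epsilon>) = ereal s'" "0 \<le> s'" "s \<le> s'" "x s' = z + \<epsilon>"
        "ereal s' < hit_time x (ereal s) (z - \<epsilon>)"
        using hit_first_attained[OF x] by (metis ereal_less_eq(3))
      have mid: "z - \<epsilon> < x v" "x v \<le> z + \<epsilon>" if "s \<le> v" "v \<le> s'" for v
      proof -
        have "z - \<epsilon> < x v \<and> x v \<le> z + \<epsilon>"
        proof (cases "v = s'")
          case False
          have "ereal v < hit_time x (ereal s) (z + \<epsilon>)" "ereal v < hit_time x (ereal s) (z - \<epsilon>)"
            using s' that False by (auto intro: less_trans[of _ "ereal s'"])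
          then show ?thesis
            using between_hits[OF x Suc.prems(2,3), of "z - \<epsilon>" "z + \<epsilon>" v] that \<epsilon> by auto
        qed (use s' \<epsilon> in auto)
        then show "z - \<epsilon> < x v" "x v \<le> z + \<epsilon>" by auto
      qed
      show ?thesis
      proof (rule Suc.IH[OF u[unfolded s'(1)] s'(3,5)])
        show "\<exists>u\<ge>0. u \<le> s' \<and> x u = z + \<epsilon> + real (i - 1) * \<epsilon>"
        proof (cases i)
          case 0
          then show ?thesis using s' by (intro exI[of _ s']) auto
        next
          case (Suc k)
          then show ?thesis using u0 s' by (intro exI[of _ u0]) (auto simp: algebra_simps)
        qed
        show "z + \<epsilon> - (real (j + 1) + 1) * \<epsilon> < x u" if "0 \<le> u" "u \<le> s'" for u
        proof -
          have "z - (real j + 1) * \<epsilon> < x u"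
            using Suc.prems(5)[of u] mid(1)[of u] low that by (cases "u \<le> s") auto
          then show ?thesis by (simp add: algebra_simps)
        qed
        show "x v - x u < (real K + 1) * \<epsilon>" if "0 \<le> u" "u \<le> v" "v \<le> s'" for u v
        proof (cases "v \<le> s")
          case True
          then show ?thesis using Suc.prems(6) that by auto
        next
          case False
          have "z - (real j + 1) * \<epsilon> < x u"
            using Suc.prems(5)[of u] mid(1)[of u] low that by (cases "u \<le> s") auto
          then show ?thesis using mid(2)[of v] False that jK by (simp add: algebra_simps)
        qed
      qed
    next
      case d
      have "hit_first x (ereal s) (z - \<epsilon>) (z + \<epsilon>) < \<infinity>"
        using walk_event_less[OF d] by (cases e) auto
      then obtain s' where s': "hit_first x (ereal s) (z - \<epsilon>) (z + \<epsilon>) = ereal s'"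
        "hit_time x (ereal s) (z - \<epsilon>) = ereal s'" "0 \<le> s'" "s \<le> s'" "x s' = z - \<epsilon>"
        "ereal s' < hit_time x (ereal s) (z + \<epsilon>)"
        using hit_first_attained[OF x] by (metis ereal_less_eq(3))
      have mid: "z - \<epsilon> \<le> x v" "x v < z + \<epsilon>" if "s \<le> v" "v \<le> s'" for v
      proof -
        have "z - \<epsilon> \<le> x v \<and> x v < z + \<epsilon>"
        proof (cases "v = s'")
          case False
          have "ereal v < hit_time x (ereal s) (z + \<epsilon>)" "ereal v < hit_time x (ereal s) (z - \<epsilon>)"
            using s' that False by (auto intro: less_trans[of _ "ereal s'"])
          then show ?thesis
            using between_hits[OF x Suc.prems(2,3), of "z - \<epsilon>" "z + \<epsilon>" v] that \<epsilon> by auto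
        qed (use s' \<epsilon> in auto)
        then show "z - \<epsilon> \<le> x v" "x v < z + \<epsilon>" by auto
      qed
      show ?thesis
      proof (rule Suc.IH[OF d[unfolded s'(1)] s'(3,5)])
        show "\<exists>u\<ge>0. u \<le> s' \<and> x u = z - \<epsilon> + real (i + 1) * \<epsilon>"
          using u0 s' by (intro exI[of _ u0]) (auto simp: algebra_simps)
        show "z - \<epsilon> - (real (j - 1) + 1) * \<epsilon> < x u" if "0 \<le> u" "u \<le> s'" for u
        proof -
          have "z - (real j + 1) * \<epsilon> \<le> x u"
            using Suc.prems(5)[of u] mid(1)[of u] low that by (cases "u \<le> s") auto
          \<comment> \<open>For \<open>j = 0\<close> the step sets a new lattice minimum and the
            required bound drops by a mesh. For \<open>j > 0\<close> the bound is unchanged and must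
            remain strict, which the newly visited level \<open>z - \<epsilon>\<close> does not
            endanger.\<close>
          moreover have "z - (real j + 1) * \<epsilon> < x u \<or> z - \<epsilon> \<le> x u"
            using Suc.prems(5)[of u] mid(1)[of u] that by (cases "u \<le> s") auto
          ultimately show ?thesis
          proof (cases j)
            case 0
            then show ?thesis using \<open>_ \<or> z - \<epsilon> \<le> x u\<close> \<epsilon> by auto
          next
            case (Suc k)
            have "z - (real j + 1) * \<epsilon> < z - \<epsilon>" using \<epsilon> Suc by simp
            then have "z - (real j + 1) * \<epsilon> < x u" using \<open>_ \<or> z - \<epsilon> \<le> x u\<close> by linarith
            then show ?thesis using Suc by (simp add: algebra_simps)
          qed
        qed
        show "x v - x u < (real K + 1) * \<epsilon>" if "0 \<le> u" "u \<le> v" "v \<le> s'" for u v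
        proof (cases "v \<le> s")
          case True
          then show ?thesis using Suc.prems(6) that by auto
        next
          case False
          have "z - (real j + 1) * \<epsilon> \<le> x u"
            using Suc.prems(5)[of u] mid(1)[of u] low that by (cases "u \<le> s") auto
          then show ?thesis using mid(2)[of v] False that jK by (simp add: algebra_simps)
        qed
      qed
    qed
  qed
qed

text \<open>The invariant is opposite to that of \<open>walk_event_sound\<close>: the lattice
  minimum is attained and the path maximum is less than one mesh above the lattice maximum, hence
  \<open>N + 1\<close>. A move by a full mesh takes time at least \<open>d\<close>, so
  \<open>n\<close> steps cover a duration below \<open>n * d\<close>; this is the induction
  measure.\<close>

lemma walk_event_complete:
  assumes x: "continuous_on {0..} x" and \<epsilon>: "0 < \<epsilon>"
    and u0: "0 \<le> u0" "u0 \<le> t" and t: "ereal t < e" and down: "(real N + 1) * \<epsilon> \<le> x u0 - x t"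
    and up: "\<And>u v. 0 \<le> u \<Longrightarrow> u \<le> v \<Longrightarrow> v \<le> t \<Longrightarrow> x v - x u < real K * \<epsilon>"
    and d: "0 < d" "\<And>u v. 0 \<le> u \<Longrightarrow> u \<le> v \<Longrightarrow> v \<le> t \<Longrightarrow> v < u + d \<Longrightarrow> \<bar>x v - x u\<bar> < \<epsilon>"
  shows "0 \<le> s \<Longrightarrow> s \<le> t \<Longrightarrow> x s = z \<Longrightarrow> t - s < real n * d \<Longrightarrow>
    (\<And>u. 0 \<le> u \<Longrightarrow> u \<le> s \<Longrightarrow> x u < z + (real i + 1) * \<epsilon>) \<Longrightarrow>
    \<exists>u. 0 \<le> u \<and> u \<le> s \<and> x u = z - real j * \<epsilon> \<Longrightarrow>
    walk_event x \<epsilon> N K e n (ereal s) z i j"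
proof (induction n arbitrary: s z i j)
  case (Suc n)
  show ?case
  proof (cases "N \<le> i")
    case True
    then show ?thesis using Suc.prems(2) t by (auto intro: le_less_trans[of _ "ereal t"])
  next
    case False
    have iN: "(real i + 2) * \<epsilon> \<le> (real N + 1) * \<epsilon>"
      using False \<epsilon> by (intro mult_right_mono) auto
    obtain u1 where u1: "0 \<le> u1" "u1 \<le> s" "x u1 = z - real j * \<epsilon>" using Suc.prems by blast
    have "real j * \<epsilon> < real K * \<epsilon>"
      using up[OF u1(1,2) Suc.prems(2)] u1 Suc.prems(3) by simp
    then have j: "j < K" using \<epsilon> by simp
    let ?u = "hit_time x (ereal s) (z + \<epsilon>)" and ?d = "hit_time x (ereal s) (z - \<epsilon>)"
    have i\<epsilon>: "z + \<epsilon> \<le> z + (real i + 1) * \<epsilon>" using \<epsilon> by simp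
    \<comment> \<open>Without a further step before \<open>t\<close>, the path would end above
      \<open>z - \<epsilon>\<close> after a maximum below \<open>z + (i + 1) * \<epsilon>\<close>: a
      drop below \<open>(N + 1) * \<epsilon>\<close>.\<close>
    have "?u \<le> ereal t \<or> ?d \<le> ereal t"
    proof (rule ccontr)
      assume "\<not> ?thesis"
      then have lt: "ereal t < ?u" "ereal t < ?d" by auto
      have mid: "z - \<epsilon> < x v \<and> x v < z + \<epsilon>" if "s \<le> v" "v \<le> t" for v
        using between_hits[OF x Suc.prems(1,3), of "z - \<epsilon>" "z + \<epsilon>" v] that \<epsilon>
          le_less_trans[OF _ lt(1), of "ereal v"] le_less_trans[OF _ lt(2), of "ereal v"] by simp
      have "x u0 < z + (real i + 1) * \<epsilon>"
      proof (cases "u0 \<le> s")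
        case False
        then have "x u0 < z + \<epsilon>" using mid[of u0] u0 by simp
        with i\<epsilon> show ?thesis by linarith
      qed (use Suc.prems(5) u0 in simp)
      then show False using mid[of t] Suc.prems(2) down iN by (simp add: algebra_simps)
    qed
    then have "?u < ?d \<and> ?u \<le> ereal t \<or> ?d < ?u \<and> ?d \<le> ereal t"
    proof -
      assume *: "?u \<le> ereal t \<or> ?d \<le> ereal t"
      have "?u \<noteq> ?d"
      proof (cases "?u < \<infinity>")
        case True
        then show ?thesis using hit_time_neq[OF x, of "z + \<epsilon>" "z - \<epsilon>"] \<epsilon> by auto
      qed (use * in auto)
      then show ?thesis using * by (metis linorder_neqE order.strict_implies_order order.trans)
    qed
    then consider (u) "?u < ?d" "?u \<le> ereal t" | (d) "?d < ?u" "?d \<le> ereal t" by blast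
    then show ?thesis
    proof cases
      case u
      then have "hit_first x (ereal s) (z + \<epsilon>) (z - \<epsilon>) < \<infinity>"
        by (auto simp: hit_first_def intro: le_less_trans[of _ "ereal t"])
      then obtain s' where s': "hit_first x (ereal s) (z + \<epsilon>) (z - \<epsilon>) = ereal s'"
        "hit_time x (ereal s) (z + \<epsilon>) = ereal s'" "0 \<le> s'" "s \<le> s'" "x s' = z + \<epsilon>"
        "ereal s' < hit_time x (ereal s) (z - \<epsilon>)"
        using hit_first_attained[OF x] by (metis ereal_less_eq(3))
      have s't: "s' \<le> t" using u s' by simp
      have "s + d \<le> s'"
        using d(2)[of s s'] Suc.prems(1,3) s' s't \<epsilon> by force
      have "walk_event x \<epsilon> N K e n (ereal s') (z + \<epsilon>) (i - 1) (j + 1)"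
      proof (rule Suc.IH[OF s'(3) s't s'(5)])
        show "t - s' < real n * d" using Suc.prems(4) \<open>s + d \<le> s'\<close> by (simp add: algebra_simps)
        show "x v < z + \<epsilon> + (real (i - 1) + 1) * \<epsilon>" if "0 \<le> v" "v \<le> s'" for v
        proof -
          have "x v < z + (real i + 1) * \<epsilon> \<or> x v < z + \<epsilon> \<or> x v = z + \<epsilon>"
            using that Suc.prems(5)[of v] s' between_hits(2)[OF x Suc.prems(1,3), of "z - \<epsilon>" "z + \<epsilon>" v] \<epsilon>
              less_trans[OF _ s'(6), of "ereal v"]
            by (cases "v \<le> s"; cases "v = s'") auto
          then have "x v < z + (real i + 1) * \<epsilon> \<or> x v \<le> z + \<epsilon>" by linarith
          then show ?thesis
          proof (cases i)
            case 0
            then show ?thesis using \<open>_ \<or> x v \<le> z + \<epsilon>\<close> \<epsilon> by auto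
          next
            case (Suc k)
            then have "z + \<epsilon> < z + (real i + 1) * \<epsilon>" using \<epsilon> by simp
            then have "x v < z + (real i + 1) * \<epsilon>" using \<open>_ \<or> x v \<le> z + \<epsilon>\<close> by linarith
            then show ?thesis using Suc by (simp add: algebra_simps)
          qed
        qed
        show "\<exists>v\<ge>0. v \<le> s' \<and> x v = z + \<epsilon> - real (j + 1) * \<epsilon>"
          using u1 s' by (intro exI[of _ u1]) (auto simp: algebra_simps)
      qed
      then show ?thesis using False j s' by simp
    next
      case d': d
      then have "hit_first x (ereal s) (z - \<epsilon>) (z + \<epsilon>) < \<infinity>"
        by (auto simp: hit_first_def intro: le_less_trans[of _ "ereal t"])
      then obtain s' where s': "hit_first x (ereal s) (z - \<epsilon>) (z + \<epsilon>) = ereal s'"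
        "hit_time x (ereal s) (z - \<epsilon>) = ereal s'" "0 \<le> s'" "s \<le> s'" "x s' = z - \<epsilon>"
        "ereal s' < hit_time x (ereal s) (z + \<epsilon>)"
        using hit_first_attained[OF x] by (metis ereal_less_eq(3))
      have s't: "s' \<le> t" using d' s' by simp
      have "s + d \<le> s'"
        using d(2)[of s s'] Suc.prems(1,3) s' s't \<epsilon> by force
      have "walk_event x \<epsilon> N K e n (ereal s') (z - \<epsilon>) (i + 1) (j - 1)"
      proof (rule Suc.IH[OF s'(3) s't s'(5)])
        show "t - s' < real n * d" using Suc.prems(4) \<open>s + d \<le> s'\<close> by (simp add: algebra_simps)
        show "x v < z - \<epsilon> + (real (i + 1) + 1) * \<epsilon>" if "0 \<le> v" "v \<le> s'" for v
        proof -
          have "x v < z + (real i + 1) * \<epsilon> \<or> x v < z + \<epsilon>"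
            using that Suc.prems(5)[of v] s' between_hits(2)[OF x Suc.prems(1,3), of "z - \<epsilon>" "z + \<epsilon>" v] \<epsilon>
              less_trans[OF _ s'(6), of "ereal v"]
            by (cases "v \<le> s"; cases "v = s'") auto
          then show ?thesis using i\<epsilon> by (auto simp: algebra_simps)
        qed
        show "\<exists>v\<ge>0. v \<le> s' \<and> x v = z - \<epsilon> - real (j - 1) * \<epsilon>"
        proof (cases j)
          case 0
          then show ?thesis using s' by (intro exI[of _ s']) auto
        next
          case (Suc k)
          then show ?thesis using u1 s' by (intro exI[of _ u1]) (auto simp: algebra_simps)
        qed
      qed
      then show ?thesis using False j s' by simp
    qed
  qed
qed auto

section \<open>Drawdown and drawup times in terms of drops and rises\<close>

lemma le_drawdown_iff:
  assumes x: "continuous_on {0..} x" and v: "0 \<le> v"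
  shows "c \<le> drawdown x v \<longleftrightarrow> (\<exists>u\<in>{0..v}. c \<le> x u - x v)"
proof -
  have cont: "continuous_on {0..v} x"
    using x by (rule continuous_on_subset) auto
  obtain m where m: "m \<in> {0..v}" "\<And>u. u \<in> {0..v} \<Longrightarrow> x u \<le> x m"
    using continuous_attains_sup[OF compact_Icc _ cont] v by auto
  have "(SUP s\<in>{0..v}. x s) = x m"
    by (rule cSup_eq_maximum) (use m in auto)
  then show ?thesis unfolding drawdown_def using m by fastforce
qed

text \<open>The times at which the drawdown is at least \<open>c\<close> are, up to any horizon, the
  projection of a compact set of pairs (peak time, current time), so the infimum is
  attained.\<close>

lemma drawdown_time_le_iff:
  assumes x: "continuous_on {0..} x"
  shows "drawdown_time c x \<le> ereal t \<longleftrightarrow> (\<exists>u v. 0 \<le> u \<and> u \<le> v \<and> v \<le> t \<and> c \<le> x u - x v)"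
proof -
  let ?V = "{v. 0 \<le> v \<and> c \<le> drawdown x v}"
  have V: "v \<in> ?V \<longleftrightarrow> 0 \<le> v \<and> (\<exists>u\<in>{0..v}. c \<le> x u - x v)" for v
    using le_drawdown_iff[OF x] by auto
  have Inf: "drawdown_time c x = Inf {ereal v | v. v \<in> ?V}"
    by (simp add: drawdown_time_def)
  have cpt: "compact (?V \<inter> {..w})" for w
  proof -
    let ?S = "{0..w} \<times> {0..w}"
    let ?C = "(?S \<inter> (\<lambda>p. x (fst p) - x (snd p)) -` {c..}) \<inter> {p. fst p \<le> snd p}"
    have c1: "continuous_on ?S (\<lambda>p. x (fst p))"
      by (rule continuous_on_compose2[OF x continuous_on_fst[OF continuous_on_id]]) auto
    have c2: "continuous_on ?S (\<lambda>p. x (snd p))"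
      by (rule continuous_on_compose2[OF x continuous_on_snd[OF continuous_on_id]]) auto
    have "closed ?C"
      by (intro closed_Int continuous_closed_preimage continuous_on_diff c1 c2 closed_Times
          closed_atLeastAtMost closed_atLeast closed_Collect_le continuous_on_fst continuous_on_snd
          continuous_on_id)
    then have "compact (?S \<inter> ?C)"
      by (intro compact_Int_closed compact_Times compact_Icc)
    then have "compact (snd ` (?S \<inter> ?C))"
      by (rule compact_continuous_image[OF continuous_on_snd[OF continuous_on_id]])
    also have "snd ` (?S \<inter> ?C) = ?V \<inter> {..w}"
    proof (intro equalityI subsetI)
      fix v assume "v \<in> ?V \<inter> {..w}"
      then obtain u where "0 \<le> u" "u \<le> v" "v \<le> w" "c \<le> x u - x v" using V[of v] by auto
      then show "v \<in> snd ` (?S \<inter> ?C)"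
        by (intro image_eqI[of _ _ "(u, v)"]) auto
    next
      fix v assume "v \<in> snd ` (?S \<inter> ?C)"
      then obtain u where u: "0 \<le> u" "u \<le> v" "v \<le> w" "c \<le> x u - x v" by auto
      then have "\<exists>u\<in>{0..v}. c \<le> x u - x v" by (intro bexI[of _ u]) auto
      then have "v \<in> ?V" using V[of v] u by simp
      with u show "v \<in> ?V \<inter> {..w}" by simp
    qed
    finally show ?thesis .
  qed
  show ?thesis
  proof
    assume le: "drawdown_time c x \<le> ereal t"
    have "?V \<noteq> {}"
    proof
      assume "?V = {}"
      then have "drawdown_time c x = \<infinity>" unfolding Inf \<open>?V = {}\<close> by (simp add: top_ereal_def)
      with le show False by simp
    qed
    then obtain w where w: "w \<in> ?V" "\<forall>v\<in>?V. w \<le> v"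
      by (rule bexE[OF least_if_compact_below[OF _ cpt]])
    have "drawdown_time c x = ereal w" unfolding Inf using w by (rule Inf_ereal_least)
    then have "w \<le> t" using le by simp
    moreover obtain u where "u \<in> {0..w}" "c \<le> x u - x w" using w(1) V[of w] by blast
    ultimately show "\<exists>u v. 0 \<le> u \<and> u \<le> v \<and> v \<le> t \<and> c \<le> x u - x v"
      by (intro exI[of _ u] exI[of _ w]) simp
  next
    assume "\<exists>u v. 0 \<le> u \<and> u \<le> v \<and> v \<le> t \<and> c \<le> x u - x v"
    then obtain u v where uv: "0 \<le> u" "u \<le> v" "v \<le> t" "c \<le> x u - x v" by blast
    then have "\<exists>u\<in>{0..v}. c \<le> x u - x v" by (intro bexI[of _ u]) auto
    then have "v \<in> ?V" using V[of v] uv by simp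
    then have "drawdown_time c x \<le> ereal v" unfolding Inf by (intro Inf_lower) auto
    also have "\<dots> \<le> ereal t" using uv by simp
    finally show "drawdown_time c x \<le> ereal t" .
  qed
qed

lemma drawup_eq: "drawup x = drawdown (\<lambda>t. - x t)"
  by (simp add: drawup_def drawdown_def Inf_real_def image_image fun_eq_iff)

lemma drawup_time_eq: "drawup_time c x = drawdown_time c (\<lambda>t. - x t)"
  by (simp add: drawup_time_def drawdown_time_def drawup_eq)

lemma drawup_time_le_iff:
  assumes "continuous_on {0..} x"
  shows "drawup_time c x \<le> ereal t \<longleftrightarrow> (\<exists>u v. 0 \<le> u \<and> u \<le> v \<and> v \<le> t \<and> c \<le> x v - x u)"
  using drawdown_time_le_iff[OF continuous_on_minus[OF assms], of c t] by (simp add: drawup_time_eq)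

lemma drawdown_time_nonneg: "0 \<le> drawdown_time c x"
  by (auto simp: drawdown_time_def intro!: Inf_greatest)

text \<open>The right-hand side mentions only increments of the path. This makes the event visibly
  monotone in the two levels, insensitive to the starting value, and comparable with
  \<open>walk_event\<close>.\<close>

lemma drawdown_time_less_iff:
  assumes x: "continuous_on {0..} x"
  shows "drawdown_time a x < min (drawup_time b x) (ereal e) \<longleftrightarrow>
    (\<exists>u t. 0 \<le> u \<and> u \<le> t \<and> ereal t < ereal e \<and> a \<le> x u - x t
      \<and> (\<forall>u v. 0 \<le> u \<longrightarrow> u \<le> v \<longrightarrow> v \<le> t \<longrightarrow> x v - x u < b))" (is "?L \<longleftrightarrow> ?R")
proof
  assume L: ?L
  then obtain t where t: "drawdown_time a x = ereal t"
    using drawdown_time_nonneg[of a x] by (cases "drawdown_time a x") auto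
  then have "drawdown_time a x \<le> ereal t" by simp
  then obtain u v where uv: "0 \<le> u" "u \<le> v" "v \<le> t" "a \<le> x u - x v"
    unfolding drawdown_time_le_iff[OF x] by blast
  have "\<not> drawup_time b x \<le> ereal t" using L t by (simp add: not_le)
  then have "x v' - x u' < b" if "0 \<le> u'" "u' \<le> v'" "v' \<le> v" for u' v'
    unfolding drawup_time_le_iff[OF x] not_ex using that uv(3) by (meson not_le order_trans)
  moreover have "ereal v < ereal e" using L t uv(3) by simp
  ultimately show ?R using uv by (intro exI[of _ u] exI[of _ v]) simp
next
  assume ?R
  then obtain u t where ut: "0 \<le> u" "u \<le> t" "ereal t < ereal e" "a \<le> x u - x t"
    and up: "\<And>u v. 0 \<le> u \<Longrightarrow> u \<le> v \<Longrightarrow> v \<le> t \<Longrightarrow> x v - x u < b" by blast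
  have "drawdown_time a x \<le> ereal t" unfolding drawdown_time_le_iff[OF x] using ut by blast
  moreover have "\<not> drawup_time b x \<le> ereal t" unfolding drawup_time_le_iff[OF x] using up
    by (meson not_le)
  ultimately show ?L using ut(3) by (auto intro: le_less_trans)
qed

lemma walk_event_imp_drawdown_first:
  assumes x: "continuous_on {0..} x" and \<epsilon>: "0 < \<epsilon>"
    and a: "a \<le> real N * \<epsilon>" and b: "(real K + 1) * \<epsilon> \<le> b"
    and ev: "walk_event x \<epsilon> N K (ereal e) n 0 (x 0) 0 0"
  shows "drawdown_time a x < min (drawup_time b x) (ereal e)"
proof -
  have "\<exists>u t. 0 \<le> u \<and> u \<le> t \<and> ereal t < ereal e \<and> real N * \<epsilon> \<le> x u - x t
      \<and> (\<forall>u v. 0 \<le> u \<longrightarrow> u \<le> v \<longrightarrow> v \<le> t \<longrightarrow> x v - x u < (real K + 1) * \<epsilon>)"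
  proof (rule walk_event_sound[OF x \<epsilon>, of N K "ereal e" n 0 "x 0" 0 0])
    show "x v - x u < (real K + 1) * \<epsilon>" if "0 \<le> u" "u \<le> v" "v \<le> 0" for u v
    proof -
      have "u = v" using that by simp
      then show ?thesis using \<epsilon> by simp
    qed
    show "x 0 - (real 0 + 1) * \<epsilon> < x u" if "0 \<le> u" "u \<le> 0" for u
    proof -
      have "u = 0" using that by simp
      then show ?thesis using \<epsilon> by simp
    qed
  qed (use ev in \<open>auto simp: zero_ereal_def\<close>)
  then show ?thesis unfolding drawdown_time_less_iff[OF x]
    using a b by (meson order_less_le_trans order_trans)
qed

lemma drawdown_first_imp_walk_event:
  assumes x: "continuous_on {0..} x" and \<epsilon>: "0 < \<epsilon>"
    and a: "(real N + 1) * \<epsilon> \<le> a" and b: "b \<le> real K * \<epsilon>"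
    and ev: "drawdown_time a x < min (drawup_time b x) (ereal e)"
  shows "\<exists>n. walk_event x \<epsilon> N K (ereal e) n 0 (x 0) 0 0"
proof -
  obtain u t where ut: "0 \<le> u" "u \<le> t" "ereal t < ereal e" "a \<le> x u - x t"
    and up: "\<And>u v. 0 \<le> u \<Longrightarrow> u \<le> v \<Longrightarrow> v \<le> t \<Longrightarrow> x v - x u < b"
    using ev unfolding drawdown_time_less_iff[OF x] by blast
  have "continuous_on {0..t} x" using x by (rule continuous_on_subset) auto
  then have "uniformly_continuous_on {0..t} x"
    by (rule compact_uniformly_continuous) auto
  then obtain d where d: "0 < d" "\<And>u v. u \<in> {0..t} \<Longrightarrow> v \<in> {0..t} \<Longrightarrow> dist v u < d \<Longrightarrow> dist (x v) (x u) < \<epsilon>"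
    using \<epsilon> unfolding uniformly_continuous_on_def by meson
  obtain n where n: "t < real n * d"
    using reals_Archimedean3[OF d(1)] by blast
  have "walk_event x \<epsilon> N K (ereal e) n (ereal 0) (x 0) 0 0"
  proof (rule walk_event_complete[OF x \<epsilon> ut(1,2,3) order_trans[OF a ut(4)]])
    show "x v - x u < real K * \<epsilon>" if "0 \<le> u" "u \<le> v" "v \<le> t" for u v
      using up[OF that] b by simp
    show "\<bar>x v - x u\<bar> < \<epsilon>" if "0 \<le> u" "u \<le> v" "v \<le> t" "v < u + d" for u v
      using d(2)[of u v] that by (simp add: dist_real_def)
  qed (use d n ut \<epsilon> in auto)
  then show ?thesis by (auto simp: zero_ereal_def)
qed

subsection \<open>Exponential martingales and optional stopping\<close>

lemma (in prob_space) indep_var_nn_integral: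
  fixes X Y :: "'a \<Rightarrow> ennreal"
  assumes "indep_var borel X borel Y"
  shows "(\<integral>\<^sup>+w. X w * Y w \<partial>M) = (\<integral>\<^sup>+w. X w \<partial>M) * (\<integral>\<^sup>+w. Y w \<partial>M)"
proof -
  have b: "case_bool borel borel = (\<lambda>_. borel)" by (auto simp: fun_eq_iff split: bool.split)
  have "indep_vars (\<lambda>_. borel) (case_bool X Y) UNIV"
    using assms unfolding indep_var_def b .
  from indep_vars_nn_integral[OF _ this] show ?thesis
    by (simp add: UNIV_bool mult.commute)
qed

text \<open>A bound in L2 gives uniform integrability. Fatou yields the upper bound 1; for the lower
  bound the functions are truncated at level \<open>L\<close>, which costs at most
  \<open>C / L\<close>.\<close>

lemma (in prob_space) nn_integral_limit_of_L2_bounded: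
  fixes f :: "nat \<Rightarrow> 'a \<Rightarrow> real" and g :: "'a \<Rightarrow> real"
  assumes [measurable]: "\<And>n. f n \<in> borel_measurable M"
    and nn: "\<And>n w. 0 \<le> f n w"
    and lim: "\<And>w. w \<in> space M \<Longrightarrow> (\<lambda>n. f n w) \<longlonglongrightarrow> g w"
    and int: "\<And>n. (\<integral>\<^sup>+w. f n w \<partial>M) = 1"
    and L2: "\<And>n. (\<integral>\<^sup>+w. (f n w)\<^sup>2 \<partial>M) \<le> ennreal C" and C: "0 \<le> C"
  shows "(\<integral>\<^sup>+w. g w \<partial>M) = 1"
proof -
  have g[measurable]: "g \<in> borel_measurable M"
    by (rule borel_measurable_LIMSEQ_real[OF lim]) auto
  have gnn: "0 \<le> g w" if "w \<in> space M" for w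
    by (rule LIMSEQ_le_const[OF lim[OF that]]) (use nn in auto)
  have elim: "(\<lambda>n. ennreal (f n w)) \<longlonglongrightarrow> ennreal (g w)" if "w \<in> space M" for w
    using lim[OF that] by (intro tendsto_ennrealI)
  have "(\<integral>\<^sup>+w. g w \<partial>M) = (\<integral>\<^sup>+w. liminf (\<lambda>n. ennreal (f n w)) \<partial>M)"
    by (intro nn_integral_cong lim_imp_Liminf[symmetric] elim) auto
  also have "\<dots> \<le> liminf (\<lambda>n. \<integral>\<^sup>+w. f n w \<partial>M)"
    by (rule nn_integral_liminf) simp
  finally have le: "(\<integral>\<^sup>+w. g w \<partial>M) \<le> 1" by (simp add: int Liminf_const)
  have ge: "1 \<le> (\<integral>\<^sup>+w. g w \<partial>M) + ennreal (C / L)" if L: "0 < L" for L :: real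
  proof -
    have "(\<lambda>n. (\<integral>\<^sup>+w. min (ennreal (f n w)) (ennreal L) \<partial>M)) \<longlonglongrightarrow> (\<integral>\<^sup>+w. min (ennreal (g w)) (ennreal L) \<partial>M)"
    proof (rule nn_integral_dominated_convergence[where w = "\<lambda>_. ennreal L"])
      show "AE w in M. (\<lambda>n. min (ennreal (f n w)) (ennreal L)) \<longlonglongrightarrow> min (ennreal (g w)) (ennreal L)"
        using elim by (intro AE_I2 tendsto_min tendsto_const)
    qed (auto simp: emeasure_space_1)
    then have lim': "(\<lambda>n. (\<integral>\<^sup>+w. min (ennreal (f n w)) (ennreal L) \<partial>M) + ennreal (C / L)) \<longlonglongrightarrow>
        (\<integral>\<^sup>+w. min (ennreal (g w)) (ennreal L) \<partial>M) + ennreal (C / L)"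
      by (intro tendsto_add tendsto_const)
    have "1 \<le> (\<integral>\<^sup>+w. min (ennreal (f n w)) (ennreal L) \<partial>M) + ennreal (C / L)" for n
    proof -
      \<comment> \<open>Where \<open>f\<close> exceeds \<open>L\<close>, it is at most
        \<open>f * f / L\<close>.\<close>
      have pt: "ennreal (f n w) \<le> min (ennreal (f n w)) (ennreal L) + ennreal (1 / L) * ennreal ((f n w)\<^sup>2)" for w
      proof (cases "f n w \<le> L")
        case True
        then show ?thesis by (simp add: min_absorb1 ennreal_leI)
      next
        case False
        then have "f n w * L \<le> f n w * f n w" using nn[of n w] by (intro mult_left_mono) auto
        then have "f n w \<le> 1 / L * (f n w)\<^sup>2"
          using L by (simp add: field_simps power2_eq_square)
        then have "ennreal (f n w) \<le> ennreal (1 / L) * ennreal ((f n w)\<^sup>2)"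
          using L by (simp add: ennreal_leI flip: ennreal_mult)
        then show ?thesis by (rule order_trans) simp
      qed
      have "1 = (\<integral>\<^sup>+w. f n w \<partial>M)" by (simp add: int)
      also have "\<dots> \<le> (\<integral>\<^sup>+w. min (ennreal (f n w)) (ennreal L) + ennreal (1 / L) * ennreal ((f n w)\<^sup>2) \<partial>M)"
        by (intro nn_integral_mono pt)
      also have "\<dots> = (\<integral>\<^sup>+w. min (ennreal (f n w)) (ennreal L) \<partial>M) + ennreal (1 / L) * (\<integral>\<^sup>+w. (f n w)\<^sup>2 \<partial>M)"
        by (simp add: nn_integral_add nn_integral_cmult)
      also have "\<dots> \<le> (\<integral>\<^sup>+w. min (ennreal (f n w)) (ennreal L) \<partial>M) + ennreal (1 / L) * ennreal C"
        by (intro add_left_mono mult_left_mono L2) simp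
      also have "ennreal (1 / L) * ennreal C = ennreal (C / L)"
        using L C by (simp flip: ennreal_mult)
      finally show ?thesis .
    qed
    then have "1 \<le> (\<integral>\<^sup>+w. min (ennreal (g w)) (ennreal L) \<partial>M) + ennreal (C / L)"
      by (intro LIMSEQ_le_const[OF lim']) auto
    also have "\<dots> \<le> (\<integral>\<^sup>+w. g w \<partial>M) + ennreal (C / L)"
      by (intro add_right_mono nn_integral_mono) simp
    finally show ?thesis .
  qed
  have "(\<lambda>n. (\<integral>\<^sup>+w. g w \<partial>M) + ennreal (C / real (Suc n))) \<longlonglongrightarrow> (\<integral>\<^sup>+w. g w \<partial>M) + ennreal 0"
    by (intro tendsto_add tendsto_const tendsto_ennrealI lim_const_over_n[THEN LIMSEQ_Suc])
  then have "1 \<le> (\<integral>\<^sup>+w. g w \<partial>M) + ennreal 0"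
    by (rule LIMSEQ_le_const) (use ge in \<open>auto intro!: exI[of _ 0] simp del: of_nat_Suc\<close>)
  with le show ?thesis by simp
qed

locale drifted_brownian_motion = standard_brownian_motion M B
  for M :: "'a measure" and B +
  fixes X :: "real \<Rightarrow> 'a \<Rightarrow> real" and \<mu> \<sigma> :: real
  assumes X_def: "\<And>t w. X t w = \<mu> * t + \<sigma> * B t w"
begin

text \<open>\<open>X 0 = 0\<close> holds only almost surely. Subtracting the initial value gives a
  start in 0 on every path, so the arguments about paths need no null sets.\<close>

definition Z :: "real \<Rightarrow> 'a \<Rightarrow> real" where "Z t w = X t w - X 0 w"

lemma Z_0 [simp]: "Z 0 w = 0" by (simp add: Z_def)

lemma Z_diff: "Z t w - Z s w = \<mu> * (t - s) + \<sigma> * (B t w - B s w)"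
  by (simp add: Z_def X_def algebra_simps)

lemma Z_measurable [measurable]: "0 \<le> t \<Longrightarrow> Z t \<in> borel_measurable M"
proof -
  assume "0 \<le> t"
  then have "(\<lambda>w. (\<mu> * t + \<sigma> * B t w) - (\<mu> * 0 + \<sigma> * B 0 w)) \<in> borel_measurable M"
    using random_variable[of t] random_variable[of 0] by (intro borel_measurable_diff
      borel_measurable_add borel_measurable_times borel_measurable_const) auto
  then show ?thesis by (simp add: Z_def[abs_def] X_def)
qed

lemma Z_continuous: "w \<in> space M \<Longrightarrow> continuous_on {0..} (\<lambda>t. Z t w)"
  unfolding Z_def X_def by (intro continuous_intros continuous_paths)

section \<open>The filtration generated by \<open>Z\<close>\<close>

definition cylinders :: "real \<Rightarrow> 'a set set" where
  "cylinders t = {{w \<in> space M. \<forall>u\<in>U. Z u w \<le> f u} | U f. finite U \<and> U \<subseteq> {0..t}}"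

definition past :: "real \<Rightarrow> 'a measure" where "past t = sigma (space M) (cylinders t)"

lemma cylinders_Pow: "cylinders t \<subseteq> Pow (space M)"
  by (auto simp: cylinders_def)

lemma past_simps: "space (past t) = space M" "sets (past t) = sigma_sets (space M) (cylinders t)"
  using cylinders_Pow by (simp_all add: past_def)

text \<open>Lets the martingale property be checked on cylinders only; see
  \<open>W_past\<close>.\<close>

lemma Int_stable_cylinders: "Int_stable (cylinders t)"
proof (rule Int_stableI)
  fix a b assume "a \<in> cylinders t" "b \<in> cylinders t"
  then obtain U f V g where a: "a = {w \<in> space M. \<forall>u\<in>U. Z u w \<le> f u}" "finite U" "U \<subseteq> {0..t}"
    and b: "b = {w \<in> space M. \<forall>u\<in>V. Z u w \<le> g u}" "finite V" "V \<subseteq> {0..t}"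
    unfolding cylinders_def by blast
  define h where "h u = (if u \<in> U then if u \<in> V then min (f u) (g u) else f u else g u)" for u
  have "a \<inter> b = {w \<in> space M. \<forall>u\<in>U \<union> V. Z u w \<le> h u}"
    unfolding a b h_def by (auto split: if_splits)
  then show "a \<inter> b \<in> cylinders t" unfolding cylinders_def using a b by blast
qed

lemma Z_past [measurable]:
  assumes "0 \<le> u" "u \<le> t"
  shows "Z u \<in> borel_measurable (past t)"
  unfolding borel_measurable_iff_le
proof
  fix c
  have "{w \<in> space M. \<forall>v\<in>{u}. Z v w \<le> c} \<in> cylinders t"
    unfolding cylinders_def using assms by (auto intro!: exI[of _ "{u}"] exI[of _ "\<lambda>_. c"])
  then show "{w \<in> space (past t). Z u w \<le> c} \<in> sets (past t)"
    by (auto simp: past_simps)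
qed

lemma past_mono: "s \<le> t \<Longrightarrow> sets (past s) \<subseteq> sets (past t)"
  unfolding past_simps by (intro sigma_sets_mono') (force simp: cylinders_def)

text \<open>Stated for an arbitrary \<open>N\<close> because it is needed twice: for
  \<open>M\<close> itself, and for the path \<sigma>-algebra from which the exponential clock is
  independent.\<close>

lemma past_le_if_measurable:
  assumes "space N = space M" "\<And>u. 0 \<le> u \<Longrightarrow> Z u \<in> borel_measurable N"
  shows "sets (past t) \<subseteq> sets N"
proof -
  have "cylinders t \<subseteq> sets N"
  proof
    fix a assume "a \<in> cylinders t"
    then obtain U f where a: "a = {w \<in> space M. \<forall>u\<in>U. Z u w \<le> f u}" "finite U" "U \<subseteq> {0..t}"
      unfolding cylinders_def by blast
    have "{w \<in> space N. \<forall>u\<in>U. Z u w \<le> f u} \<in> sets N"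
      using a assms(2) by (intro sets.sets_Collect_finite_All a) auto
    then show "a \<in> sets N" unfolding a assms(1) .
  qed
  then show ?thesis unfolding past_simps assms(1)[symmetric] by (rule sets.sigma_sets_subset)
qed

lemma past_le: "sets (past t) \<subseteq> sets M"
  by (rule past_le_if_measurable) auto

section \<open>The Laplace exponent \<open>\<kappa>\<close> of \<open>Z\<close> and the exponential
  martingale\<close>

definition \<kappa> :: "real \<Rightarrow> real" where "\<kappa> c = c * \<mu> + c\<^sup>2 * \<sigma>\<^sup>2 / 2"

text \<open>An exponent \<open>c\<close> with \<open>\<kappa> c = q\<close> turns killing at rate \<open>q\<close> into the compensator of \<open>exp (c * Z)\<close>.\<close>

definition W :: "real \<Rightarrow> real \<Rightarrow> 'a \<Rightarrow> real" where "W c t w = exp (c * Z t w - \<kappa> c * t)"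

lemma W_measurable [measurable]: "0 \<le> t \<Longrightarrow> W c t \<in> borel_measurable M"
  unfolding W_def by measurable

lemma W_pos: "0 < W c t w" by (simp add: W_def)

lemma W_increment:
  assumes "0 \<le> s" "s < t"
  shows "(\<integral>\<^sup>+w. ennreal (exp (c * (\<mu> * (t - s) + \<sigma> * (B t w - B s w)) - \<kappa> c * (t - s))) \<partial>M) = 1"
proof -
  let ?h = "t - s"
  have h: "0 < ?h" using assms by simp
  have "(\<integral>\<^sup>+w. ennreal (exp (c * (\<mu> * ?h + \<sigma> * (B t w - B s w)) - \<kappa> c * ?h)) \<partial>M)
      = (\<integral>\<^sup>+x. normal_density 0 (sqrt ?h) x * ennreal (exp (c * (\<mu> * ?h + \<sigma> * x) - \<kappa> c * ?h)) \<partial>lborel)"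
    by (rule distributed_nn_integral[OF normal_increments[OF assms], symmetric]) simp
  also have "\<dots> = (\<integral>\<^sup>+x. normal_density (c * \<sigma> * ?h) (sqrt ?h) x \<partial>lborel)"
  proof (rule nn_integral_cong)
    fix x
    \<comment> \<open>Completing the square: the exponential weight shifts the mean of the Gaussian
      from 0 to \<open>c * \<sigma> * ?h\<close>, and \<open>\<kappa> c * ?h\<close> is the constant
      left over.\<close>
    have "- x\<^sup>2 / (2 * ?h) + (c * (\<mu> * ?h + \<sigma> * x) - \<kappa> c * ?h) = - (x - c * \<sigma> * ?h)\<^sup>2 / (2 * ?h)"
      using h by (simp add: \<kappa>_def field_simps power2_eq_square)
    then have "exp (- x\<^sup>2 / (2 * ?h)) * exp (c * (\<mu> * ?h + \<sigma> * x) - \<kappa> c * ?h) = exp (- (x - c * \<sigma> * ?h)\<^sup>2 / (2 * ?h))"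
      unfolding exp_add[symmetric] by (simp only:)
    then have "normal_density 0 (sqrt ?h) x * exp (c * (\<mu> * ?h + \<sigma> * x) - \<kappa> c * ?h) = normal_density (c * \<sigma> * ?h) (sqrt ?h) x"
      using h unfolding normal_density_def by (simp add: mult.assoc)
    then show "ennreal (normal_density 0 (sqrt ?h) x) * ennreal (exp (c * (\<mu> * ?h + \<sigma> * x) - \<kappa> c * ?h))
        = ennreal (normal_density (c * \<sigma> * ?h) (sqrt ?h) x)"
      by (simp flip: ennreal_mult)
  qed
  also have "\<dots> = emeasure (density lborel (normal_density (c * \<sigma> * ?h) (sqrt ?h))) UNIV"
    by (simp add: emeasure_density)
  also have "\<dots> = 1"
    using prob_space.emeasure_space_1[OF prob_space_normal_density[of "sqrt ?h" "c * \<sigma> * ?h"]] h by simp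
  finally show ?thesis .
qed

text \<open>The martingale property on a cylinder: its indicator and \<open>W c s\<close> depend on
  increments up to \<open>s\<close>, while \<open>W c t / W c s\<close> depends on the increment
  after \<open>s\<close> and has mean 1, so the integral factors.\<close>

lemma W_cylinder:
  assumes s: "0 \<le> s" "s < t" and A: "A \<in> cylinders s"
  shows "(\<integral>\<^sup>+w. ennreal (W c t w) * indicator A w \<partial>M) = (\<integral>\<^sup>+w. ennreal (W c s w) * indicator A w \<partial>M)"
proof -
  obtain U f where A: "A = {w \<in> space M. \<forall>u\<in>U. Z u w \<le> f u}" "finite U" "U \<subseteq> {0..s}"
    using A unfolding cylinders_def by blast
  \<comment> \<open>Adding 0 and \<open>s\<close> makes every \<open>Z u\<close> with
    \<open>u\<close> in \<open>U\<close> a sum of consecutive increments, and puts \<open>s\<close>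
    last, so that the increment from \<open>s\<close> to \<open>t\<close> is a single one.\<close>
  define V where "V = U \<union> {0, s}"
  define L where "L = sorted_list_of_set V"
  define n where "n = length L - 1"
  have V: "finite V" "V \<subseteq> {0..s}" "0 \<in> V" "s \<in> V" using A s by (auto simp: V_def)
  have L: "set L = V" "sorted_wrt (<) L" "L \<noteq> []" unfolding L_def using V by auto
  have len: "length L = Suc n" using L by (cases L) (auto simp: n_def)
  have nth_less: "i < j \<Longrightarrow> j < length L \<Longrightarrow> L ! i < L ! j" for i j
    using L(2) by (simp add: sorted_wrt_iff_nth_less)
  have L0: "L ! 0 = 0"
  proof -
    obtain i where "i < length L" "L ! i = 0" using L(1) V(3) by (metis in_set_conv_nth)
    moreover have "0 \<le> L ! 0" using L(1) V(2) len nth_mem[of 0 L] by force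
    ultimately show ?thesis using nth_less[of 0 i] by (cases i) auto
  qed
  have Ln: "L ! n = s"
  proof -
    obtain i where i: "i < length L" "L ! i = s" using L(1) V(4) by (metis in_set_conv_nth)
    moreover have "L ! n \<le> s" using L(1) V(2) len nth_mem[of n L] by force
    ultimately show ?thesis using nth_less[of i n] len by (cases "i = n") auto
  qed
  define T where "T i = (if i \<le> n then L ! i else t)" for i
  have T: "T 0 = 0" "T n = s" "T (Suc n) = t" using L0 Ln by (auto simp: T_def)
  define D where "D i w = B (T (Suc i)) w - B (T i) w" for i w
  have ind: "indep_vars (\<lambda>_. borel) D {..<Suc n}"
    unfolding D_def
  proof (rule independent_increments)
    show "T i < T (Suc i)" if "i < Suc n" for i
      using that nth_less[of i "Suc i"] len Ln s by (cases "i = n") (auto simp: T_def)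
  qed (simp add: T)
  have tele: "(\<Sum>i<k. D i w) = B (T k) w - B 0 w" for k w
    unfolding D_def using sum_lessThan_telescope[of "\<lambda>k. B (T k) w" k] T by simp
  define val where "val k g = \<mu> * T k + \<sigma> * (\<Sum>i<k. g i)" for k and g :: "nat \<Rightarrow> real"
  \<comment> \<open>\<open>undefined\<close> is the value that \<open>restrict\<close> gives outside
    the index set; \<open>val k\<close> reads only indices below \<open>k \<le> n\<close>.\<close>
  have val: "val k (\<lambda>i. if i < n then D i w else undefined) = Z (T k) w" if "k \<le> n" for k w
  proof -
    have "(\<Sum>i<k. if i < n then D i w else undefined) = (\<Sum>i<k. D i w)"
      using that by (intro sum.cong) auto
    then have "val k (\<lambda>i. if i < n then D i w else undefined) = \<mu> * T k + \<sigma> * (B (T k) w - B 0 w)"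
      unfolding val_def tele by (rule arg_cong)
    then show ?thesis by (simp add: Z_def X_def algebra_simps)
  qed
  define Y1 where "Y1 g = ennreal (exp (c * val n g - \<kappa> c * s)) * indicator {g. \<forall>k\<in>{..n}. L ! k \<in> U \<longrightarrow> val k g \<le> f (L ! k)} g" for g
  define Y2 where "Y2 g = ennreal (exp (c * (\<mu> * (t - s) + \<sigma> * g n) - \<kappa> c * (t - s)))" for g :: "nat \<Rightarrow> real"
  have val_m: "val k \<in> borel_measurable (PiM {..<n} (\<lambda>_. borel))" if "k \<le> n" for k
    unfolding val_def using that by (intro borel_measurable_add borel_measurable_times borel_measurable_const
      borel_measurable_sum measurable_component_singleton) auto
  have Y1: "Y1 \<in> borel_measurable (PiM {..<n} (\<lambda>_. borel))"
  proof -
    have "{g \<in> space (PiM {..<n} (\<lambda>_. borel)). \<forall>k\<in>{..n}. L ! k \<in> U \<longrightarrow> val k g \<le> f (L ! k)}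
        \<in> sets (PiM {..<n} (\<lambda>_. borel))"
      using val_m by (intro sets.sets_Collect_finite_All' sets.sets_Collect_imp) auto
    then have "{g. \<forall>k\<in>{..n}. L ! k \<in> U \<longrightarrow> val k g \<le> f (L ! k)} \<inter> space (PiM {..<n} (\<lambda>_. borel))
        \<in> sets (PiM {..<n} (\<lambda>_. borel))" by (simp add: Int_def conj_commute)
    then show ?thesis unfolding Y1_def using val_m[of n]
      by (intro borel_measurable_times_ennreal borel_measurable_indicator') (auto simp: conj_commute Int_def)
  qed
  have Y2: "Y2 \<in> borel_measurable (PiM {n} (\<lambda>_. borel))" unfolding Y2_def by measurable
  define R1 where "R1 w = restrict (\<lambda>i. D i w) {..<n}" for w
  define R2 where "R2 w = restrict (\<lambda>i. D i w) {n}" for w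
  have "indep_var (PiM {..<n} (\<lambda>_. borel)) R1 (PiM {n} (\<lambda>_. borel)) R2"
    unfolding R1_def R2_def by (rule indep_var_restrict[OF ind]) auto
  from indep_var_compose[OF this Y1 Y2]
  have prod: "(\<integral>\<^sup>+w. Y1 (R1 w) * Y2 (R2 w) \<partial>M) = (\<integral>\<^sup>+w. Y1 (R1 w) \<partial>M) * (\<integral>\<^sup>+w. Y2 (R2 w) \<partial>M)"
    using indep_var_nn_integral[of "Y1 \<circ> R1" "Y2 \<circ> R2"] by simp
  have Y2R: "Y2 (R2 w) = ennreal (exp (c * (\<mu> * (t - s) + \<sigma> * (B t w - B s w)) - \<kappa> c * (t - s)))" for w
    by (simp add: Y2_def R2_def D_def T)
  have R1: "val k (R1 w) = Z (T k) w" if "k \<le> n" for k w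
    using val[OF that] by (simp add: R1_def restrict_def)
  have Y1R: "Y1 (R1 w) = ennreal (W c s w) * indicator A w" if w: "w \<in> space M" for w
  proof -
    have "(\<forall>k\<in>{..n}. L ! k \<in> U \<longrightarrow> val k (R1 w) \<le> f (L ! k)) \<longleftrightarrow> (\<forall>u\<in>U. Z u w \<le> f u)"
    proof -
      have "(\<forall>k\<in>{..n}. L ! k \<in> U \<longrightarrow> val k (R1 w) \<le> f (L ! k)) \<longleftrightarrow> (\<forall>k<length L. L ! k \<in> U \<longrightarrow> Z (L ! k) w \<le> f (L ! k))"
        using R1 by (auto simp: len T_def less_Suc_eq_le)
      also have "\<dots> \<longleftrightarrow> (\<forall>u\<in>set L. u \<in> U \<longrightarrow> Z u w \<le> f u)" by (simp add: all_set_conv_all_nth)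
      also have "\<dots> \<longleftrightarrow> (\<forall>u\<in>U. Z u w \<le> f u)" unfolding L V_def by auto
      finally show ?thesis .
    qed
    then show ?thesis using w R1[of n w] by (simp add: Y1_def A W_def T indicator_def)
  qed
  have "ennreal (W c t w) * indicator A w = Y1 (R1 w) * Y2 (R2 w)" if w: "w \<in> space M" for w
  proof -
    have "Z t w = Z s w + (\<mu> * (t - s) + \<sigma> * (B t w - B s w))" using Z_diff[of t w s] by simp
    then have "W c t w = W c s w * exp (c * (\<mu> * (t - s) + \<sigma> * (B t w - B s w)) - \<kappa> c * (t - s))"
    proof -
      have "exp (c * (z + y) - k * t) = exp (c * z - k * s) * exp (c * y - k * (t - s))" for z y k :: real
        unfolding exp_add[symmetric] by (simp add: algebra_simps)
      then show ?thesis unfolding W_def \<open>Z t w = _\<close> by (simp only:)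
    qed
    then show ?thesis unfolding Y1R[OF w] Y2R
      by (simp add: ennreal_mult W_def mult_ac)
  qed
  then have "(\<integral>\<^sup>+w. ennreal (W c t w) * indicator A w \<partial>M) = (\<integral>\<^sup>+w. Y1 (R1 w) * Y2 (R2 w) \<partial>M)"
    by (intro nn_integral_cong)
  also have "\<dots> = (\<integral>\<^sup>+w. ennreal (W c s w) * indicator A w \<partial>M)"
  proof -
    have "(\<integral>\<^sup>+w. Y2 (R2 w) \<partial>M) = 1" unfolding Y2R by (rule W_increment[OF s])
    moreover have "(\<integral>\<^sup>+w. Y1 (R1 w) \<partial>M) = (\<integral>\<^sup>+w. ennreal (W c s w) * indicator A w \<partial>M)"
      by (intro nn_integral_cong Y1R)
    ultimately show ?thesis unfolding prod by simp
  qed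
  finally show ?thesis .
qed


lemma nn_integral_W:
  assumes "0 \<le> t"
  shows "(\<integral>\<^sup>+w. ennreal (W c t w) \<partial>M) = 1"
proof (cases "t = 0")
  case True
  then show ?thesis by (simp add: W_def emeasure_space_1)
next
  case False
  have "ennreal (W c t w) = ennreal (exp (c * (\<mu> * (t - 0) + \<sigma> * (B t w - B 0 w)) - \<kappa> c * (t - 0)))" for w
    unfolding Z_diff[symmetric] by (simp add: W_def)
  then show ?thesis using W_increment[of 0 t c] False assms by simp
qed

text \<open>Dynkin's argument extends the martingale property from cylinders to the generated
  \<sigma>-algebra. Stated through integrals over past events, it needs no conditional
  expectations.\<close>

lemma W_past:
  assumes s: "0 \<le> s" "s \<le> t" and A: "A \<in> sets (past s)"
  shows "(\<integral>\<^sup>+w. ennreal (W c t w) * indicator A w \<partial>M) = (\<integral>\<^sup>+w. ennreal (W c s w) * indicator A w \<partial>M)"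
proof (cases "s = t")
  case False
  have t: "0 \<le> t" using s by simp
  have sub: "sigma_sets (space M) (cylinders s) \<subseteq> sets M"
    using past_le[of s] by (simp add: past_simps)
  have "A \<in> sigma_sets (space M) (cylinders s)" using A by (simp add: past_simps)
  from Int_stable_cylinders cylinders_Pow this show ?thesis
  proof (induction rule: sigma_sets_induct_disjoint)
    case (basic A)
    then show ?case using W_cylinder s False by simp
  next
    case empty
    then show ?case by simp
  next
    case (compl A)
    then have [measurable]: "A \<in> sets M" using sub by auto
    have split: "(\<integral>\<^sup>+w. ennreal (W c u w) * indicator A w \<partial>M) + (\<integral>\<^sup>+w. ennreal (W c u w) * indicator (space M - A) w \<partial>M) = 1"
      if "0 \<le> u" for u
    proof -
      have "(\<integral>\<^sup>+w. ennreal (W c u w) * indicator A w \<partial>M) + (\<integral>\<^sup>+w. ennreal (W c u w) * indicator (space M - A) w \<partial>M)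
          = (\<integral>\<^sup>+w. ennreal (W c u w) * indicator A w + ennreal (W c u w) * indicator (space M - A) w \<partial>M)"
        using that by (intro nn_integral_add[symmetric]) auto
      also have "\<dots> = (\<integral>\<^sup>+w. ennreal (W c u w) \<partial>M)"
        by (intro nn_integral_cong) (auto simp: indicator_def)
      finally show ?thesis using nn_integral_W[OF that] by simp
    qed
    \<comment> \<open>Finiteness allows the integral over \<open>A\<close> to be cancelled from the
      total mass 1, which leaves the complement.\<close>
    have "(\<integral>\<^sup>+w. ennreal (W c s w) * indicator A w \<partial>M) \<noteq> top"
      using split[OF s(1)] by (auto simp: top_unique)
    then show ?case
      using split[OF t] split[OF s(1)] compl by (metis ennreal_add_left_cancel infinity_ennreal_def)
  next
    case (union A)
    have [measurable]: "A i \<in> sets M" for i using union(2) sub by auto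
    have "(\<integral>\<^sup>+w. ennreal (W c u w) * indicator (\<Union>i. A i) w \<partial>M) = (\<Sum>i. \<integral>\<^sup>+w. ennreal (W c u w) * indicator (A i) w \<partial>M)"
      if "0 \<le> u" for u
    proof -
      have "(\<integral>\<^sup>+w. ennreal (W c u w) * indicator (\<Union>i. A i) w \<partial>M) = (\<integral>\<^sup>+w. (\<Sum>i. ennreal (W c u w) * indicator (A i) w) \<partial>M)"
        unfolding ennreal_suminf_cmult suminf_indicator[OF union(1)] ..
      also have "\<dots> = (\<Sum>i. \<integral>\<^sup>+w. ennreal (W c u w) * indicator (A i) w \<partial>M)"
        using that by (intro nn_integral_suminf) auto
      finally show ?thesis .
    qed
    then show ?case using s t union(3) by simp
  qed
qed simp

text \<open>\<open>G\<close> rounds \<open>R\<close> up to the grid of width \<open>m / n\<close>,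
  so that \<open>G\<close> takes finitely many values, each on an event of the corresponding past.
  On such an event \<open>W\<close> at the grid time may be replaced by \<open>W\<close> at
  \<open>m\<close>, and the pieces add up to the integral at the fixed time
  \<open>m\<close>.\<close>

lemma optional_stopping_grid:
  fixes R :: "'a \<Rightarrow> real"
  assumes n: "0 < n" and m: "0 < m"
    and R: "\<And>w. w \<in> space M \<Longrightarrow> 0 \<le> R w \<and> R w \<le> m"
    and stop: "\<And>t. 0 \<le> t \<Longrightarrow> t < m \<Longrightarrow> {w \<in> space M. R w \<le> t} \<in> sets (past t)"
  defines "G \<equiv> \<lambda>w. m * real (nat \<lceil>R w * n / m\<rceil>) / real n"
  shows "(\<lambda>w. W c (G w) w) \<in> borel_measurable M" "(\<integral>\<^sup>+w. ennreal (W c (G w) w) \<partial>M) = 1"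
proof -
  define t where "t k = m * real k / real n" for k
  have t: "0 \<le> t k" "k \<le> n \<Longrightarrow> t k \<le> m" "t n = m" for k
    using n m by (simp_all add: t_def field_simps)
  define N where "N w = nat \<lceil>R w * n / m\<rceil>" for w
  define A where "A k = {w \<in> space M. N w = k}" for k
  have le: "N w \<le> k \<longleftrightarrow> R w \<le> t k" for w k
  proof -
    have "N w \<le> k \<longleftrightarrow> R w * n / m \<le> real k"
      by (simp add: N_def nat_le_iff ceiling_le_iff)
    also have "\<dots> \<longleftrightarrow> R w \<le> t k" using n m by (simp add: t_def field_simps)
    finally show ?thesis .
  qed
  have stop': "{w \<in> space M. R w \<le> t k} \<in> sets (past (t k))" if "k \<le> n" for k
  proof (cases "t k < m")
    \<comment> \<open>At the last grid point the event is the whole space; hence the hypothesis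
      \<open>stop\<close> need only cover times below \<open>m\<close>, which suits a time capped at
      \<open>m\<close>.\<close>
    case False
    then have "t k = m" using t that by force
    then have "{w \<in> space M. R w \<le> t k} = space (past (t k))" using R by (auto simp: past_simps)
    then show ?thesis by simp
  qed (use stop t in auto)
  have A: "A k \<in> sets (past (t k))" if "k \<le> n" for k
  proof (cases k)
    case 0
    then have "A k = {w \<in> space M. R w \<le> t k}" by (simp add: A_def flip: le)
    then show ?thesis using stop'[OF that] by simp
  next
    case (Suc l)
    have "A k = {w \<in> space M. R w \<le> t k} - {w \<in> space M. R w \<le> t l}"
      unfolding A_def le[symmetric] Suc by auto
    moreover have "sets (past (t l)) \<subseteq> sets (past (t k))"
      using m n by (intro past_mono) (auto simp: t_def Suc divide_right_mono)
    ultimately show ?thesis using stop'[OF that] stop'[of l] that Suc by auto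
  qed
  have AM[measurable]: "A k \<in> sets M" if "k \<le> n" for k using A[OF that] past_le by auto
  have G: "W c (G w) w = (\<Sum>k\<le>n. W c (t k) w * indicator (A k) w)" if w: "w \<in> space M" for w
  proof -
    define k where "k = N w"
    have "k \<le> n" unfolding k_def le t using R[OF w] by simp
    have "(\<Sum>k\<le>n. W c (t k) w * indicator (A k) w) = (\<Sum>l\<in>{k}. W c (t l) w)"
      using \<open>k \<le> n\<close> w by (intro sum.mono_neutral_cong_right) (auto simp: A_def k_def indicator_def)
    then show ?thesis by (simp add: G_def t_def k_def N_def)
  qed
  have meas: "(\<lambda>w. \<Sum>k\<le>n. W c (t k) w * indicator (A k) w) \<in> borel_measurable M"
    using t AM by (intro borel_measurable_sum borel_measurable_times borel_measurable_indicator) auto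
  then show "(\<lambda>w. W c (G w) w) \<in> borel_measurable M"
    by (rule measurable_cong[THEN iffD2, rotated]) (use G in auto)
  have "(\<integral>\<^sup>+w. ennreal (W c (G w) w) \<partial>M) = (\<integral>\<^sup>+w. (\<Sum>k\<le>n. ennreal (W c (t k) w) * indicator (A k) w) \<partial>M)"
  proof (rule nn_integral_cong)
    fix w assume "w \<in> space M"
    have "ennreal (\<Sum>k\<le>n. W c (t k) w * indicator (A k) w) = (\<Sum>k\<le>n. ennreal (W c (t k) w * indicator (A k) w))"
      using W_pos by (intro sum_ennreal[symmetric]) (simp add: less_imp_le)
    also have "\<dots> = (\<Sum>k\<le>n. ennreal (W c (t k) w) * indicator (A k) w)"
      by (intro sum.cong) (auto simp: indicator_def)
    finally show "ennreal (W c (G w) w) = (\<Sum>k\<le>n. ennreal (W c (t k) w) * indicator (A k) w)"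
      unfolding G[OF \<open>w \<in> space M\<close>] .
  qed
  also have "\<dots> = (\<Sum>k\<le>n. \<integral>\<^sup>+w. ennreal (W c (t k) w) * indicator (A k) w \<partial>M)"
    using t AM by (intro nn_integral_sum) auto
  also have "\<dots> = (\<Sum>k\<le>n. \<integral>\<^sup>+w. ennreal (W c m w) * indicator (A k) w \<partial>M)"
    using t A by (intro sum.cong refl W_past[symmetric]) auto
  also have "\<dots> = (\<integral>\<^sup>+w. (\<Sum>k\<le>n. ennreal (W c m w) * indicator (A k) w) \<partial>M)"
    using m AM by (intro nn_integral_sum[symmetric]) auto
  also have "\<dots> = (\<integral>\<^sup>+w. ennreal (W c m w) \<partial>M)"
  proof (rule nn_integral_cong)
    fix w assume w: "w \<in> space M"
    define k where "k = N w"
    have "k \<le> n" unfolding k_def le t using R[OF w] by simp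
    have "(\<Sum>k\<le>n. ennreal (W c m w) * indicator (A k) w) = (\<Sum>l\<in>{k}. ennreal (W c m w))"
      using \<open>k \<le> n\<close> w by (intro sum.mono_neutral_cong_right) (auto simp: A_def k_def indicator_def)
    then show "(\<Sum>k\<le>n. ennreal (W c m w) * indicator (A k) w) = ennreal (W c m w)" by simp
  qed
  also have "\<dots> = 1" using m by (intro nn_integral_W) simp
  finally show "(\<integral>\<^sup>+w. ennreal (W c (G w) w) \<partial>M) = 1" .
qed

text \<open>Refine the grid: the rounded times decrease to \<open>R\<close> within
  \<open>m / Suc n\<close>, paths are continuous, and the L2 bound needed to pass to the limit comes
  from the grid identity for the exponent \<open>2 * c\<close>.\<close>

lemma optional_stopping:
  fixes R :: "'a \<Rightarrow> real"
  assumes m: "0 < m"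
    and R: "\<And>w. w \<in> space M \<Longrightarrow> 0 \<le> R w \<and> R w \<le> m"
    and stop: "\<And>t. 0 \<le> t \<Longrightarrow> t < m \<Longrightarrow> {w \<in> space M. R w \<le> t} \<in> sets (past t)"
  shows "(\<lambda>w. W c (R w) w) \<in> borel_measurable M" "(\<integral>\<^sup>+w. ennreal (W c (R w) w) \<partial>M) = 1"
proof -
  define G where "G n w = m * real (nat \<lceil>R w * real (Suc n) / m\<rceil>) / real (Suc n)" for n w
  have grid: "(\<lambda>w. W c (G n w) w) \<in> borel_measurable M" "(\<integral>\<^sup>+w. ennreal (W c (G n w) w) \<partial>M) = 1" for n c
    using optional_stopping_grid[OF _ m R stop, of "Suc n" c] by (simp_all add: G_def)
  have G_bounds: "R w \<le> G n w" "G n w \<le> R w + m / real (Suc n)" "G n w \<le> m" if w: "w \<in> space M" for n w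
  proof -
    have nn: "0 \<le> R w * real (Suc n) / m" using R[OF w] m by simp
    then have k: "real (nat \<lceil>R w * real (Suc n) / m\<rceil>) = of_int \<lceil>R w * real (Suc n) / m\<rceil>" by simp
    have c: "R w * real (Suc n) / m \<le> of_int \<lceil>R w * real (Suc n) / m\<rceil>"
      "of_int \<lceil>R w * real (Suc n) / m\<rceil> \<le> R w * real (Suc n) / m + 1" by linarith+
    have "m / real (Suc n) * (R w * real (Suc n) / m) \<le> G n w"
      "G n w \<le> m / real (Suc n) * (R w * real (Suc n) / m + 1)"
    proof -
      have "G n w = m / real (Suc n) * of_int \<lceil>R w * real (Suc n) / m\<rceil>" unfolding G_def k by simp
      then show "m / real (Suc n) * (R w * real (Suc n) / m) \<le> G n w"
        "G n w \<le> m / real (Suc n) * (R w * real (Suc n) / m + 1)"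
        using m c by (simp_all only: mult_left_mono divide_nonneg_nonneg less_imp_le of_nat_0_le_iff)
    qed
    moreover have "m / real (Suc n) * (R w * real (Suc n) / m) = R w"
      using m by (simp del: of_nat_Suc)
    ultimately show "R w \<le> G n w" "G n w \<le> R w + m / real (Suc n)"
      by (simp_all only: distrib_left mult_1_right)
    have "R w * real (Suc n) \<le> m * real (Suc n)" using R[OF w] by (intro mult_right_mono) auto
    then have "R w * real (Suc n) / m \<le> real (Suc n)" using m by (simp add: divide_le_eq mult.commute del: of_nat_Suc)
    then have "nat \<lceil>R w * real (Suc n) / m\<rceil> \<le> Suc n" by (simp add: nat_le_iff ceiling_le_iff del: of_nat_Suc)
    then have "m * real (nat \<lceil>R w * real (Suc n) / m\<rceil>) \<le> m * real (Suc n)"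
      using m by (intro mult_left_mono of_nat_mono) simp_all
    then show "G n w \<le> m" unfolding G_def by (simp add: divide_le_eq)
  qed
  have lim: "(\<lambda>n. W c (G n w) w) \<longlonglongrightarrow> W c (R w) w" if w: "w \<in> space M" for w
  proof -
    have "(\<lambda>n. R w + m / real (Suc n)) \<longlonglongrightarrow> R w + 0"
      by (intro tendsto_add tendsto_const lim_const_over_n[THEN LIMSEQ_Suc])
    then have G: "(\<lambda>n. G n w) \<longlonglongrightarrow> R w"
      using G_bounds[OF w] by (intro tendsto_sandwich[of "\<lambda>_. R w" "\<lambda>n. G n w" sequentially "\<lambda>n. R w + m / real (Suc n)"]) auto
    have cont: "continuous_on {0..} (\<lambda>t. W c t w)"
      unfolding W_def by (intro continuous_intros Z_continuous w)
    show ?thesis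
      by (rule continuous_on_tendsto_compose[OF cont G])
        (use R[OF w] G_bounds[OF w] in \<open>auto intro!: always_eventually order_trans[of 0 "R w"]\<close>)
  qed
  show "(\<lambda>w. W c (R w) w) \<in> borel_measurable M"
    by (rule borel_measurable_LIMSEQ_real[OF lim grid(1)])
  \<comment> \<open>The square of \<open>W c u\<close> is \<open>W (2 * c) u\<close> times
    \<open>exp ((\<kappa> (2 * c) - 2 * \<kappa> c) * u)\<close>, and
    \<open>u \<le> m\<close>.\<close>
  define C where "C = exp (\<bar>\<kappa> (2 * c) - 2 * \<kappa> c\<bar> * m)"
  have sq: "(W c u w)\<^sup>2 \<le> C * W (2 * c) u w" if "0 \<le> u" "u \<le> m" for u w
  proof -
    have "(\<kappa> (2 * c) - 2 * \<kappa> c) * u \<le> \<bar>\<kappa> (2 * c) - 2 * \<kappa> c\<bar> * m"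
      using that by (intro mult_mono) auto
    then have "2 * (c * Z u w - \<kappa> c * u) \<le> \<bar>\<kappa> (2 * c) - 2 * \<kappa> c\<bar> * m + (2 * c * Z u w - \<kappa> (2 * c) * u)"
      by (simp add: algebra_simps)
    then show ?thesis unfolding W_def C_def exp_add[symmetric] exp_double[symmetric] by simp
  qed
  show "(\<integral>\<^sup>+w. ennreal (W c (R w) w) \<partial>M) = 1"
  proof (rule nn_integral_limit_of_L2_bounded[OF grid(1) _ lim grid(2)])
    show "(\<integral>\<^sup>+w. ennreal ((W c (G n w) w)\<^sup>2) \<partial>M) \<le> ennreal C" for n
    proof -
      have "(\<integral>\<^sup>+w. ennreal ((W c (G n w) w)\<^sup>2) \<partial>M) \<le> (\<integral>\<^sup>+w. ennreal C * ennreal (W (2 * c) (G n w) w) \<partial>M)"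
      proof (rule nn_integral_mono)
        fix w assume w: "w \<in> space M"
        have "(W c (G n w) w)\<^sup>2 \<le> C * W (2 * c) (G n w) w"
          using G_bounds[OF w, of n] R[OF w] by (intro sq) auto
        then show "ennreal ((W c (G n w) w)\<^sup>2) \<le> ennreal C * ennreal (W (2 * c) (G n w) w)"
          using W_pos[of "2 * c" "G n w" w] by (simp add: C_def ennreal_leI flip: ennreal_mult)
      qed
      also have "\<dots> = ennreal C * (\<integral>\<^sup>+w. ennreal (W (2 * c) (G n w) w) \<partial>M)"
        using grid(1) by (intro nn_integral_cmult) auto
      finally show ?thesis by (simp add: grid(2))
    qed
  qed (use W_pos in \<open>auto simp: C_def less_imp_le\<close>)
qed

end

subsection \<open>Hitting times\<close>

text \<open>The probability that an exponential clock of rate \<open>q\<close> outlasts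
  \<open>T\<close>. The case \<infinity> is split off because
  \<open>real_of_ereal \<infinity>\<close> is 0 and would give 1.\<close>

definition discount :: "real \<Rightarrow> ereal \<Rightarrow> real" where
  "discount q T = (if T = \<infinity> then 0 else exp (- q * real_of_ereal T))"

lemma discount_measurable [measurable]: "discount q \<in> borel_measurable borel"
  unfolding discount_def by measurable

lemma discount_simps [simp]: "discount q \<infinity> = 0" "discount q (ereal t) = exp (- q * t)"
  by (simp_all add: discount_def)

lemma discount_bounds: "0 < q \<Longrightarrow> 0 \<le> T \<Longrightarrow> 0 \<le> discount q T \<and> discount q T \<le> 1"
  by (cases T) (auto simp: discount_def)

lemma discount_mono: "0 < q \<Longrightarrow> ereal m \<le> T \<Longrightarrow> discount q T \<le> exp (- q * m)"
  by (cases T) auto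

context drifted_brownian_motion
begin

abbreviation path :: "'a \<Rightarrow> real \<Rightarrow> real" where "path w \<equiv> (\<lambda>t. Z t w)"

section \<open>Stopping times at which the path is at a fixed level\<close>

definition stops :: "('a \<Rightarrow> ereal) \<Rightarrow> bool" where
  "stops S \<longleftrightarrow> (\<forall>w\<in>space M. 0 \<le> S w) \<and> (\<forall>t\<ge>0. {w \<in> space M. S w \<le> ereal t} \<in> sets (past t))"

text \<open>With a deterministic height at time \<open>S\<close>, the value of the exponential
  martingale there is a constant times the discount, which replaces conditioning on the
  position.\<close>

definition stops_at :: "('a \<Rightarrow> ereal) \<Rightarrow> real \<Rightarrow> bool" where
  "stops_at S z \<longleftrightarrow> stops S \<and> (\<forall>w\<in>space M. \<forall>s. S w = ereal s \<longrightarrow> Z s w = z)"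

lemma stops_nonneg: "stops S \<Longrightarrow> w \<in> space M \<Longrightarrow> 0 \<le> S w"
  by (simp add: stops_def)

lemma stopsD: "stops S \<Longrightarrow> 0 \<le> s \<Longrightarrow> s \<le> t \<Longrightarrow> {w \<in> space M. S w \<le> ereal s} \<in> sets (past t)"
  unfolding stops_def using past_mono by blast

lemma stops_measurable:
  assumes S: "stops S" and N: "space N = space M" "\<And>t. sets (past t) \<subseteq> sets N"
  shows "S \<in> borel_measurable N"
proof (rule borel_measurableI_le)
  fix y :: ereal
  show "{w \<in> space N. S w \<le> y} \<in> sets N"
  proof (cases y)
    case (real r)
    show ?thesis
    proof (cases "0 \<le> r")
      case True
      then show ?thesis using stopsD[OF S, of r r] N real by auto
    next
      case False
      then have "ereal r < 0" by simp
      then have "\<not> S w \<le> y" if "w \<in> space M" for w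
        using order_trans[OF stops_nonneg[OF S that]] real by (metis leD)
      then have "{w \<in> space N. S w \<le> y} = {}" using N(1) by auto
      then show ?thesis by (simp only: sets.empty_sets)
    qed
  next
    case PInf
    then show ?thesis by simp
  next
    case MInf
    then have "{w \<in> space N. S w \<le> y} = {}" using stops_nonneg[OF S] N(1) by force
    then show ?thesis by (simp only: sets.empty_sets)
  qed
qed

lemma stops_random_variable: "stops S \<Longrightarrow> S \<in> borel_measurable M"
  by (rule stops_measurable) (auto simp: past_le[THEN subsetD])

lemma stops_at_zero: "stops_at (\<lambda>_. 0) 0"
  unfolding stops_at_def stops_def
proof (intro conjI ballI allI impI)
  fix t :: real assume "0 \<le> t"
  then have "{w \<in> space M. (0::ereal) \<le> ereal t} = space (past t)" by (simp add: past_simps)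
  then show "{w \<in> space M. (0::ereal) \<le> ereal t} \<in> sets (past t)" by simp
qed (auto simp: zero_ereal_def)

text \<open>Expresses the hit through countably many past events. As \<open>y \<noteq> z\<close>,
  the hit comes strictly after \<open>S\<close>, which leaves rational times just before it at which
  \<open>Z\<close> is already close to \<open>y\<close>.\<close>

lemma hit_time_le_iff_rational:
  assumes w: "w \<in> space M" and S: "stops_at S z" and y: "y \<noteq> z"
  shows "hit_time (path w) (S w) y \<le> ereal t \<longleftrightarrow>
    (\<forall>n. \<exists>r\<in>\<rat> \<inter> {0..t}. S w \<le> ereal r \<and> \<bar>Z r w - y\<bar> < 1 / real (Suc n))"
proof
  have S0: "0 \<le> S w" using S w by (simp add: stops_at_def stops_nonneg)
  {
    assume "hit_time (path w) (S w) y \<le> ereal t"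
    then obtain u where u: "0 \<le> u" "S w \<le> ereal u" "u \<le> t" "Z u w = y"
      unfolding hit_time_le_iff[OF Z_continuous[OF w]] by blast
    then obtain s where s: "S w = ereal s" using S0 by (cases "S w") auto
    have "Z s w = z" using S w s by (simp add: stops_at_def)
    then have su: "s < u" using u s y by (cases "s = u") auto
    have s0: "0 \<le> s" using S0 s by simp
    show "\<forall>n. \<exists>r\<in>\<rat> \<inter> {0..t}. S w \<le> ereal r \<and> \<bar>Z r w - y\<bar> < 1 / real (Suc n)"
    proof
      fix n
      obtain d where d: "0 < d" "\<And>v. v \<in> {0..} \<Longrightarrow> dist v u < d \<Longrightarrow> dist (Z v w) (Z u w) < 1 / real (Suc n)"
        using Z_continuous[OF w] u(1) unfolding continuous_on_iff by (metis atLeast_iff zero_less_divide_1_iff of_nat_0_less_iff zero_less_Suc)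
      obtain r where r: "r \<in> \<rat>" "max s (u - d) < r" "r < u"
        using Rats_dense_in_real[of "max s (u - d)" u] su d(1) by auto
      then have "r \<in> \<rat> \<inter> {0..t}" "S w \<le> ereal r" "\<bar>Z r w - y\<bar> < 1 / real (Suc n)"
        using d(2)[of r] u s0 s by (auto simp: dist_real_def)
      then show "\<exists>r\<in>\<rat> \<inter> {0..t}. S w \<le> ereal r \<and> \<bar>Z r w - y\<bar> < 1 / real (Suc n)" by blast
    qed
  }
  {
    assume R: "\<forall>n. \<exists>r\<in>\<rat> \<inter> {0..t}. S w \<le> ereal r \<and> \<bar>Z r w - y\<bar> < 1 / real (Suc n)"
    then obtain r0 where "r0 \<in> {0..t}" "S w \<le> ereal r0" by blast
    then obtain s where s: "S w = ereal s" "0 \<le> s" "s \<le> t" using S0 by (cases "S w") auto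
    have "continuous_on {s..t} (\<lambda>u. \<bar>Z u w - y\<bar>)"
      using Z_continuous[OF w] s(2) by (intro continuous_intros) (auto intro: continuous_on_subset)
    \<comment> \<open>The distance to \<open>y\<close> attains its minimum on the compact interval,
      and the rational times force this minimum to be 0.\<close>
    then obtain u where u: "u \<in> {s..t}" "\<And>v. v \<in> {s..t} \<Longrightarrow> \<bar>Z u w - y\<bar> \<le> \<bar>Z v w - y\<bar>"
      using continuous_attains_inf[of "{s..t}" "\<lambda>u. \<bar>Z u w - y\<bar>"] s by auto
    have "\<bar>Z u w - y\<bar> \<le> 1 / real (Suc n)" for n
    proof -
      obtain r where "r \<in> {0..t}" "S w \<le> ereal r" "\<bar>Z r w - y\<bar> < 1 / real (Suc n)" using R by blast
      then show ?thesis using u(2)[of r] s by auto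
    qed
    then have "\<bar>Z u w - y\<bar> \<le> 0"
      by (intro LIMSEQ_le_const[OF lim_const_over_n[THEN LIMSEQ_Suc, of 1]]) (auto simp del: of_nat_Suc)
    then show "hit_time (path w) (S w) y \<le> ereal t"
      unfolding hit_time_le_iff[OF Z_continuous[OF w]] using u s by (intro exI[of _ u]) auto
  }
qed

lemma stops_hit_time:
  assumes S: "stops_at S z" and y: "y \<noteq> z"
  shows "stops (\<lambda>w. hit_time (path w) (S w) y)"
  unfolding stops_def
proof (intro conjI ballI allI impI)
  fix t :: real assume t: "0 \<le> t"
  have "{w \<in> space M. \<exists>r\<in>\<rat> \<inter> {0..t}. S w \<le> ereal r \<and> \<bar>Z r w - y\<bar> < 1 / real (Suc n)} \<in> sets (past t)" for n
  proof -
    have "{w \<in> space M. \<exists>r\<in>\<rat> \<inter> {0..t}. S w \<le> ereal r \<and> \<bar>Z r w - y\<bar> < 1 / real (Suc n)}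
      = (\<Union>r\<in>\<rat> \<inter> {0..t}. {w \<in> space M. S w \<le> ereal r} \<inter> {w \<in> space (past t). \<bar>Z r w - y\<bar> < 1 / real (Suc n)})"
      by (auto simp: past_simps)
    also have "\<dots> \<in> sets (past t)"
    proof (rule sets.countable_UN'')
      show "countable (\<rat> \<inter> {0..t})" using countable_rat by (rule countable_subset[rotated]) auto
      fix r assume r: "r \<in> \<rat> \<inter> {0..t}"
      have [measurable]: "Z r \<in> borel_measurable (past t)" using r by (intro Z_past) auto
      have "{w \<in> space (past t). \<bar>Z r w - y\<bar> < 1 / real (Suc n)} \<in> sets (past t)" by measurable
      moreover have "{w \<in> space M. S w \<le> ereal r} \<in> sets (past t)"
        using S r by (intro stopsD) (auto simp: stops_at_def)
      ultimately show "{w \<in> space M. S w \<le> ereal r} \<inter> {w \<in> space (past t). \<bar>Z r w - y\<bar> < 1 / real (Suc n)} \<in> sets (past t)"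
        by (rule sets.Int[rotated])
    qed
    finally show ?thesis .
  qed
  then have "(\<Inter>n. {w \<in> space M. \<exists>r\<in>\<rat> \<inter> {0..t}. S w \<le> ereal r \<and> \<bar>Z r w - y\<bar> < 1 / real (Suc n)}) \<in> sets (past t)"
    by (intro sets.countable_INT') auto
  also have "(\<Inter>n. {w \<in> space M. \<exists>r\<in>\<rat> \<inter> {0..t}. S w \<le> ereal r \<and> \<bar>Z r w - y\<bar> < 1 / real (Suc n)})
      = {w \<in> space M. hit_time (path w) (S w) y \<le> ereal t}"
    using hit_time_le_iff_rational[OF _ S y] by auto
  finally show "{w \<in> space M. hit_time (path w) (S w) y \<le> ereal t} \<in> sets (past t)" .
qed (simp add: hit_time_ge)

text \<open>If both hits occur by \<open>t\<close>, a rational time separates them; if the competing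
  level is not hit by \<open>t\<close>, then \<open>t\<close> itself is the witness, hence the
  \<open>insert t\<close>.\<close>

lemma hit_first_le_iff:
  "hit_first x S y y' \<le> ereal t \<longleftrightarrow>
    (\<exists>r\<in>insert t (\<rat> \<inter> {0..t}). hit_time x S y \<le> ereal r \<and> \<not> hit_time x S y' \<le> ereal r)"
proof
  assume le: "hit_first x S y y' \<le> ereal t"
  then have h: "hit_time x S y < hit_time x S y'" "hit_time x S y \<le> ereal t"
    by (auto simp: hit_first_def split: if_splits)
  then obtain u where u: "hit_time x S y = ereal u" "0 \<le> u"
    using hit_time_ge(2)[of x S y] by (cases "hit_time x S y") auto
  show "\<exists>r\<in>insert t (\<rat> \<inter> {0..t}). hit_time x S y \<le> ereal r \<and> \<not> hit_time x S y' \<le> ereal r"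
  proof (cases "hit_time x S y' \<le> ereal t")
    case False
    then show ?thesis using h by auto
  next
    case True
    then obtain v where v: "hit_time x S y' = ereal v" "v \<le> t"
      using hit_time_ge(2)[of x S y'] by (cases "hit_time x S y'") auto
    obtain r where "r \<in> \<rat>" "u < r" "r < v" using Rats_dense_in_real[of u v] h u v by auto
    then show ?thesis using u v by (intro bexI[of _ r]) auto
  qed
next
  assume "\<exists>r\<in>insert t (\<rat> \<inter> {0..t}). hit_time x S y \<le> ereal r \<and> \<not> hit_time x S y' \<le> ereal r"
  then obtain r where r: "r \<le> t" "hit_time x S y \<le> ereal r" "\<not> hit_time x S y' \<le> ereal r" by auto
  then have "hit_time x S y < hit_time x S y'" by auto
  moreover have "hit_time x S y \<le> ereal t" using r(1,2) by (meson ereal_less_eq(3) order_trans)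
  ultimately show "hit_first x S y y' \<le> ereal t" by (simp add: hit_first_def)
qed

lemma stops_at_hit_first:
  assumes S: "stops_at S z" and y: "y \<noteq> z" "y' \<noteq> z"
  shows "stops_at (\<lambda>w. hit_first (path w) (S w) y y') y"
  unfolding stops_at_def stops_def
proof (intro conjI ballI allI impI)
  fix t :: real assume t: "0 \<le> t"
  have "{w \<in> space M. hit_first (path w) (S w) y y' \<le> ereal t} =
    (\<Union>r\<in>insert t (\<rat> \<inter> {0..t}). {w \<in> space M. hit_time (path w) (S w) y \<le> ereal r}
      - {w \<in> space M. hit_time (path w) (S w) y' \<le> ereal r})"
    unfolding hit_first_le_iff by auto
  also have "\<dots> \<in> sets (past t)"
  proof (rule sets.countable_UN'')
    have "countable (\<rat> \<inter> {0..t})" using countable_rat by (rule countable_subset[rotated]) auto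
    then show "countable (insert t (\<rat> \<inter> {0..t}))" by simp
    fix r assume "r \<in> insert t (\<rat> \<inter> {0..t})"
    then show "{w \<in> space M. hit_time (path w) (S w) y \<le> ereal r}
      - {w \<in> space M. hit_time (path w) (S w) y' \<le> ereal r} \<in> sets (past t)"
      using t by (intro sets.Diff stopsD stops_hit_time[OF S] y) auto
  qed
  finally show "{w \<in> space M. hit_first (path w) (S w) y y' \<le> ereal t} \<in> sets (past t)" .
next
  fix w s assume w: "w \<in> space M" and s: "hit_first (path w) (S w) y y' = ereal s"
  then have "hit_first (path w) (S w) y y' < \<infinity>" by simp
  then obtain u where "hit_first (path w) (S w) y y' = ereal u" "Z u w = y"
    by (rule hit_first_attained[OF Z_continuous[OF w]])
  then show "Z s w = y" using s by simp
qed (rule hit_first_ge)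

lemma expectation_W_stopped:
  assumes S: "stops S" and m: "0 < m"
  shows "integrable M (\<lambda>w. W c (real_of_ereal (min (S w) (ereal m))) w)"
    and "expectation (\<lambda>w. W c (real_of_ereal (min (S w) (ereal m))) w) = 1"
proof -
  define R where "R w = real_of_ereal (min (S w) (ereal m))" for w
  have R: "ereal (R w) = min (S w) (ereal m)" if "w \<in> space M" for w
    using stops_nonneg[OF S that] m by (cases "S w") (auto simp: R_def min_def)
  have b: "0 \<le> R w \<and> R w \<le> m" if w: "w \<in> space M" for w
  proof -
    have "0 \<le> ereal (R w)" "ereal (R w) \<le> ereal m"
      unfolding R[OF w] using stops_nonneg[OF S w] m by auto
    then show ?thesis by simp
  qed
  have st: "{w \<in> space M. R w \<le> t} \<in> sets (past t)" if t: "0 \<le> t" "t < m" for t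
  proof -
    have "R w \<le> t \<longleftrightarrow> S w \<le> ereal t" if w: "w \<in> space M" for w
    proof -
      have "R w \<le> t \<longleftrightarrow> ereal (R w) \<le> ereal t" by simp
      also have "\<dots> \<longleftrightarrow> S w \<le> ereal t" unfolding R[OF w] using t by (simp add: min_le_iff_disj)
      finally show ?thesis .
    qed
    then have "{w \<in> space M. R w \<le> t} = {w \<in> space M. S w \<le> ereal t}" by auto
    then show ?thesis using stopsD[OF S, of t t] t by simp
  qed
  note os = optional_stopping[OF m b st, of c]
  show "integrable M (\<lambda>w. W c (real_of_ereal (min (S w) (ereal m))) w)"
    using os unfolding R_def[symmetric]
    by (intro integrableI_nn_integral_finite[where x = 1]) (auto simp: less_imp_le[OF W_pos])
  show "expectation (\<lambda>w. W c (real_of_ereal (min (S w) (ereal m))) w) = 1"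
    using os unfolding R_def[symmetric]
    by (subst integral_eq_nn_integral) (auto simp: less_imp_le[OF W_pos])
qed

lemma discount_integrable: "0 < q \<Longrightarrow> stops S \<Longrightarrow> integrable M (\<lambda>w. discount q (S w))"
  using stops_random_variable[of S] stops_nonneg[of S] discount_bounds[of q]
  by (intro integrable_const_bound[of _ 1]) (auto intro: AE_I2)

text \<open>Stop \<open>W\<close> at \<open>S\<close> and at the exit time \<open>?H\<close> from
  the strip of half-width \<epsilon>, both capped at \<open>m\<close>: both expectations are 1.
  Since \<open>\<kappa> c = q\<close>, the difference of the stopped values is \<open>V\<close> up
  to an error of order \<open>exp (- q * m)\<close>, so \<open>V\<close> has expectation 0 as
  \<open>m\<close> grows.\<close>

lemma discount_step:
  assumes S: "stops_at S z" and \<epsilon>: "0 < \<epsilon>" and q: "0 < q" and c: "\<kappa> c = q"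
  defines "U \<equiv> \<lambda>w. hit_first (path w) (S w) (z + \<epsilon>) (z - \<epsilon>)"
    and "D \<equiv> \<lambda>w. hit_first (path w) (S w) (z - \<epsilon>) (z + \<epsilon>)"
  shows "exp (c * z) * expectation (\<lambda>w. discount q (S w))
    = exp (c * (z + \<epsilon>)) * expectation (\<lambda>w. discount q (U w))
      + exp (c * (z - \<epsilon>)) * expectation (\<lambda>w. discount q (D w))"
proof -
  have U: "stops_at U (z + \<epsilon>)" and D: "stops_at D (z - \<epsilon>)"
    unfolding U_def D_def using \<epsilon> by (intro stops_at_hit_first[OF S]; simp)+
  let ?H = "\<lambda>w. min (hit_time (path w) (S w) (z + \<epsilon>)) (hit_time (path w) (S w) (z - \<epsilon>))"
  \<comment> \<open>Bounds \<open>exp (c * v)\<close> for all heights \<open>v\<close> in the closed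
    strip around \<open>z\<close>.\<close>
  define K where "K = exp (\<bar>c\<bar> * (\<bar>z\<bar> + \<epsilon>))"
  have K: "exp (c * v) \<le> K" if "\<bar>v\<bar> \<le> \<bar>z\<bar> + \<epsilon>" for v
  proof -
    have "c * v \<le> \<bar>c\<bar> * \<bar>v\<bar>" using abs_ge_self[of "c * v"] by (simp add: abs_mult)
    also have "\<dots> \<le> \<bar>c\<bar> * (\<bar>z\<bar> + \<epsilon>)" using that by (intro mult_left_mono) auto
    finally show ?thesis by (simp add: K_def)
  qed
  have hits: "stops (\<lambda>w. hit_time (path w) (S w) (z + \<epsilon>))" "stops (\<lambda>w. hit_time (path w) (S w) (z - \<epsilon>))"
    using \<epsilon> by (intro stops_hit_time[OF S]; simp)+
  have H: "stops ?H"
    unfolding stops_def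
  proof (intro conjI ballI allI impI)
    show "0 \<le> ?H w" for w by (simp add: hit_time_ge)
    fix t :: real assume t: "0 \<le> t"
    have "{w \<in> space M. ?H w \<le> ereal t} = {w \<in> space M. hit_time (path w) (S w) (z + \<epsilon>) \<le> ereal t}
        \<union> {w \<in> space M. hit_time (path w) (S w) (z - \<epsilon>) \<le> ereal t}"
      by (auto simp: min_le_iff_disj)
    also have "\<dots> \<in> sets (past t)" using t by (intro sets.Un stopsD hits) auto
    finally show "{w \<in> space M. ?H w \<le> ereal t} \<in> sets (past t)" .
  qed
  define V where "V w = exp (c * z) * discount q (S w) - exp (c * (z + \<epsilon>)) * discount q (U w)
      - exp (c * (z - \<epsilon>)) * discount q (D w)" for w
  have int: "integrable M (\<lambda>w. discount q (S w))" "integrable M (\<lambda>w. discount q (U w))"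
    "integrable M (\<lambda>w. discount q (D w))"
    using S U D unfolding stops_at_def by (blast intro: discount_integrable q)+
  then have iV: "integrable M V" unfolding V_def by (intro Bochner_Integration.integrable_diff integrable_mult_right)
  have Wat: "W c t w = exp (c * Z t w) * exp (- q * t)" for t w
    unfolding W_def c exp_add[symmetric] by simp
  have pt: "\<bar>W c (real_of_ereal (min (S w) (ereal m))) w - W c (real_of_ereal (min (?H w) (ereal m))) w - V w\<bar>
      \<le> 3 * (K * exp (- q * m))" if w: "w \<in> space M" and m: "0 < m" for m w
  proof -
    have Kb: "exp (c * z) \<le> K" "exp (c * (z + \<epsilon>)) \<le> K" "exp (c * (z - \<epsilon>)) \<le> K"
      using \<epsilon> by (intro K; linarith)+
    have K0: "0 \<le> K" by (simp add: K_def)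
    have tm: "\<bar>exp (c * v) * discount q T\<bar> \<le> K * exp (- q * m)" if "exp (c * v) \<le> K" "ereal m \<le> T" for v T
    proof -
      have "0 \<le> T" using m that(2) by (meson ereal_less_eq(5) less_imp_le order_trans)
      then show ?thesis unfolding abs_mult
        using discount_bounds[OF q] discount_mono[OF q that(2)] that K0 by (intro mult_mono) auto
    qed
    have geS: "S w \<le> U w" "S w \<le> D w" by (simp_all add: U_def D_def hit_first_ge)
    have geH: "S w \<le> ?H w" by (simp add: hit_time_ge)
    have UD: "?H w \<le> U w" "?H w \<le> D w" by (auto simp: U_def D_def hit_first_def)
    have S0: "0 \<le> S w" using S w by (simp add: stops_at_def stops_nonneg)
    \<comment> \<open>Before \<open>S\<close> both capped values are \<open>W\<close> at
      \<open>m\<close> and cancel, so no bound on the path before \<open>S\<close> is needed.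
      Between \<open>S\<close> and the exit the path is in the strip and \<open>W\<close> at
      \<open>m\<close> is of order \<open>exp (- q * m)\<close>. After the exit the difference is
      exactly \<open>V\<close>.\<close>
    consider (a) "ereal m < S w" | (b) "S w \<le> ereal m" "ereal m < ?H w" | (c) "?H w \<le> ereal m"
      using not_le by blast
    then show ?thesis
    proof cases
      case a
      then have "ereal m < ?H w" using geH by (rule less_le_trans)
      then have "min (?H w) (ereal m) = ereal m" by (intro min_absorb2 less_imp_le)
      moreover have "min (S w) (ereal m) = ereal m" using a by (intro min_absorb2 less_imp_le)
      moreover have "ereal m \<le> S w" using a by (rule less_imp_le)
      note tm[OF Kb(1) this] tm[OF Kb(2) order_trans[OF this geS(1)]] tm[OF Kb(3) order_trans[OF this geS(2)]]
      ultimately show ?thesis unfolding V_def by simp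
    next
      case b
      obtain s where s: "S w = ereal s" "0 \<le> s" "s \<le> m" using b(1) S0 by (cases "S w") auto
      have zs: "Z s w = z" using S w s by (simp add: stops_at_def)
      have "z - \<epsilon> < Z m w" "Z m w < z + \<epsilon>"
        using between_hits[OF Z_continuous[OF w] s(2) zs, of "z - \<epsilon>" "z + \<epsilon>" m] \<epsilon> b s by auto
      then have "exp (c * Z m w) \<le> K" by (intro K) linarith
      then have Wm: "\<bar>W c m w\<bar> \<le> K * exp (- q * m)" unfolding Wat by (simp add: abs_mult)
      have "min (S w) (ereal m) = ereal s" using s by simp
      moreover have "min (?H w) (ereal m) = ereal m" using b(2) by (intro min_absorb2 less_imp_le)
      moreover have "W c s w = exp (c * z) * discount q (S w)" by (simp add: Wat zs s)
      moreover have "ereal m \<le> ?H w" using b(2) by (rule less_imp_le)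
      note Wm tm[OF Kb(2) order_trans[OF this UD(1)]] tm[OF Kb(3) order_trans[OF this UD(2)]]
      ultimately show ?thesis unfolding V_def by simp
    next
      case c
      obtain s where s: "S w = ereal s" "0 \<le> s" using order_trans[OF geH c] S0 by (cases "S w") auto
      have zs: "Z s w = z" using S w s by (simp add: stops_at_def)
      obtain h where h: "?H w = ereal h" "h \<le> m" using c stops_nonneg[OF H w] by (cases "?H w") auto
      have sh: "s \<le> h" using geH unfolding h(1) unfolding s(1) by simp
      have mins: "min (S w) (ereal m) = ereal s" "min (?H w) (ereal m) = ereal h"
        unfolding h(1) unfolding s(1) using h(2) sh by simp_all
      have Ws: "W c s w = exp (c * z) * discount q (S w)" by (simp add: Wat zs s)
      have ne: "hit_time (path w) (S w) (z + \<epsilon>) \<noteq> hit_time (path w) (S w) (z - \<epsilon>)"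
        using hit_time_neq[OF Z_continuous[OF w], of "z + \<epsilon>" "z - \<epsilon>" "S w"] \<epsilon> h by fastforce
      have "W c h w = exp (c * (z + \<epsilon>)) * discount q (U w) + exp (c * (z - \<epsilon>)) * discount q (D w)"
      proof (cases "hit_time (path w) (S w) (z + \<epsilon>) < hit_time (path w) (S w) (z - \<epsilon>)")
        case True
        then have "U w = ereal h" "D w = \<infinity>" using h by (auto simp: U_def D_def hit_first_def)
        moreover have "Z h w = z + \<epsilon>" using U w \<open>U w = ereal h\<close> by (simp add: stops_at_def)
        ultimately show ?thesis by (simp add: Wat)
      next
        case False
        then have "U w = \<infinity>" "D w = ereal h" using h ne by (auto simp: U_def D_def hit_first_def min_def)
        moreover have "Z h w = z - \<epsilon>" using D w \<open>D w = ereal h\<close> by (simp add: stops_at_def)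
        ultimately show ?thesis by (simp add: Wat)
      qed
      then show ?thesis unfolding mins V_def using Ws K0 by simp
    qed
  qed
  have bound: "\<bar>expectation V\<bar> \<le> 3 * (K * exp (- q * m))" if m: "0 < m" for m
  proof -
    let ?f = "\<lambda>w. W c (real_of_ereal (min (S w) (ereal m))) w" and ?g = "\<lambda>w. W c (real_of_ereal (min (?H w) (ereal m))) w"
    have sS: "stops S" using S by (simp add: stops_at_def)
    note f = expectation_W_stopped[OF sS m, of c] and g = expectation_W_stopped[OF H m, of c]
    have "expectation (\<lambda>w. ?f w - ?g w - V w) = - expectation V"
      using f g iV by simp
    then have "\<bar>expectation V\<bar> = norm (expectation (\<lambda>w. ?f w - ?g w - V w))" by simp
    also have "\<dots> \<le> expectation (\<lambda>w. norm (?f w - ?g w - V w))" by (rule integral_norm_bound)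
    also have "\<dots> \<le> expectation (\<lambda>w. 3 * (K * exp (- q * m)))"
      using f g iV pt[OF _ m] by (intro integral_mono) auto
    finally show ?thesis by (simp add: prob_space)
  qed
  have "(\<lambda>n. 3 * (K * exp (- q * real (Suc n)))) \<longlonglongrightarrow> 0"
  proof -
    have "(\<lambda>n. 3 * (K * exp (- q) ^ Suc n)) \<longlonglongrightarrow> 0"
      by (rule tendsto_mult_right_zero, rule tendsto_mult_right_zero, rule LIMSEQ_Suc, rule LIMSEQ_realpow_zero) (use q in auto)
    moreover have "exp (- q) ^ Suc n = exp (- q * real (Suc n))" for n
      unfolding exp_of_nat_mult[symmetric] by (simp add: mult.commute)
    ultimately show ?thesis by (simp only:)
  qed
  then have "\<bar>expectation V\<bar> \<le> 0"
    by (rule LIMSEQ_le_const) (use bound in \<open>auto simp del: of_nat_Suc\<close>)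
  then have "expectation V = 0" by simp
  then show ?thesis unfolding V_def using int by simp
qed

end

subsection \<open>Independent exponential killing\<close>

lemma walk_event_Suc:
  "walk_event x \<epsilon> N K e n S z i j \<Longrightarrow> walk_event x \<epsilon> N K e (Suc n) S z i j"
proof (induction n arbitrary: S z i j)
  case (Suc n)
  show ?case
  proof (cases "N \<le> i")
    case True
    then show ?thesis using Suc.prems by simp
  next
    case False
    have "j < K \<and> (walk_event x \<epsilon> N K e n (hit_first x S (z + \<epsilon>) (z - \<epsilon>)) (z + \<epsilon>) (i - 1) (j + 1) \<or>
       walk_event x \<epsilon> N K e n (hit_first x S (z - \<epsilon>) (z + \<epsilon>)) (z - \<epsilon>) (i + 1) (j - 1))"
      using Suc.prems unfolding walk_event.simps(2) if_not_P[OF False] .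
    then show ?thesis
      unfolding walk_event.simps(2)[where n = "Suc n"] if_not_P[OF False] using Suc.IH by blast
  qed
qed simp

text \<open>
  Allowing \<open>\<sigma> < 0\<close> makes the setting closed under reflection: \<open>- X\<close> has coefficients
  \<open>- \<mu>\<close> and \<open>- \<sigma>\<close> for the same \<open>B\<close>.
\<close>

locale killed_brownian_motion = drifted_brownian_motion M B X \<mu> \<sigma>
  for M :: "'a measure" and B X \<mu> \<sigma> +
  fixes N :: "'a measure" and e :: "'a \<Rightarrow> real" and q :: real
  assumes sigma: "\<sigma> \<noteq> 0" and q: "0 < q"
    and e_dist: "distributed M lborel e (exponential_density q)"
    and space_N: "space N = space M"
    and X_N: "\<And>t. 0 \<le> t \<Longrightarrow> X t \<in> borel_measurable N"
    and indep: "indep_set (sets N) (sets (vimage_algebra (space M) e borel))"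
begin

section \<open>Step probabilities of the embedded walk\<close>

definition \<delta> :: real where "\<delta> = \<mu> / \<sigma>\<^sup>2"
definition \<gamma> :: real where "\<gamma> = sqrt (\<delta>\<^sup>2 + 2 * q / \<sigma>\<^sup>2)"

lemma gamma_square: "\<gamma>\<^sup>2 = \<delta>\<^sup>2 + 2 * q / \<sigma>\<^sup>2"
  using q by (simp add: \<gamma>_def)

lemma delta_less_gamma: "\<bar>\<delta>\<bar> < \<gamma>"
  unfolding \<gamma>_def using q sigma by (intro real_less_rsqrt) simp

lemma gamma_pos: "0 < \<gamma>" using delta_less_gamma by simp

text \<open>Completing the square in the Laplace exponent shows its two roots at level
  \<open>q\<close> to be \<open>- \<delta> + \<gamma>\<close> and
  \<open>- \<delta> - \<gamma>\<close>.\<close>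

lemma kappa_root: "(c + \<delta>)\<^sup>2 = \<gamma>\<^sup>2 \<Longrightarrow> \<kappa> c = q"
proof -
  assume c: "(c + \<delta>)\<^sup>2 = \<gamma>\<^sup>2"
  have "\<delta> * \<sigma>\<^sup>2 = \<mu>" using sigma by (simp add: \<delta>_def)
  moreover have "\<sigma>\<^sup>2 / 2 * ((c + \<delta>)\<^sup>2 - \<delta>\<^sup>2) = c * (\<delta> * \<sigma>\<^sup>2) + c\<^sup>2 * \<sigma>\<^sup>2 / 2"
    by (simp add: power2_eq_square algebra_simps)
  ultimately have "\<kappa> c = \<sigma>\<^sup>2 / 2 * ((c + \<delta>)\<^sup>2 - \<delta>\<^sup>2)"
    unfolding \<kappa>_def by (simp only:)
  also have "\<dots> = q" unfolding c gamma_square using sigma by simp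
  finally show ?thesis .
qed

lemma e_measurable [measurable]: "e \<in> borel_measurable M"
  using distributed_measurable[OF e_dist] by simp

lemma prob_exit:
  assumes S: "stops_at S z" and \<epsilon>: "0 < \<epsilon>"
  shows "expectation (\<lambda>w. discount q (hit_first (path w) (S w) (z + \<epsilon>) (z - \<epsilon>)))
      = 1 / (2 * cosh (\<gamma> * \<epsilon>) * exp (- (\<delta> * \<epsilon>))) * expectation (\<lambda>w. discount q (S w))" (is "?u = _ * ?s")
    and "expectation (\<lambda>w. discount q (hit_first (path w) (S w) (z - \<epsilon>) (z + \<epsilon>)))
      = exp (- (\<delta> * \<epsilon>)) / (2 * cosh (\<gamma> * \<epsilon>)) * expectation (\<lambda>w. discount q (S w))" (is "?d = _")
proof -
  \<comment> \<open>This tilt makes the two equations symmetric: \<open>?s = g * u + d / g\<close>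
    and \<open>?s = u / g + g * d\<close>. As \<open>g > 1\<close>, they force \<open>u = d\<close>,
    and \<open>g + 1 / g\<close> is \<open>2 * cosh (\<gamma> * \<epsilon>)\<close>.\<close>
  define u where "u = exp (- (\<delta> * \<epsilon>)) * ?u"
  define d where "d = exp (\<delta> * \<epsilon>) * ?d"
  define g where "g = exp (\<gamma> * \<epsilon>)"
  have g: "1 < g" using gamma_pos \<epsilon> by (simp add: g_def)
  have eq: "?s = exp (c * \<epsilon>) * ?u + exp (- (c * \<epsilon>)) * ?d" if c: "\<kappa> c = q" for c
  proof -
    have "exp (c * z) * ?s = exp (c * z) * (exp (c * \<epsilon>) * ?u + exp (- (c * \<epsilon>)) * ?d)"
      using discount_step[OF S \<epsilon> q c]
      by (simp only: distrib_left right_diff_distrib diff_conv_add_uminus exp_add mult_minus_right mult.assoc)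
    then show ?thesis by simp
  qed
  have s1: "?s = g * u + d / g"
    using eq[OF kappa_root, of "- \<delta> + \<gamma>"]
    by (simp add: u_def d_def g_def exp_add exp_minus distrib_right left_diff_distrib exp_diff field_simps)
  have s2: "?s = u / g + g * d"
    using eq[OF kappa_root, of "- \<delta> - \<gamma>"]
    by (simp add: u_def d_def g_def exp_add exp_minus distrib_right left_diff_distrib exp_diff field_simps)
  have "(g * u - g * d) - (u / g - d / g) = 0" using s1 s2 by linarith
  moreover have "(g - 1 / g) * (u - d) = (g * u - g * d) - (u / g - d / g)"
    by (simp add: left_diff_distrib right_diff_distrib)
  ultimately have "(g - 1 / g) * (u - d) = 0" by (simp only:)
  moreover have "g - 1 / g \<noteq> 0"
  proof -
    have "1 / g < 1" using g by simp
    then show ?thesis using g by linarith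
  qed
  ultimately have "u = d" by simp
  have c: "2 * cosh (\<gamma> * \<epsilon>) = g + 1 / g"
    by (simp add: cosh_field_def g_def exp_minus inverse_eq_divide)
  have "?s = g * u + u / g" using s1 unfolding \<open>u = d\<close> .
  also have "\<dots> = (g + 1 / g) * u" by (simp add: distrib_right)
  finally have cu: "?s = 2 * cosh (\<gamma> * \<epsilon>) * u" unfolding c .
  have C: "2 * cosh (\<gamma> * \<epsilon>) \<noteq> 0" using cosh_real_pos[of "\<gamma> * \<epsilon>"] by linarith
  have r1: "1 / (2 * cosh (\<gamma> * \<epsilon>) * y) * (2 * cosh (\<gamma> * \<epsilon>) * (y * v)) = v" if "y \<noteq> 0" for y v :: real
    using C that by simp
  show "?u = 1 / (2 * cosh (\<gamma> * \<epsilon>) * exp (- (\<delta> * \<epsilon>))) * ?s"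
    unfolding cu unfolding u_def by (rule r1[OF exp_not_eq_zero, symmetric])
  have r2: "exp (- (\<delta> * \<epsilon>)) / (2 * cosh (\<gamma> * \<epsilon>)) * (2 * cosh (\<gamma> * \<epsilon>) * (exp (\<delta> * \<epsilon>) * v)) = v" for v
  proof -
    have "exp (- (\<delta> * \<epsilon>)) * (exp (\<delta> * \<epsilon>) * v) = v" by (simp add: exp_minus)
    then show ?thesis using C by simp
  qed
  show "?d = exp (- (\<delta> * \<epsilon>)) / (2 * cosh (\<gamma> * \<epsilon>)) * ?s"
    unfolding cu \<open>u = d\<close> unfolding d_def by (rule r2[symmetric])
qed

lemma Z_N: "0 \<le> t \<Longrightarrow> Z t \<in> borel_measurable N"
  using X_N[of t] X_N[of 0] unfolding Z_def[abs_def] by simp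

text \<open>A stopping time of the path is measurable for \<open>N\<close>, hence independent of
  \<open>e\<close>; Fubini then integrates the exponential tail over the law of
  \<open>S\<close>.\<close>

lemma prob_stop_less:
  assumes S: "stops S"
  shows "{w \<in> space M. S w < ereal (e w)} \<in> events"
    and "prob {w \<in> space M. S w < ereal (e w)} = expectation (\<lambda>w. discount q (S w))"
proof -
  have [measurable]: "S \<in> borel_measurable M" using stops_random_variable[OF S] .
  show ev: "{w \<in> space M. S w < ereal (e w)} \<in> events" by measurable
  have SN: "S \<in> borel_measurable N"
    by (rule stops_measurable[OF S space_N past_le_if_measurable[OF space_N Z_N]])
  have "sigma_sets (space M) {S -` A \<inter> space M | A. A \<in> sets borel} \<subseteq> sets N"
    unfolding space_N[symmetric] using measurable_sets[OF SN] by (intro sets.sigma_sets_subset) auto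
  moreover have "sigma_sets (space M) {(\<lambda>w. ereal (e w)) -` A \<inter> space M | A. A \<in> sets borel}
      \<subseteq> sigma_sets (space M) {e -` A \<inter> space M | A. A \<in> sets borel}"
  proof (rule sigma_sets_mono', safe)
    fix A :: "ereal set" assume "A \<in> sets borel"
    then have "ereal -` A \<inter> space borel \<in> sets borel" by (rule measurable_sets[rotated]) simp
    then show "\<exists>A'. (\<lambda>w. ereal (e w)) -` A \<inter> space M = e -` A' \<inter> space M \<and> A' \<in> sets borel"
      by (intro exI[of _ "ereal -` A"]) auto
  qed
  ultimately have "indep_set (sigma_sets (space M) {S -` A \<inter> space M | A. A \<in> sets borel})
      (sigma_sets (space M) {(\<lambda>w. ereal (e w)) -` A \<inter> space M | A. A \<in> sets borel})"
    using indep unfolding indep_set_def sets_vimage_algebra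
    by (elim indep_sets_mono_sets) (auto split: bool.split)
  then have "indep_var borel S borel (\<lambda>w. ereal (e w))" unfolding indep_var_eq by simp
  then have pair: "distr M borel S \<Otimes>\<^sub>M distr M borel (\<lambda>w. ereal (e w))
      = distr M (borel \<Otimes>\<^sub>M borel) (\<lambda>w. (S w, ereal (e w)))"
    unfolding indep_var_distribution_eq by simp
  interpret De: prob_space "distr M borel (\<lambda>w. ereal (e w))" by (rule prob_space_distr) simp
  let ?A = "{p \<in> space (borel \<Otimes>\<^sub>M borel). fst p < (snd p :: ereal)}"
  have A[measurable]: "?A \<in> sets (borel \<Otimes>\<^sub>M borel)" by measurable
  have pt: "emeasure (distr M borel (\<lambda>w. ereal (e w))) (Pair (S w) -` ?A) = ennreal (discount q (S w))" if w: "w \<in> space M" for w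
  proof -
    have "emeasure (distr M borel (\<lambda>w. ereal (e w))) (Pair (S w) -` ?A) = emeasure M {v \<in> space M. S w < ereal (e v)}"
    proof (subst emeasure_distr)
      show "Pair (S w) -` ?A \<in> sets borel" using A by (rule sets_Pair1)
      have "(\<lambda>w. ereal (e w)) -` (Pair (S w) -` ?A) \<inter> space M = {v \<in> space M. S w < ereal (e v)}"
        by (auto simp: space_pair_measure)
      then show "emeasure M ((\<lambda>w. ereal (e w)) -` (Pair (S w) -` ?A) \<inter> space M) = emeasure M {v \<in> space M. S w < ereal (e v)}" by simp
    qed simp
    also have "\<dots> = ennreal (discount q (S w))"
    proof (cases "S w")
      case (real s)
      then have "0 \<le> s" using stops_nonneg[OF S w] by simp
      then have "prob {v \<in> space M. s < e v} = exp (- q * s)"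
        using exponential_distributedD_gt[OF e_dist _ q, of s] by (simp add: mult.commute)
      then show ?thesis by (simp add: real emeasure_eq_measure)
    qed (use stops_nonneg[OF S w] in auto)
    finally show ?thesis .
  qed
  have "emeasure M {w \<in> space M. S w < ereal (e w)} = emeasure (distr M (borel \<Otimes>\<^sub>M borel) (\<lambda>w. (S w, ereal (e w)))) ?A"
    by (subst emeasure_distr[OF _ A]) (auto intro!: arg_cong[where f = "emeasure M"] simp: space_pair_measure)
  also have "\<dots> = (\<integral>\<^sup>+s. emeasure (distr M borel (\<lambda>w. ereal (e w))) (Pair s -` ?A) \<partial>distr M borel S)"
    unfolding pair[symmetric] by (rule De.emeasure_pair_measure_alt, subst sets_pair_measure_cong[OF sets_distr sets_distr], rule A)
  also have "\<dots> = (\<integral>\<^sup>+w. emeasure (distr M borel (\<lambda>w. ereal (e w))) (Pair (S w) -` ?A) \<partial>M)"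
  proof (rule nn_integral_distr)
    have "(\<lambda>s. emeasure (distr M borel (\<lambda>w. ereal (e w))) (Pair s -` ?A)) \<in> borel_measurable borel"
      using A by (intro De.measurable_emeasure_Pair) simp
    then show "(\<lambda>s. emeasure (distr M borel (\<lambda>w. ereal (e w))) (Pair s -` ?A)) \<in> borel_measurable (distr M borel S)" by simp
  qed simp
  also have "\<dots> = (\<integral>\<^sup>+w. ennreal (discount q (S w)) \<partial>M)"
    by (intro nn_integral_cong pt)
  also have "\<dots> = ennreal (expectation (\<lambda>w. discount q (S w)))"
    using discount_bounds[OF q] stops_nonneg[OF S]
    by (intro nn_integral_eq_integral discount_integrable q S AE_I2) auto
  finally show "prob {w \<in> space M. S w < ereal (e w)} = expectation (\<lambda>w. discount q (S w))"
    using discount_bounds[OF q] stops_nonneg[OF S]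
    by (simp add: measure_def integral_nonneg_AE)
qed

definition p_up :: "real \<Rightarrow> real" where "p_up \<epsilon> = 1 / (2 * cosh (\<gamma> * \<epsilon>) * exp (- (\<delta> * \<epsilon>)))"
definition p_down :: "real \<Rightarrow> real" where "p_down \<epsilon> = exp (- (\<delta> * \<epsilon>)) / (2 * cosh (\<gamma> * \<epsilon>))"

text \<open>The induction runs over all starting stopping times at once. By
  \<open>prob_exit\<close>, a step multiplies the discounted expectation by \<open>p_up\<close> or
  \<open>p_down\<close>, which matches the recursion of \<open>walk_prob\<close>.\<close>

lemma prob_walk_event:
  fixes n :: nat and k l :: nat
  assumes \<epsilon>: "0 < \<epsilon>"
  shows "stops_at S z \<Longrightarrow> {w \<in> space M. walk_event (path w) \<epsilon> k l (ereal (e w)) n (S w) z i j} \<in> events \<and>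
    prob {w \<in> space M. walk_event (path w) \<epsilon> k l (ereal (e w)) n (S w) z i j}
      = walk_prob (p_up \<epsilon>) (p_down \<epsilon>) k l n i j * expectation (\<lambda>w. discount q (S w))"
proof (induction n arbitrary: S z i j)
  case 0
  then have "stops S" by (simp add: stops_at_def)
  from prob_stop_less[OF this] show ?case by simp
next
  case (Suc n)
  have S: "stops S" using Suc.prems by (simp add: stops_at_def)
  show ?case
  proof (cases "k \<le> i \<or> l \<le> j")
    case True
    show ?thesis
    proof (cases "k \<le> i")
      case True
      then have "{w \<in> space M. walk_event (path w) \<epsilon> k l (ereal (e w)) (Suc n) (S w) z i j}
          = {w \<in> space M. S w < ereal (e w)}" by simp
      then show ?thesis using prob_stop_less[OF S] True by simp
    next
      case False
      then have "{w \<in> space M. walk_event (path w) \<epsilon> k l (ereal (e w)) (Suc n) (S w) z i j} = {}"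
        using True by simp
      then show ?thesis using False True by (simp only: walk_prob.simps) simp
    qed
  next
    case False
    define U where "U w = hit_first (path w) (S w) (z + \<epsilon>) (z - \<epsilon>)" for w
    define D where "D w = hit_first (path w) (S w) (z - \<epsilon>) (z + \<epsilon>)" for w
    have U: "stops_at U (z + \<epsilon>)" and D: "stops_at D (z - \<epsilon>)"
      unfolding U_def D_def using \<epsilon> by (intro stops_at_hit_first[OF Suc.prems]; simp)+
    let ?U = "{w \<in> space M. walk_event (path w) \<epsilon> k l (ereal (e w)) n (U w) (z + \<epsilon>) (i - 1) (j + 1)}"
    let ?D = "{w \<in> space M. walk_event (path w) \<epsilon> k l (ereal (e w)) n (D w) (z - \<epsilon>) (i + 1) (j - 1)}"
    note IU = Suc.IH[OF U, of "i - 1" "j + 1"] and ID = Suc.IH[OF D, of "i + 1" "j - 1"]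
    have eq: "{w \<in> space M. walk_event (path w) \<epsilon> k l (ereal (e w)) (Suc n) (S w) z i j} = ?U \<union> ?D"
      using False by (auto simp: U_def D_def)
    \<comment> \<open>Each event forces its own time below the clock, hence finite, but
      \<open>U w\<close> and \<open>D w\<close> are never both finite.\<close>
    have "?U \<inter> ?D = {}"
    proof -
      have False if "w \<in> ?U" "w \<in> ?D" for w
      proof -
        have "U w < ereal (e w)" "D w < ereal (e w)" using that walk_event_less by blast+
        then have "U w < \<infinity>" "D w < \<infinity>" by auto
        then show False unfolding U_def D_def hit_first_def by (auto split: if_splits)
      qed
      then show ?thesis by blast
    qed
    then have "prob (?U \<union> ?D) = prob ?U + prob ?D"
      using conjunct1[OF IU] conjunct1[OF ID] by (intro finite_measure_Union)
    also have "\<dots> = walk_prob (p_up \<epsilon>) (p_down \<epsilon>) k l (Suc n) i j * expectation (\<lambda>w. discount q (S w))"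
    proof -
      have "expectation (\<lambda>w. discount q (U w)) = p_up \<epsilon> * expectation (\<lambda>w. discount q (S w))"
        unfolding U_def p_up_def by (rule prob_exit(1)[OF Suc.prems \<epsilon>])
      moreover have "expectation (\<lambda>w. discount q (D w)) = p_down \<epsilon> * expectation (\<lambda>w. discount q (S w))"
        unfolding D_def p_down_def by (rule prob_exit(2)[OF Suc.prems \<epsilon>])
      moreover have "\<not> k \<le> i" "\<not> l \<le> j" using False by auto
      ultimately show ?thesis
        unfolding conjunct2[OF IU] conjunct2[OF ID] by (simp add: distrib_right)
    qed
    finally show ?thesis unfolding eq using conjunct1[OF IU] conjunct1[OF ID] by (intro conjI sets.Un)
  qed
qed

lemma prob_walk_event_start:
  assumes "0 < \<epsilon>"
  shows "{w \<in> space M. walk_event (path w) \<epsilon> k l (ereal (e w)) n 0 0 0 0} \<in> events"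
    and "prob {w \<in> space M. walk_event (path w) \<epsilon> k l (ereal (e w)) n 0 0 0 0}
      = walk_prob (p_up \<epsilon>) (p_down \<epsilon>) k l n 0 0"
  using prob_walk_event[OF assms stops_at_zero, of k l n 0 0]
  by (simp_all add: discount_def prob_space)

section \<open>Measurability of the event and the squeeze between two walks\<close>

abbreviation first_drawdown :: "real \<Rightarrow> real \<Rightarrow> 'a set" where
  "first_drawdown a b \<equiv>
    {w \<in> space M. drawdown_time a (path w) < min (drawup_time b (path w)) (ereal (e w))}"

text \<open>As \<open>c > 0\<close>, peak and trough occur at different times, so rational times can
  be chosen between them in the right order. Conversely, compactness turns drops arbitrarily close
  to \<open>c\<close> into one of size at least \<open>c\<close>.\<close>

lemma rational_drawdown:
  assumes x: "continuous_on {0..} x" and c: "0 < c"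
  shows "drawdown_time c x \<le> ereal t \<longleftrightarrow>
    (\<forall>n. \<exists>u\<in>\<rat> \<inter> {0..t}. \<exists>v\<in>\<rat> \<inter> {0..t}. u \<le> v \<and> c - 1 / real (Suc n) < x u - x v)"
  (is "_ \<longleftrightarrow> (\<forall>n. ?P n)")
proof
  assume "drawdown_time c x \<le> ereal t"
  then obtain u v where uv: "0 \<le> u" "u \<le> v" "v \<le> t" "c \<le> x u - x v"
    unfolding drawdown_time_le_iff[OF x] by blast
  then have less: "u < v" using c by (cases "u = v") auto
  show "\<forall>n. ?P n"
  proof
    fix n
    define r where "r = 1 / real (Suc n) / 2"
    have r: "0 < r" by (simp add: r_def)
    obtain d1 where d1: "0 < d1" "\<And>w. w \<in> {0..} \<Longrightarrow> dist w u < d1 \<Longrightarrow> dist (x w) (x u) < r"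
      using x uv(1) r unfolding continuous_on_iff by (meson atLeast_iff)
    obtain d2 where d2: "0 < d2" "\<And>w. w \<in> {0..} \<Longrightarrow> dist w v < d2 \<Longrightarrow> dist (x w) (x v) < r"
      using x uv(1,2) r unfolding continuous_on_iff by (meson atLeast_iff order_trans)
    obtain u' where u': "u' \<in> \<rat>" "u < u'" "u' < min v (u + d1)"
      using Rats_dense_in_real[of u "min v (u + d1)"] less d1 by auto
    obtain v' where v': "v' \<in> \<rat>" "max u' (v - d2) < v'" "v' < v"
      using Rats_dense_in_real[of "max u' (v - d2)" v] u' d2 by auto
    have "\<bar>x u' - x u\<bar> < r" "\<bar>x v' - x v\<bar> < r"
      using d1(2)[of u'] d2(2)[of v'] u' v' uv by (auto simp: dist_real_def)
    moreover have "2 * r = 1 / real (Suc n)" by (simp add: r_def del: of_nat_Suc)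
    ultimately have "c - 1 / real (Suc n) < x u' - x v'" using uv(4) by linarith
    then show "?P n" using u' v' uv by (intro bexI[of _ u'] bexI[of _ v'] conjI) auto
  qed
next
  assume R: "\<forall>n. ?P n"
  then have t: "0 \<le> t" by auto
  let ?S = "({0..t} \<times> {0..t}) \<inter> {p. fst p \<le> snd p}"
  have cpt: "compact ?S"
    by (intro compact_Int_closed compact_Times compact_Icc closed_Collect_le continuous_on_fst continuous_on_snd continuous_on_id)
  have c1: "continuous_on ?S (\<lambda>p. x (fst p))"
    by (rule continuous_on_compose2[OF x continuous_on_fst[OF continuous_on_id]]) auto
  have c2: "continuous_on ?S (\<lambda>p. x (snd p))"
    by (rule continuous_on_compose2[OF x continuous_on_snd[OF continuous_on_id]]) auto
  have "(0, 0) \<in> ?S" using t by simp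
  then obtain p where p: "p \<in> ?S" "\<And>p'. p' \<in> ?S \<Longrightarrow> x (fst p') - x (snd p') \<le> x (fst p) - x (snd p)"
    using continuous_attains_sup[OF cpt _ continuous_on_diff[OF c1 c2]] by blast
  have "c - 1 / real (Suc n) \<le> x (fst p) - x (snd p)" for n
  proof -
    obtain u v where uv: "u \<in> {0..t}" "v \<in> {0..t}" "u \<le> v" "c - 1 / real (Suc n) < x u - x v" using R by blast
    then show ?thesis using p(2)[of "(u, v)"] by auto
  qed
  moreover have "(\<lambda>n. c - 1 / real (Suc n)) \<longlonglongrightarrow> c - 0"
    by (intro tendsto_diff tendsto_const lim_const_over_n[THEN LIMSEQ_Suc])
  ultimately have "c \<le> x (fst p) - x (snd p)"
    by (intro LIMSEQ_le_const2[where X = "\<lambda>n. c - 1 / real (Suc n)"]) auto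
  then show "drawdown_time c x \<le> ereal t"
    unfolding drawdown_time_le_iff[OF x] using p(1) by (intro exI[of _ "fst p"] exI[of _ "snd p"]) auto
qed

lemma drawdown_time_measurable:
  assumes Y: "\<And>t. 0 \<le> t \<Longrightarrow> Y t \<in> borel_measurable M"
    and cont: "\<And>w. w \<in> space M \<Longrightarrow> continuous_on {0..} (\<lambda>t. Y t w)" and c: "0 < c"
  shows "(\<lambda>w. drawdown_time c (\<lambda>t. Y t w)) \<in> borel_measurable M"
proof (rule borel_measurableI_le)
  fix y :: ereal
  show "{w \<in> space M. drawdown_time c (\<lambda>t. Y t w) \<le> y} \<in> events"
  proof (cases y)
    case (real t)
    have cnt: "countable (\<rat> \<inter> {0..t})"
      using countable_rat by (rule countable_subset[rotated]) auto
    have "{w \<in> space M. drawdown_time c (\<lambda>t. Y t w) \<le> y} =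
      {w \<in> space M. \<forall>n. \<exists>u\<in>\<rat> \<inter> {0..t}. \<exists>v\<in>\<rat> \<inter> {0..t}. u \<le> v \<and> c - 1 / real (Suc n) < Y u w - Y v w}"
      using rational_drawdown[OF cont c] real by (simp cong: conj_cong)
    also have "\<dots> \<in> events"
    proof (intro sets.sets_Collect_countable_All sets.sets_Collect_countable_Ex' cnt)
      fix u v n assume "u \<in> \<rat> \<inter> {0..t}" "v \<in> \<rat> \<inter> {0..t}"
      then have [measurable]: "Y u \<in> borel_measurable M" "Y v \<in> borel_measurable M" using Y by auto
      show "{w \<in> space M. u \<le> v \<and> c - 1 / real (Suc n) < Y u w - Y v w} \<in> events" by measurable
    qed
    finally show ?thesis .
  next
    case MInf
    have "\<not> drawdown_time c (\<lambda>t. Y t w) \<le> y" for w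
      unfolding MInf using drawdown_time_nonneg[of c "\<lambda>t. Y t w"] by auto
    then have "{w \<in> space M. drawdown_time c (\<lambda>t. Y t w) \<le> y} = {}" by blast
    then show ?thesis by (simp only: sets.empty_sets)
  qed simp
qed

lemma first_drawdown_event:
  assumes "0 < a" "0 < b"
  shows "first_drawdown a b \<in> events"
proof -
  have [measurable]: "(\<lambda>w. drawdown_time a (path w)) \<in> borel_measurable M"
    using assms by (intro drawdown_time_measurable Z_continuous) auto
  have [measurable]: "(\<lambda>w. drawup_time b (path w)) \<in> borel_measurable M"
    unfolding drawup_time_eq using assms
    by (intro drawdown_time_measurable continuous_on_minus Z_continuous) auto
  show ?thesis by measurable
qed

lemma first_drawdown_ge:
  assumes \<epsilon>: "0 < \<epsilon>" and ab: "0 < a" "0 < b" "a \<le> real k * \<epsilon>" "(real l + 1) * \<epsilon> \<le> b"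
    and lim: "(\<lambda>n. walk_prob (p_up \<epsilon>) (p_down \<epsilon>) k l n 0 0) \<longlonglongrightarrow> \<phi>"
  shows "\<phi> \<le> prob (first_drawdown a b)"
proof (rule LIMSEQ_le_const2[OF lim], intro exI allI impI)
  fix n
  show "walk_prob (p_up \<epsilon>) (p_down \<epsilon>) k l n 0 0 \<le> prob (first_drawdown a b)"
    unfolding prob_walk_event_start(2)[OF \<epsilon>, symmetric]
  proof (rule finite_measure_mono[OF _ first_drawdown_event[OF ab(1,2)]], rule subsetI)
    fix w assume w: "w \<in> {w \<in> space M. walk_event (path w) \<epsilon> k l (ereal (e w)) n 0 0 0 0}"
    then have sp: "w \<in> space M" and ev: "walk_event (path w) \<epsilon> k l (ereal (e w)) n 0 (path w 0) 0 0"
      by simp_all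
    show "w \<in> first_drawdown a b"
      using sp walk_event_imp_drawdown_first[OF Z_continuous[OF sp] \<epsilon> ab(3,4) ev] by blast
  qed
qed

text \<open>The number of steps needed depends on the path, so the event is only covered by the
  increasing union over \<open>n\<close>, whose probability is the limit
  \<open>\<phi>\<close>.\<close>

lemma first_drawdown_le:
  assumes \<epsilon>: "0 < \<epsilon>" and ab: "0 < a" "0 < b" "(real k + 1) * \<epsilon> \<le> a" "b \<le> real l * \<epsilon>"
    and lim: "(\<lambda>n. walk_prob (p_up \<epsilon>) (p_down \<epsilon>) k l n 0 0) \<longlonglongrightarrow> \<phi>"
  shows "prob (first_drawdown a b) \<le> \<phi>"
proof -
  define A where "A n = {w \<in> space M. walk_event (path w) \<epsilon> k l (ereal (e w)) n 0 0 0 0}" for n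
  have A: "A n \<in> events" for n unfolding A_def by (rule prob_walk_event_start(1)[OF \<epsilon>])
  have "incseq A" unfolding incseq_Suc_iff A_def using walk_event_Suc by blast
  then have "(\<lambda>n. prob (A n)) \<longlonglongrightarrow> prob (\<Union>n. A n)"
    using A by (intro finite_Lim_measure_incseq) auto
  moreover have "(\<lambda>n. prob (A n)) \<longlonglongrightarrow> \<phi>"
    unfolding A_def prob_walk_event_start(2)[OF \<epsilon>] by (rule lim)
  ultimately have "prob (\<Union>n. A n) = \<phi>" by (rule LIMSEQ_unique)
  moreover have "first_drawdown a b \<subseteq> (\<Union>n. A n)"
  proof
    fix w assume w: "w \<in> first_drawdown a b"
    then have sp: "w \<in> space M" by simp
    from w obtain n where "walk_event (path w) \<epsilon> k l (ereal (e w)) n 0 (path w 0) 0 0"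
      using drawdown_first_imp_walk_event[OF Z_continuous[OF sp] \<epsilon> ab(3,4), of "e w"] by blast
    then have "w \<in> A n" using sp by (simp add: A_def)
    then show "w \<in> (\<Union>n. A n)" by (rule UN_I[OF UNIV_I])
  qed
  moreover have "(\<Union>n. A n) \<in> events" using A by (intro sets.countable_UN) auto
  ultimately show ?thesis using finite_measure_mono[of "first_drawdown a b" "\<Union>n. A n"] by simp
qed

lemma first_drawdown_mono:
  assumes "a \<le> a'" "b' \<le> b" "0 < a" "0 < b"
  shows "prob (first_drawdown a' b') \<le> prob (first_drawdown a b)"
proof (rule finite_measure_mono[OF _ first_drawdown_event[OF assms(3,4)]], rule subsetI)
  fix w assume w: "w \<in> first_drawdown a' b'"
  then have x: "continuous_on {0..} (path w)" using Z_continuous by blast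
  obtain u t where ut: "0 \<le> u" "u \<le> t" "ereal t < ereal (e w)" "a' \<le> Z u w - Z t w"
    and up: "\<forall>u v. 0 \<le> u \<longrightarrow> u \<le> v \<longrightarrow> v \<le> t \<longrightarrow> Z v w - Z u w < b'"
    using w unfolding mem_Collect_eq drawdown_time_less_iff[OF x] by blast
  have "\<forall>u v. 0 \<le> u \<longrightarrow> u \<le> v \<longrightarrow> v \<le> t \<longrightarrow> Z v w - Z u w < b"
    using up assms(2) order_less_le_trans by blast
  moreover have "a \<le> Z u w - Z t w" using ut(4) assms(1) by simp
  ultimately have "drawdown_time a (path w) < min (drawup_time b (path w)) (ereal (e w))"
    unfolding drawdown_time_less_iff[OF x] using ut(1-3) by blast
  then show "w \<in> first_drawdown a b" using w by simp
qed

text \<open>Rounding one level up and the other down gives bounds from below and from above, both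
  with limit \<open>L\<close>. The conditional hypotheses let one proof serve both orders of
  \<open>a\<close> and \<open>b\<close>; \<open>a \<noteq> b\<close> keeps the rounded levels in the
  same order.\<close>

lemma first_drawdown_squeeze:
  fixes \<phi> :: "real \<Rightarrow> nat \<Rightarrow> nat \<Rightarrow> real"
  assumes ab: "0 < a" "0 < b" "a \<noteq> b"
    and \<phi>: "\<And>\<epsilon> k l. 0 < \<epsilon> \<Longrightarrow> 0 < k \<Longrightarrow> 0 < l \<Longrightarrow> (b < a \<Longrightarrow> l \<le> k) \<Longrightarrow> (a < b \<Longrightarrow> k < l) \<Longrightarrow>
      (\<lambda>n. walk_prob (p_up \<epsilon>) (p_down \<epsilon>) k l n 0 0) \<longlonglongrightarrow> \<phi> \<epsilon> k l"
    and lim: "\<And>\<epsilon> k l. \<epsilon> \<longlonglongrightarrow> 0 \<Longrightarrow> (\<And>n. 0 < \<epsilon> n) \<Longrightarrow> (\<And>n. 0 < k n) \<Longrightarrow> (\<And>n. 0 < l n) \<Longrightarrow>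
      (\<And>n. b < a \<Longrightarrow> l n \<le> k n) \<Longrightarrow> (\<And>n. a < b \<Longrightarrow> k n < l n) \<Longrightarrow>
      (\<lambda>n. real (k n) * \<epsilon> n) \<longlonglongrightarrow> a \<Longrightarrow> (\<lambda>n. real (l n) * \<epsilon> n) \<longlonglongrightarrow> b \<Longrightarrow>
      (\<lambda>n. \<phi> (\<epsilon> n) (k n) (l n)) \<longlonglongrightarrow> L"
  shows "prob (first_drawdown a b) = L"
proof -
  define m where "m = min (min a b) \<bar>a - b\<bar>"
  have m: "0 < m" using ab by (simp add: m_def)
  \<comment> \<open>The 4 makes \<open>a\<close>, \<open>b\<close> and their distance at least four
    meshes wide: rounding moves a level by at most 1 up and 2 down, so levels stay positive and
    ordered, strictly where required.\<close>
  define \<epsilon> where "\<epsilon> n = m / (4 * real (Suc n))" for n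
  have \<epsilon>: "0 < \<epsilon> n" for n using m by (simp add: \<epsilon>_def)
  have m4: "4 \<le> x / \<epsilon> n" if "m \<le> x" for x n
  proof -
    have "4 * \<epsilon> n = m / real (Suc n)" by (simp add: \<epsilon>_def del: of_nat_Suc)
    also have "\<dots> \<le> m" using m by (simp add: divide_le_eq)
    finally show ?thesis using \<epsilon>[of n] that by (simp add: pos_le_divide_eq)
  qed
  have "(\<lambda>n. m / 4 / real (Suc n)) \<longlonglongrightarrow> 0"
    by (intro lim_const_over_n[THEN LIMSEQ_Suc])
  then have \<epsilon>0: "\<epsilon> \<longlonglongrightarrow> 0" unfolding \<epsilon>_def by simp
  define U where "U x n = nat \<lceil>x / \<epsilon> n\<rceil>" for x n
  \<comment> \<open>The extra \<open>- 1\<close> gives \<open>(D + 1) * \<epsilon> \<le> x\<close>,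
    the slack of one mesh that both comparisons of walk and path need.\<close>
  define D where "D x n = nat \<lfloor>x / \<epsilon> n\<rfloor> - 1" for x n
  have U: "x / \<epsilon> n \<le> real (U x n)" "real (U x n) \<le> x / \<epsilon> n + 1" if "m \<le> x" for x n
    using m4[OF that, of n] unfolding U_def by linarith+
  have D: "x / \<epsilon> n - 2 \<le> real (D x n)" "real (D x n) \<le> x / \<epsilon> n - 1" if "m \<le> x" for x n
  proof -
    have f: "4 \<le> \<lfloor>x / \<epsilon> n\<rfloor>" using m4[OF that, of n] by (simp add: le_floor_iff)
    define k where "k = nat \<lfloor>x / \<epsilon> n\<rfloor>"
    have k: "real k = of_int \<lfloor>x / \<epsilon> n\<rfloor>" "1 \<le> k" using f unfolding k_def by linarith+
    have "real (D x n) = of_int \<lfloor>x / \<epsilon> n\<rfloor> - 1"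
      unfolding D_def k_def[symmetric] k(1)[symmetric] using k(2) by (simp add: of_nat_diff)
    then show "x / \<epsilon> n - 2 \<le> real (D x n)" "real (D x n) \<le> x / \<epsilon> n - 1" by linarith+
  qed
  have mab: "m \<le> a" "m \<le> b" "m \<le> \<bar>a - b\<bar>" by (auto simp: m_def)
  have pos: "0 < U x n" "0 < D x n" if "m \<le> x" for x n
    using U[OF that, of n] D[OF that, of n] m4[OF that, of n] by linarith+
  have gap: "4 \<le> (a - b) / \<epsilon> n" if "b < a" for n using m4[of "a - b" n] mab that by simp
  have gap': "4 \<le> (b - a) / \<epsilon> n" if "a < b" for n using m4[of "b - a" n] mab that by simp
  have ord: "D b n \<le> U a n" "U b n \<le> D a n" if "b < a" for n
    using gap[OF that, of n] U[OF mab(1), of n] D[OF mab(1), of n] U[OF mab(2), of n] D[OF mab(2), of n]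
    unfolding diff_divide_distrib by linarith+
  have ord': "U a n < D b n" "D a n < U b n" if "a < b" for n
    using gap'[OF that, of n] U[OF mab(1), of n] D[OF mab(1), of n] U[OF mab(2), of n] D[OF mab(2), of n]
    unfolding diff_divide_distrib by linarith+
  have scale: "x \<le> real (U x n) * \<epsilon> n" "real (U x n) * \<epsilon> n \<le> x + \<epsilon> n"
    "x - 2 * \<epsilon> n \<le> real (D x n) * \<epsilon> n" "(real (D x n) + 1) * \<epsilon> n \<le> x" if "m \<le> x" for x n
  proof -
    have e: "x / \<epsilon> n * \<epsilon> n = x" using \<epsilon>[of n] by simp
    show "x \<le> real (U x n) * \<epsilon> n"
      using mult_right_mono[OF U(1)[OF that] less_imp_le[OF \<epsilon>], of n n] e by simp
    show "real (U x n) * \<epsilon> n \<le> x + \<epsilon> n"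
      using mult_right_mono[OF U(2)[OF that] less_imp_le[OF \<epsilon>], of n n] unfolding distrib_right e by simp
    show "x - 2 * \<epsilon> n \<le> real (D x n) * \<epsilon> n"
      using mult_right_mono[OF D(1)[OF that] less_imp_le[OF \<epsilon>], of n n] unfolding left_diff_distrib e by simp
    show "(real (D x n) + 1) * \<epsilon> n \<le> x"
      using mult_right_mono[OF D(2)[OF that] less_imp_le[OF \<epsilon>], of n n] unfolding left_diff_distrib distrib_right e by simp
  qed
  have limU: "(\<lambda>n. real (U x n) * \<epsilon> n) \<longlonglongrightarrow> x" if "m \<le> x" for x
  proof (rule tendsto_sandwich[OF _ _ tendsto_const])
    show "(\<lambda>n. x + \<epsilon> n) \<longlonglongrightarrow> x" using tendsto_add[OF tendsto_const \<epsilon>0, of x] by simp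
  qed (use scale[OF that] in auto)
  have limD: "(\<lambda>n. real (D x n) * \<epsilon> n) \<longlonglongrightarrow> x" if "m \<le> x" for x
  proof (rule tendsto_sandwich[OF _ _ _ tendsto_const])
    show "(\<lambda>n. x - 2 * \<epsilon> n) \<longlonglongrightarrow> x"
      using tendsto_diff[OF tendsto_const tendsto_mult_right_zero[OF \<epsilon>0], of x 2] by simp
    have "real (D x n) * \<epsilon> n \<le> x" for n
      using scale(4)[OF that, of n] \<epsilon>[of n] unfolding distrib_right by linarith
    then show "\<forall>\<^sub>F n in sequentially. real (D x n) * \<epsilon> n \<le> x" by simp
  qed (use scale[OF that] in auto)
  have "\<phi> (\<epsilon> n) (U a n) (D b n) \<le> prob (first_drawdown a b)" for n
    by (rule first_drawdown_ge[OF \<epsilon> ab(1,2) scale(1)[OF mab(1)] scale(4)[OF mab(2)]],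
        rule \<phi>[OF \<epsilon> pos(1)[OF mab(1)] pos(2)[OF mab(2)] ord(1) ord'(1)])
  moreover have "(\<lambda>n. \<phi> (\<epsilon> n) (U a n) (D b n)) \<longlonglongrightarrow> L"
    by (rule lim[OF \<epsilon>0 \<epsilon> pos(1)[OF mab(1)] pos(2)[OF mab(2)] ord(1) ord'(1) limU[OF mab(1)] limD[OF mab(2)]])
  ultimately have 1: "L \<le> prob (first_drawdown a b)" by (intro LIMSEQ_le_const2) auto
  have "prob (first_drawdown a b) \<le> \<phi> (\<epsilon> n) (D a n) (U b n)" for n
    by (rule first_drawdown_le[OF \<epsilon> ab(1,2) scale(4)[OF mab(1)] scale(1)[OF mab(2)]],
        rule \<phi>[OF \<epsilon> pos(2)[OF mab(1)] pos(1)[OF mab(2)] ord(2) ord'(2)])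
  moreover have "(\<lambda>n. \<phi> (\<epsilon> n) (D a n) (U b n)) \<longlonglongrightarrow> L"
    by (rule lim[OF \<epsilon>0 \<epsilon> pos(2)[OF mab(1)] pos(1)[OF mab(2)] ord(2) ord'(2) limD[OF mab(1)] limU[OF mab(2)]])
  ultimately have 2: "prob (first_drawdown a b) \<le> L" by (intro LIMSEQ_le_const) auto
  show ?thesis using 1 2 by simp
qed

section \<open>Limiting values, with \<open>d\<close> standing for \<delta> or for -
  \<delta>\<close>

definition first_value :: "real \<Rightarrow> real \<Rightarrow> real \<Rightarrow> real" where
  "first_value d a b = exp (- (a - b) * (d + \<gamma> * coth (\<gamma> * b))) *
      (\<gamma>\<^sup>2 / (\<gamma>\<^sup>2 - d\<^sup>2) * ((exp (- d * b) * (sinh (\<gamma> * b) * (d / \<gamma>) + cosh (\<gamma> * b)) - 1)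
        / (sinh (\<gamma> * b) * sinh (\<gamma> * b))))"

definition hit_value :: "real \<Rightarrow> real \<Rightarrow> real" where
  "hit_value d a = exp (- d * a) / (sinh (\<gamma> * a) * (- d / \<gamma>) + cosh (\<gamma> * a))"

lemma tilted: "0 < \<epsilon> \<Longrightarrow> tilted_walk (\<gamma> * \<epsilon>) (exp (- (\<delta> * \<epsilon>)))"
  by (rule tilted_walk_exp[OF delta_less_gamma])

lemma tilted': "0 < \<epsilon> \<Longrightarrow> tilted_walk (\<gamma> * \<epsilon>) (exp (- (- \<delta> * \<epsilon>)))"
  using delta_less_gamma by (intro tilted_walk_exp) auto

lemma tilted_up_down:
  assumes "0 < \<epsilon>"
  shows "tilted_walk.up (\<gamma> * \<epsilon>) (exp (- (\<delta> * \<epsilon>))) = p_up \<epsilon>"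
    "tilted_walk.down (\<gamma> * \<epsilon>) (exp (- (\<delta> * \<epsilon>))) = p_down \<epsilon>"
  using tilted_walk.up_def[OF tilted[OF assms]] tilted_walk.down_def[OF tilted[OF assms]]
  by (simp_all add: p_up_def p_down_def)

lemma prob_first_drawdown_gt:
  assumes "0 < b" "b < a"
  shows "prob (first_drawdown a b) = first_value \<delta> a b"
proof (rule first_drawdown_squeeze[where \<phi> = "\<lambda>\<epsilon> k l. tilted_walk.drawdown_first (\<gamma> * \<epsilon>) (exp (- (\<delta> * \<epsilon>))) k l 0 0"])
  fix \<epsilon> :: real and k l :: nat
  assume "0 < \<epsilon>" "0 < l" "b < a \<Longrightarrow> l \<le> k"
  then show "(\<lambda>n. walk_prob (p_up \<epsilon>) (p_down \<epsilon>) k l n 0 0) \<longlonglongrightarrow>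
      tilted_walk.drawdown_first (\<gamma> * \<epsilon>) (exp (- (\<delta> * \<epsilon>))) k l 0 0"
    using tilted_walk.walk_prob_drawdown_first[OF tilted, of \<epsilon> l k] assms(2) by (simp add: tilted_up_down)
next
  fix \<epsilon> :: "nat \<Rightarrow> real" and k l :: "nat \<Rightarrow> nat"
  assume \<epsilon>: "\<epsilon> \<longlonglongrightarrow> 0" "\<And>n. 0 < \<epsilon> n" and l: "\<And>n. 0 < l n" "\<And>n. b < a \<Longrightarrow> l n \<le> k n"
    and lim: "(\<lambda>n. real (k n) * \<epsilon> n) \<longlonglongrightarrow> a" "(\<lambda>n. real (l n) * \<epsilon> n) \<longlonglongrightarrow> b"
  interpret E: mesh \<gamma> \<delta> \<epsilon> using delta_less_gamma \<epsilon> by unfold_locales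
  show "(\<lambda>n. tilted_walk.drawdown_first (\<gamma> * \<epsilon> n) (exp (- (\<delta> * \<epsilon> n))) (k n) (l n) 0 0) \<longlonglongrightarrow> first_value \<delta> a b"
    unfolding first_value_def using assms l by (intro E.lim_drawdown_first lim) auto
qed (use assms in auto)

lemma prob_first_drawdown_less:
  assumes "0 < a" "a < b"
  shows "prob (first_drawdown a b) = hit_value \<delta> a * (1 - first_value (- \<delta>) b a)"
proof (rule first_drawdown_squeeze[where \<phi> = "\<lambda>\<epsilon> k l. tilted_walk.drawdown_start (\<gamma> * \<epsilon>) (exp (- (\<delta> * \<epsilon>))) k
      * (1 - tilted_walk.drawdown_first (\<gamma> * \<epsilon>) (exp (- (- \<delta> * \<epsilon>))) l k 0 0)"])
  fix \<epsilon> :: real and k l :: nat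
  assume *: "0 < \<epsilon>" "0 < k" "a < b \<Longrightarrow> k < l"
  have inv: "1 / exp (- (\<delta> * \<epsilon>)) = exp (- (- \<delta> * \<epsilon>))" by (simp add: exp_minus inverse_eq_divide)
  show "(\<lambda>n. walk_prob (p_up \<epsilon>) (p_down \<epsilon>) k l n 0 0) \<longlonglongrightarrow>
      tilted_walk.drawdown_start (\<gamma> * \<epsilon>) (exp (- (\<delta> * \<epsilon>))) k
      * (1 - tilted_walk.drawdown_first (\<gamma> * \<epsilon>) (exp (- (- \<delta> * \<epsilon>))) l k 0 0)"
    using walk_prob_drawdown_second[OF tilted[OF *(1)], unfolded inv, OF tilted'[OF *(1)] *(2) *(3)[OF assms(2)]]
    unfolding tilted_up_down[OF *(1)] .
next
  fix \<epsilon> :: "nat \<Rightarrow> real" and k l :: "nat \<Rightarrow> nat"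
  assume \<epsilon>: "\<epsilon> \<longlonglongrightarrow> 0" "\<And>n. 0 < \<epsilon> n" and k: "\<And>n. 0 < k n" "\<And>n. a < b \<Longrightarrow> k n < l n"
    and lim: "(\<lambda>n. real (k n) * \<epsilon> n) \<longlonglongrightarrow> a" "(\<lambda>n. real (l n) * \<epsilon> n) \<longlonglongrightarrow> b"
  interpret E: mesh \<gamma> \<delta> \<epsilon> using delta_less_gamma \<epsilon> by unfold_locales
  interpret E': mesh \<gamma> "- \<delta>" \<epsilon> using delta_less_gamma \<epsilon> by unfold_locales auto
  have kl: "k n \<le> l n" for n using k(2)[OF assms(2), of n] by simp
  show "(\<lambda>n. tilted_walk.drawdown_start (\<gamma> * \<epsilon> n) (exp (- (\<delta> * \<epsilon> n))) (k n)
      * (1 - tilted_walk.drawdown_first (\<gamma> * \<epsilon> n) (exp (- (- \<delta> * \<epsilon> n))) (l n) (k n) 0 0))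
      \<longlonglongrightarrow> hit_value \<delta> a * (1 - first_value (- \<delta>) b a)"
    unfolding first_value_def hit_value_def
    by (intro tendsto_mult tendsto_diff tendsto_const E.lim_drawdown_start E'.lim_drawdown_first lim k(1) kl assms(1))
qed (use assms in auto)

text \<open>The limits on the diagonal of the formulas for \<open>b < a\<close> and for
  \<open>a < b\<close> agree. The inputs are \<open>cosh_square_eq\<close> and
  \<open>k * (1 - r * r) = 1\<close>.\<close>

lemma first_value_diag:
  assumes a: "0 < a"
  shows "first_value \<delta> a a = hit_value \<delta> a * (1 - first_value (- \<delta>) a a)"
proof -
  define s c E r where "s = sinh (\<gamma> * a)" and "c = cosh (\<gamma> * a)" and "E = exp (\<delta> * a)" and "r = \<delta> / \<gamma>"
  define k where "k = \<gamma>\<^sup>2 / (\<gamma>\<^sup>2 - \<delta>\<^sup>2)"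
  have s: "0 < s" using a gamma_pos by (simp add: s_def)
  have cs: "c * c = s * s + 1" using cosh_square_eq[of "\<gamma> * a"] by (simp add: c_def s_def power2_eq_square)
  have r: "\<bar>r\<bar> < 1" unfolding r_def using delta_less_gamma gamma_pos by (simp add: abs_divide)
  have c: "s < c" unfolding s_def c_def by (simp add: sinh_less_cosh_real)
  have E: "0 < E" by (simp add: E_def)
  have den: "0 < c - s * r"
  proof -
    have "s * r \<le> s * 1" using r s by (intro mult_left_mono) auto
    then show ?thesis using c by simp
  qed
  have kr: "k * (1 - r * r) = 1"
  proof -
    have "\<gamma>\<^sup>2 - \<delta>\<^sup>2 \<noteq> 0" using delta_less_gamma abs_le_square_iff[of \<gamma> \<delta>] by auto
    moreover have "1 - r * r = (\<gamma>\<^sup>2 - \<delta>\<^sup>2) / \<gamma>\<^sup>2"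
      using gamma_pos by (simp add: r_def power2_eq_square diff_divide_distrib)
    ultimately show ?thesis using gamma_pos by (simp add: k_def)
  qed
  have f1: "first_value \<delta> a a = k * ((1 / E * (s * r + c) - 1) / (s * s))"
    by (simp add: first_value_def k_def s_def c_def E_def r_def exp_minus inverse_eq_divide)
  have f2: "first_value (- \<delta>) a a = k * ((E * (c - s * r) - 1) / (s * s))"
    by (simp add: first_value_def k_def s_def c_def E_def r_def)
  have h: "hit_value \<delta> a = 1 / (E * (c - s * r))"
    by (simp add: hit_value_def s_def c_def E_def r_def exp_minus inverse_eq_divide)
  define y where "y = c - s * r"
  have y: "y \<noteq> 0" using den by (simp add: y_def)
  \<comment> \<open>The denominator \<open>y\<close> of \<open>hit_value\<close> is conjugate to the
    factor in \<open>first_value\<close>; \<open>k\<close> times their product is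
    \<open>k + s * s\<close>.\<close>
  have "(s * r + c) * y = c * c - s * s * (r * r)" unfolding y_def by (simp add: algebra_simps)
  also have "\<dots> = s * s + 1 - s * s * (r * r)" unfolding cs ..
  finally have "k * ((s * r + c) * y) = k * (s * s + 1 - s * s * (r * r))" by (rule arg_cong)
  also have "\<dots> = k + s * s * (k * (1 - r * r))" by (simp add: algebra_simps)
  finally have main: "k * (s * r + c) * y = k + s * s" unfolding kr by (simp only: mult.assoc mult_1_right)
  have "(1 / (E * y)) * (1 - k * ((E * y - 1) / (s * s))) = ((s * s + k) - k * (E * y)) / (E * y * (s * s))"
    using s E y by (simp add: field_simps)
  also have "\<dots> = (k * (s * r + c) * y - k * (E * y)) / (E * y * (s * s))"
    unfolding main by (simp add: add.commute)
  also have "\<dots> = y * (k * (s * r + c) - k * E) / (y * (E * (s * s)))" by (simp add: algebra_simps)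
  also have "\<dots> = (k * (s * r + c) - k * E) / (E * (s * s))" using y by (rule nonzero_mult_divide_mult_cancel_left)
  also have "\<dots> = k * ((1 / E * (s * r + c) - 1) / (s * s))" using s E by (simp add: field_simps)
  finally show ?thesis unfolding f1 f2 h y_def by simp
qed

text \<open>
  For \<open>a = b\<close> the upper and the lower lattice approximation fall on different sides of the
  diagonal, so this case follows by monotonicity from the two others.
\<close>

lemma prob_first_drawdown_eq:
  assumes a: "0 < a"
  shows "prob (first_drawdown a a) = first_value \<delta> a a"
proof -
  define t where "t n = a + 1 / real (Suc n)" for n
  have t: "a < t n" for n by (simp add: t_def)
  have "(\<lambda>n. a + 1 / real (Suc n)) \<longlonglongrightarrow> a + 0"
    by (intro tendsto_add tendsto_const lim_const_over_n[THEN LIMSEQ_Suc])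
  then have lim: "t \<longlonglongrightarrow> a" by (simp add: t_def[abs_def])
  have fv: "(\<lambda>n. first_value d (t n) a) \<longlonglongrightarrow> first_value d a a" for d
    unfolding first_value_def
    by (intro tendsto_mult tendsto_exp tendsto_minus tendsto_diff lim tendsto_const)
  have "first_value \<delta> (t n) a \<le> prob (first_drawdown a a)" for n
    using first_drawdown_mono[of a "t n" a a] prob_first_drawdown_gt[OF a t[of n]] t[of n] a by simp
  then have "first_value \<delta> a a \<le> prob (first_drawdown a a)"
    using fv by (intro LIMSEQ_le_const2[OF fv]) auto
  moreover have "prob (first_drawdown a a) \<le> hit_value \<delta> a * (1 - first_value (- \<delta>) (t n) a)" for n
    using first_drawdown_mono[of a a a "t n"] prob_first_drawdown_less[OF a t[of n]] t[of n] a by simp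
  then have "prob (first_drawdown a a) \<le> hit_value \<delta> a * (1 - first_value (- \<delta>) a a)"
    by (intro LIMSEQ_le_const[where X = "\<lambda>n. hit_value \<delta> a * (1 - first_value (- \<delta>) (t n) a)"]
        tendsto_mult tendsto_diff tendsto_const fv) auto
  ultimately show ?thesis using first_value_diag[OF a] by simp
qed

text \<open>Since \<open>\<gamma>\<^sup>2 - d\<^sup>2 = 2 * q / \<sigma>\<^sup>2\<close>, the
  prefactor becomes \<open>\<sigma>\<^sup>2 * \<gamma> / (2 * q)\<close> times one more \<gamma>,
  which moves into the bracket.\<close>

lemma first_value_eq:
  assumes b: "0 < b" and d: "d\<^sup>2 = \<delta>\<^sup>2"
  shows "first_value d a b = \<sigma>\<^sup>2 * \<gamma> / (2 * q)
         * (exp (- d * b) * (\<gamma> * coth (\<gamma> * b) + d) / sinh (\<gamma> * b) - \<gamma> / (sinh (\<gamma> * b))\<^sup>2)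
         * exp (- (a - b) * (d + \<gamma> * coth (\<gamma> * b)))"
proof -
  define s c E where "s = sinh (\<gamma> * b)" and "c = cosh (\<gamma> * b)" and "E = exp (- d * b)"
  have s: "s \<noteq> 0" using b gamma_pos by (simp add: s_def)
  have "\<gamma>\<^sup>2 - d\<^sup>2 = 2 * q / \<sigma>\<^sup>2" unfolding d gamma_square by simp
  then have k: "\<gamma>\<^sup>2 / (\<gamma>\<^sup>2 - d\<^sup>2) = \<sigma>\<^sup>2 * \<gamma> / (2 * q) * \<gamma>"
    using sigma q by (simp add: power2_eq_square)
  have "\<gamma> * ((E * (s * (d / \<gamma>) + c) - 1) / (s * s)) = (E * (s * d + \<gamma> * c) - \<gamma>) / (s * s)"
    using gamma_pos s by (simp add: field_simps)
  also have "\<dots> = E * (\<gamma> * (c / s) + d) / s - \<gamma> / s\<^sup>2"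
    using s by (simp add: field_simps power2_eq_square)
  finally have "\<gamma> * ((E * (s * (d / \<gamma>) + c) - 1) / (s * s)) = E * (\<gamma> * (c / s) + d) / s - \<gamma> / s\<^sup>2" .
  note eq = this
  have "x * (y * \<gamma> * z) = y * (\<gamma> * z) * x" for x y z :: real by (simp only: mult_ac)
  then show ?thesis
    unfolding first_value_def k coth_def s_def[symmetric] c_def[symmetric] E_def[symmetric] eq[symmetric] .
qed

lemma hit_value_eq:
  "hit_value \<delta> a * v = v / (\<gamma> * cosh (\<gamma> * a) - \<delta> * sinh (\<gamma> * a)) * (\<gamma> * exp (- \<delta> * a))"
proof -
  have "\<gamma> * (sinh (\<gamma> * a) * (- \<delta> / \<gamma>) + cosh (\<gamma> * a)) = \<gamma> * cosh (\<gamma> * a) - \<delta> * sinh (\<gamma> * a)"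
    using gamma_pos by (simp add: right_diff_distrib)
  then have "hit_value \<delta> a = \<gamma> * exp (- \<delta> * a) / (\<gamma> * cosh (\<gamma> * a) - \<delta> * sinh (\<gamma> * a))"
    unfolding hit_value_def using gamma_pos by (metis mult_divide_mult_cancel_left less_irrefl)
  then show ?thesis by simp
qed

text \<open>The event depends on increments only, so the shift from \<open>X\<close> to
  \<open>Z\<close> leaves it unchanged on every path.\<close>

lemma first_drawdown_X:
  "{w \<in> space M. drawdown_time a (\<lambda>t. X t w) < min (drawup_time b (\<lambda>t. X t w)) (ereal (e w))}
    = first_drawdown a b"
proof (rule Collect_cong, rule conj_cong[OF refl])
  fix w assume w: "w \<in> space M"
  have cX: "continuous_on {0..} (\<lambda>t. X t w)"
    unfolding X_def by (intro continuous_intros continuous_paths w)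
  show "drawdown_time a (\<lambda>t. X t w) < min (drawup_time b (\<lambda>t. X t w)) (ereal (e w))
    \<longleftrightarrow> drawdown_time a (path w) < min (drawup_time b (path w)) (ereal (e w))"
    unfolding drawdown_time_less_iff[OF cX] drawdown_time_less_iff[OF Z_continuous[OF w]]
    by (simp add: Z_def)
qed

theorem prob_drawdown_before_smaller_drawup:
  assumes "b \<le> a" "0 < b"
  shows "\<P>(w in M. drawdown_time a (\<lambda>t. X t w) < min (drawup_time b (\<lambda>t. X t w)) (ereal (e w)))
       = \<sigma>\<^sup>2 * \<gamma> / (2 * q)
         * (exp (- \<delta> * b) * (\<gamma> * coth (\<gamma> * b) + \<delta>) / sinh (\<gamma> * b) - \<gamma> / (sinh (\<gamma> * b))\<^sup>2)
         * exp (- (a - b) * (\<delta> + \<gamma> * coth (\<gamma> * b)))"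
proof -
  have "prob (first_drawdown a b) = first_value \<delta> a b"
    using prob_first_drawdown_gt[of b a] prob_first_drawdown_eq[of b] assms by (cases "a = b") auto
  then show ?thesis
    unfolding first_drawdown_X first_value_eq[OF \<open>0 < b\<close> refl] .
qed

theorem prob_drawdown_before_larger_drawup:
  assumes "a < b" "0 < a"
  shows "\<P>(w in M. drawdown_time a (\<lambda>t. X t w) < min (drawup_time b (\<lambda>t. X t w)) (ereal (e w)))
       = (1 - \<sigma>\<^sup>2 * \<gamma> / (2 * q)
              * (exp (\<delta> * a) * (\<gamma> * coth (\<gamma> * a) - \<delta>) / sinh (\<gamma> * a) - \<gamma> / (sinh (\<gamma> * a))\<^sup>2)
              * exp (- (b - a) * (- \<delta> + \<gamma> * coth (\<gamma> * a))))
         / (\<gamma> * cosh (\<gamma> * a) - \<delta> * sinh (\<gamma> * a)) * (\<gamma> * exp (- \<delta> * a))"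
proof -
  have "prob (first_drawdown a b) = hit_value \<delta> a * (1 - first_value (- \<delta>) b a)"
    using assms by (intro prob_first_drawdown_less)
  also have "first_value (- \<delta>) b a = \<sigma>\<^sup>2 * \<gamma> / (2 * q)
              * (exp (\<delta> * a) * (\<gamma> * coth (\<gamma> * a) - \<delta>) / sinh (\<gamma> * a) - \<gamma> / (sinh (\<gamma> * a))\<^sup>2)
              * exp (- (b - a) * (- \<delta> + \<gamma> * coth (\<gamma> * a)))"
    using first_value_eq[OF \<open>0 < a\<close>, of "- \<delta>" b] by (simp only: power2_minus minus_minus add_uminus_conv_diff)
  finally show ?thesis
    unfolding first_drawdown_X hit_value_eq .
qed

end

subsection \<open>Both orders of the passage times\<close>

theorem corollary6p1:
  fixes M :: "'a measure"
    and B X :: "real \<Rightarrow> 'a \<Rightarrow> real"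
    and e :: "'a \<Rightarrow> real"
    and \<mu> \<sigma> q \<delta> \<gamma> a b :: real
  assumes "standard_brownian_motion M B"
    and "\<mu> \<noteq> 0" and "\<sigma> > 0" and "q > 0"
    and "\<And>t w. X t w = \<mu> * t + \<sigma> * B t w"
    and "distributed M lborel e (exponential_density q)"
    and "prob_space.indep_set M
           (sets (vimage_algebra (space M) (\<lambda>w. \<lambda>t\<in>{0..}. X t w) (\<Pi>\<^sub>M t\<in>{0..}. borel)))
           (sets (vimage_algebra (space M) e borel))"
    and "\<delta> = \<mu> / \<sigma>\<^sup>2"
    and "\<gamma> = sqrt (\<delta>\<^sup>2 + 2 * q / \<sigma>\<^sup>2)"
  shows
    "(a \<ge> b \<and> b > 0 \<longrightarrow>
       \<P>(w in M. drawdown_time a (\<lambda>t. X t w) < min (drawup_time b (\<lambda>t. X t w)) (ereal (e w)))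
       = \<sigma>\<^sup>2 * \<gamma> / (2 * q)
         * (exp (- \<delta> * b) * (\<gamma> * coth (\<gamma> * b) + \<delta>) / sinh (\<gamma> * b)
            - \<gamma> / (sinh (\<gamma> * b))\<^sup>2)
         * exp (- (a - b) * (\<delta> + \<gamma> * coth (\<gamma> * b))))
     \<and>
     (b > a \<and> a > 0 \<longrightarrow>
       \<P>(w in M. drawdown_time a (\<lambda>t. X t w) < min (drawup_time b (\<lambda>t. X t w)) (ereal (e w)))
       = (1 - \<sigma>\<^sup>2 * \<gamma> / (2 * q)
              * (exp (\<delta> * a) * (\<gamma> * coth (\<gamma> * a) - \<delta>) / sinh (\<gamma> * a)
                 - \<gamma> / (sinh (\<gamma> * a))\<^sup>2)
              * exp (- (b - a) * (- \<delta> + \<gamma> * coth (\<gamma> * a))))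
         / (\<gamma> * cosh (\<gamma> * a) - \<delta> * sinh (\<gamma> * a))
         * (\<gamma> * exp (- \<delta> * a)))
     \<and>
     (b \<ge> a \<and> a > 0 \<longrightarrow>
       \<P>(w in M. drawup_time b (\<lambda>t. X t w) < min (drawdown_time a (\<lambda>t. X t w)) (ereal (e w)))
       = \<sigma>\<^sup>2 * \<gamma> / (2 * q)
         * (exp (\<delta> * a) * (\<gamma> * coth (\<gamma> * a) - \<delta>) / sinh (\<gamma> * a)
            - \<gamma> / (sinh (\<gamma> * a))\<^sup>2)
         * exp (- (b - a) * (- \<delta> + \<gamma> * coth (\<gamma> * a))))
     \<and>
     (a > b \<and> b > 0 \<longrightarrow>
       \<P>(w in M. drawup_time b (\<lambda>t. X t w) < min (drawdown_time a (\<lambda>t. X t w)) (ereal (e w)))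
       = (1 - \<sigma>\<^sup>2 * \<gamma> / (2 * q)
              * (exp (- \<delta> * b) * (\<gamma> * coth (\<gamma> * b) + \<delta>) / sinh (\<gamma> * b)
                 - \<gamma> / (sinh (\<gamma> * b))\<^sup>2)
              * exp (- (a - b) * (\<delta> + \<gamma> * coth (\<gamma> * b))))
         / (\<gamma> * cosh (\<gamma> * b) + \<delta> * sinh (\<gamma> * b))
         * (\<gamma> * exp (\<delta> * b)))"
proof -
  interpret standard_brownian_motion M B by fact
  \<comment> \<open>The independence hypothesis concerns the \<sigma>-algebra generated by the whole
    path; the locale asks only that each coordinate be measurable for it.\<close>
  let ?N = "vimage_algebra (space M) (\<lambda>w. \<lambda>t\<in>{0..}. X t w) (\<Pi>\<^sub>M t\<in>{0..}. borel)"
  have N: "X t \<in> borel_measurable ?N" if "0 \<le> t" for t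
  proof -
    have "(\<lambda>w. \<lambda>t\<in>{0..}. X t w) \<in> measurable ?N (\<Pi>\<^sub>M t\<in>{0..}. borel)"
      by (rule measurable_vimage_algebra1) (simp add: space_PiM)
    from measurable_compose[OF this measurable_component_singleton[of t]] that
    show ?thesis by simp
  qed
  interpret K: killed_brownian_motion M B X \<mu> \<sigma> ?N e q
  proof unfold_locales
    show "\<sigma> \<noteq> 0" using assms(3) by simp
    show "X t \<in> borel_measurable ?N" if "0 \<le> t" for t using that by (rule N)
  qed (rule assms space_vimage_algebra)+
  \<comment> \<open>Reflection exchanges drawdown and drawup, so the last two claims are the first
    two for \<open>- X\<close> with \<open>a\<close> and \<open>b\<close> exchanged. The same
    \<open>?N\<close> serves, because \<open>- X\<close> is measurable for it too.\<close>
  interpret R: killed_brownian_motion M B "\<lambda>t w. - X t w" "- \<mu>" "- \<sigma>" ?N e q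
  proof unfold_locales
    show "- X t w = - \<mu> * t + - \<sigma> * B t w" for t w unfolding assms(5) by simp
    show "- \<sigma> \<noteq> 0" using assms(3) by simp
    show "(\<lambda>w. - X t w) \<in> borel_measurable ?N" if "0 \<le> t" for t
      using N[OF that] by (rule borel_measurable_uminus)
  qed (rule assms space_vimage_algebra)+
  have K: "K.\<delta> = \<delta>" "K.\<gamma> = \<gamma>"
    by (simp_all only: K.\<delta>_def K.\<gamma>_def assms(8,9))
  have R: "R.\<delta> = - \<delta>" "R.\<gamma> = \<gamma>"
    by (simp_all only: R.\<delta>_def R.\<gamma>_def assms(8,9) power2_minus power_divide minus_divide_left)
  have swap: "drawup_time c (\<lambda>t. X t w) = drawdown_time c (\<lambda>t. - X t w)"
    "drawdown_time c (\<lambda>t. X t w) = drawup_time c (\<lambda>t. - X t w)" for c w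
    by (simp_all add: drawup_time_eq)
  have m: "x - - y * z = x + y * z" for x y z :: real by simp
  note reflected = R.prob_drawdown_before_smaller_drawup R.prob_drawdown_before_larger_drawup
  note reflected = reflected[unfolded R, unfolded minus_minus power2_minus m diff_minus_eq_add
      add_uminus_conv_diff]
  show ?thesis
  proof ((intro conjI impI; elim conjE), goal_cases)
    case 1
    then show ?case by (rule K.prob_drawdown_before_smaller_drawup[unfolded K])
  next
    case 2
    then show ?case by (rule K.prob_drawdown_before_larger_drawup[unfolded K])
  next
    case 3
    then show ?case unfolding swap by (rule reflected(1))
  next
    case 4
    then show ?case unfolding swap by (rule reflected(2))
  qed
qed

end
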